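(* Let $v>4$ be an integer with prime factorization $v=p_1^{n_1}\cdots p_k^{n_k}$, and let $\#C(v_3)$ denote the number of isomorphism classes of connected cyclic configurations of type $(v_3)$. Then \[ \#C(v_3)=\begin{cases}\frac{v}{6}\prod_{i=1}^k\big(1+\frac{1}{p_i}\big)+\alpha 2^k-2 & \text{if } v \text{ is odd},\\[1ex] \frac{v}{6}\prod_{i=1}^k\big(1+\frac{1}{p_i}\big)+\beta 2^k-3 & \text{if } v \text{ is even},\end{cases} \] where, for $v$ odd, \[ \alpha=\begin{cases}5/6 & \text{if every } p_i\equiv 1 \pmod 3,\\ 2/3 & \text{if } p_1^{n_1}=3 \text{ and } p_i\equiv 1\pmod 3 \text{ for all } i>1,\\ 1/2 & \text{otherwise},\end{cases} \] and, for $v$ even, \[ \beta=\begin{cases}1/4 & \text{if } v\equiv 2 \text{ or } 6 \pmod 8,\\ 1/2 & \text{if } v\equiv 4\pmod 8,\\ 1 & \text{if } v\equiv 0\pmod 8.\end{cases} \]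
   Context: A (combinatorial) configuration of type $(v_r,b_k)$ is a pair $(P,\mathcal{B})$ where $P$ is a set of $v$ points and $\mathcal{B}$ is a collection of $b$ subsets of $P$ (lines) with $|B_i\cap B_j|\le 1$ for distinct lines, every point lying on exactly $r$ lines, and every line having exactly $k\ge 3$ points. It is balanced, of type $(v_k)$, when $v=b$ (hence $r=k$). It is decomposable if it is the disjoint union of two configurations $(P_1,\mathcal{B}_1),(P_2,\mathcal{B}_2)$ with $P=P_1\cup P_2$, $P_1\cap P_2=\emptyset$, $\mathcal{B}=\mathcal{B}_1\cup\mathcal{B}_2$; otherwise it is connected. An isomorphism between two configurations is a bijection between point sets mapping the set of lines onto the set of lines; an automorphism is an isomorphism of a configuration to itself. A configuration is cyclic if it has an automorphism permuting its points in a single full cycle. The primes $p_1,\dots,p_k$ are distinct and, in the case defining $\alpha=2/3$, the factor $p_1^{n_1}$ is the $3$-part of $v$. *)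

theory Defs
  imports
    Complex_Main
    "HOL-Combinatorics.Orbits"
    "HOL-Computational_Algebra.Primes"
    "HOL-Number_Theory.Cong"
begin

text \<open>
  A configuration is given by its set of points and its set of lines. The point set is
  required to be nonempty: otherwise every configuration would be the disjoint union of
  itself and the empty one, and none would be connected.
\<close>

type_synonym 'a incidence = "'a set \<times> 'a set set"

definition configuration :: "nat \<Rightarrow> nat \<Rightarrow> nat \<Rightarrow> nat \<Rightarrow> 'a incidence \<Rightarrow> bool" where
  "configuration v r b k C \<longleftrightarrow> (case C of (P, \<B>) \<Rightarrow>
     P \<noteq> {} \<and> finite P \<and> card P = v \<and>
     \<B> \<subseteq> Pow P \<and> card \<B> = b \<and>
     (\<forall>B1\<in>\<B>. \<forall>B2\<in>\<B>. B1 \<noteq> B2 \<longrightarrow> card (B1 \<inter> B2) \<le> 1) \<and>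
     (\<forall>x\<in>P. card {B \<in> \<B>. x \<in> B} = r) \<and>
     k \<ge> 3 \<and> (\<forall>B\<in>\<B>. card B = k))"

definition balanced_configuration :: "nat \<Rightarrow> nat \<Rightarrow> 'a incidence \<Rightarrow> bool" where
  "balanced_configuration v k C \<longleftrightarrow> configuration v k v k C"

definition decomposable :: "'a incidence \<Rightarrow> bool" where
  "decomposable C \<longleftrightarrow> (\<exists>P1 \<B>1 P2 \<B>2.
     (\<exists>v r b k. configuration v r b k (P1, \<B>1)) \<and>
     (\<exists>v r b k. configuration v r b k (P2, \<B>2)) \<and>
     P1 \<inter> P2 = {} \<and> C = (P1 \<union> P2, \<B>1 \<union> \<B>2))"

definition connected_configuration :: "'a incidence \<Rightarrow> bool" where
  "connected_configuration C \<longleftrightarrow> \<not> decomposable C"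

definition isomorphism :: "('a \<Rightarrow> 'b) \<Rightarrow> 'a incidence \<Rightarrow> 'b incidence \<Rightarrow> bool" where
  "isomorphism f C D \<longleftrightarrow> bij_betw f (fst C) (fst D) \<and> (`) f ` snd C = snd D"

definition automorphism :: "('a \<Rightarrow> 'a) \<Rightarrow> 'a incidence \<Rightarrow> bool" where
  "automorphism f C \<longleftrightarrow> isomorphism f C C"

definition cyclic_configuration :: "'a incidence \<Rightarrow> bool" where
  "cyclic_configuration C \<longleftrightarrow> (\<exists>f. automorphism f C \<and> cyclic_on f (fst C))"

text \<open>
  Every finite configuration is isomorphic to one whose points are natural numbers, so
  isomorphism classes may be counted among those.
\<close>

definition connected_cyclic_configurations :: "nat \<Rightarrow> nat \<Rightarrow> nat incidence set" where
  "connected_cyclic_configurations v k =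
     {C. balanced_configuration v k C \<and> connected_configuration C \<and> cyclic_configuration C}"

definition isomorphic_on :: "'a incidence set \<Rightarrow> ('a incidence \<times> 'a incidence) set" where
  "isomorphic_on S = {(C, D). C \<in> S \<and> D \<in> S \<and> (\<exists>f. isomorphism f C D)}"

definition num_connected_cyclic :: "nat \<Rightarrow> nat \<Rightarrow> nat" where
  "num_connected_cyclic v k =
     card (connected_cyclic_configurations v k //
           isomorphic_on (connected_cyclic_configurations v k))"

definition alpha :: "nat \<Rightarrow> real" where
  "alpha v =
     (if \<forall>p\<in>prime_factors v. [p = 1] (mod 3) then 5/6
      else if 3 ^ multiplicity 3 v = (3::nat) \<and> (\<forall>p\<in>prime_factors v - {3}. [p = 1] (mod 3))
        then 2/3
      else 1/2)"

text \<open>Only used for even \<open>v\<close>, so that the last case is \<open>v \<equiv> 0 (mod 8)\<close>.\<close>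

definition beta :: "nat \<Rightarrow> real" where
  "beta v =
     (if [v = 2] (mod 8) \<or> [v = 6] (mod 8) then 1/4
      else if [v = 4] (mod 8) then 1/2
      else 1)"

lemma isomorphism_refl: "isomorphism id C C"
  by (simp add: isomorphism_def)

lemma isomorphism_sym:
  assumes "isomorphism f C D" and "snd C \<subseteq> Pow (fst C)"
  shows "isomorphism (inv_into (fst C) f) D C"
proof -
  let ?g = "inv_into (fst C) f"
  have bij: "bij_betw f (fst C) (fst D)" and im: "(`) f ` snd C = snd D"
    using assms(1) by (auto simp: isomorphism_def)
  have "?g ` f ` B = B" if "B \<in> snd C" for B
    using that assms(2) bij by (intro inv_into_image_cancel) (auto simp: bij_betw_def)
  then have "(`) ?g ` (`) f ` snd C = snd C"
    by (simp add: image_image)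
  then show ?thesis
    using bij_betw_inv_into[OF bij] im by (simp add: isomorphism_def)
qed

lemma isomorphism_trans:
  assumes "isomorphism f C D" and "isomorphism g D E"
  shows "isomorphism (g \<circ> f) C E"
proof -
  have "(`) (g \<circ> f) ` snd C = (`) g ` (`) f ` snd C"
    by (auto simp: image_comp image_image)
  then show ?thesis
    using assms by (auto simp: isomorphism_def intro: bij_betw_trans)
qed

lemma configuration_lines: "configuration v r b k C \<Longrightarrow> snd C \<subseteq> Pow (fst C)"
  by (auto simp: configuration_def split: prod.splits)

lemma equiv_isomorphic_on:
  "equiv (connected_cyclic_configurations v k)
     (isomorphic_on (connected_cyclic_configurations v k))"
proof (rule equivI)
  let ?S = "connected_cyclic_configurations v k"
  show "refl_on ?S (isomorphic_on ?S)"
    by (auto simp: refl_on_def isomorphic_on_def intro: isomorphism_refl)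
  show "isomorphic_on ?S \<subseteq> ?S \<times> ?S"
    by (auto simp: isomorphic_on_def)
  show "sym (isomorphic_on ?S)"
  proof (rule symI)
    fix C D assume *: "(C, D) \<in> isomorphic_on ?S"
    then have "snd C \<subseteq> Pow (fst C)"
      using configuration_lines[of v k v k C]
      by (auto simp: isomorphic_on_def connected_cyclic_configurations_def balanced_configuration_def)
    with * show "(D, C) \<in> isomorphic_on ?S"
      using isomorphism_sym unfolding isomorphic_on_def by blast
  qed
  show "trans (isomorphic_on ?S)"
  proof (rule transI)
    fix C D E assume "(C, D) \<in> isomorphic_on ?S" "(D, E) \<in> isomorphic_on ?S"
    then obtain f g where "C \<in> ?S" "E \<in> ?S" "isomorphism f C D" "isomorphism g D E"
      unfolding isomorphic_on_def by blast
    then show "(C, E) \<in> isomorphic_on ?S"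
      using isomorphism_trans[of f C D g E] unfolding isomorphic_on_def by blast
  qed
qed

text \<open>
  The quotient is finite, so that the cardinality used in \<open>num_connected_cyclic\<close> never
  takes the default value 0 of infinite sets.
\<close>

lemma finite_quotient_isomorphic_on:
  "finite (connected_cyclic_configurations v k //
           isomorphic_on (connected_cyclic_configurations v k))"
proof -
  let ?S = "connected_cyclic_configurations v k"
  let ?N = "{0..<v}"
  define F :: "nat set set \<Rightarrow> nat incidence set"
    where "F L = {C \<in> ?S. \<exists>f. isomorphism f C (?N, L)}" for L
  have "X \<in> F ` Pow (Pow ?N)" if X_in: "X \<in> ?S // isomorphic_on ?S" for X
  proof -
    obtain C where C: "C \<in> ?S" and X: "X = isomorphic_on ?S `` {C}"
      using X_in by (rule quotientE)
    have cfg: "configuration v k v k C"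
      using C by (simp add: connected_cyclic_configurations_def balanced_configuration_def)
    then have "finite (fst C)" "card (fst C) = v"
      by (auto simp: configuration_def split: prod.splits)
    then obtain f where f: "bij_betw f (fst C) ?N"
      using ex_bij_betw_finite_nat by blast
    define L where "L = (`) f ` snd C"
    have iso: "isomorphism f C (?N, L)"
      using f by (simp add: isomorphism_def L_def)
    have lines: "L \<subseteq> Pow ?N"
    proof -
      have "f ` B \<subseteq> ?N" if "B \<in> snd C" for B
        using that configuration_lines[OF cfg] f by (auto simp: bij_betw_def)
      then show ?thesis by (auto simp: L_def)
    qed
    have "D \<in> X \<longleftrightarrow> D \<in> F L" for D
    proof
      assume "D \<in> X"
      then have "(C, D) \<in> isomorphic_on ?S"
        using X by simp
      moreover have "sym (isomorphic_on ?S)"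
        using equiv_isomorphic_on by (rule equivE)
      ultimately have "(D, C) \<in> isomorphic_on ?S"
        by (meson symD)
      then have D: "D \<in> ?S" "(D, C) \<in> isomorphic_on ?S"
        unfolding isomorphic_on_def by blast+
      then obtain g where "isomorphism g D C"
        by (auto simp: isomorphic_on_def)
      then show "D \<in> F L"
        using D(1) isomorphism_trans[OF _ iso] unfolding F_def by blast
    next
      assume "D \<in> F L"
      then obtain g where D: "D \<in> ?S" and g: "isomorphism g D (?N, L)"
        by (auto simp: F_def)
      have "snd D \<subseteq> Pow (fst D)"
        using D configuration_lines[of v k v k D]
        by (simp add: connected_cyclic_configurations_def balanced_configuration_def)
      from isomorphism_trans[OF iso isomorphism_sym[OF g this]]
      show "D \<in> X"
        using C D unfolding X isomorphic_on_def by blast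
    qed
    then have "X = F L" by (rule set_eqI)
    then show ?thesis using lines by blast
  qed
  then have "?S // isomorphic_on ?S \<subseteq> F ` Pow (Pow ?N)"
    by (rule subsetI)
  moreover have "finite (F ` Pow (Pow ?N))"
    by simp
  ultimately show ?thesis
    by (rule finite_subset)
qed

end

theory Submission
  imports Defs
    "HOL-Algebra.Group_Action"
    "HOL-Computational_Algebra.Polynomial"
    "HOL-Library.Cardinality"
    "HOL-Number_Theory.Residue_Primitive_Roots"
begin

text \<open>
  A cyclic automorphism identifies the points of a configuration with the integers modulo \<open>v\<close>.
  A line with a nontrivial period is a coset of the subgroup of order 3, and only one such line
  passes through a given point. So there is a line without period, and the configuration consists
  of the translates of this base line. The incidence graph is then a quotient of the hexagonal
  lattice, whose edges are colored by the three points of the base line.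

  The crucial point is that isomorphic configurations have affinely equivalent base lines. The
  faces of the lattice give 6-cycles colored \<open>abcabc\<close>. Further 6-cycles need an extra relation
  between the differences of the base line: either \<open>3 d = 0\<close> for a difference \<open>d\<close>, or
  \<open>2 d = d'\<close> for two cyclically oriented differences. The second relation forces the base line to
  be equivalent to \<open>{0, 1, 3}\<close>, and it is visible in the incidence graph. Without it the faces can
  be recognised well enough to see that an isomorphism permutes the colors in the same way at
  every vertex, and such an isomorphism is affine.

  Hence the classes correspond to orbits of \<open>S\<^sub>3\<close> times the units modulo \<open>v\<close> on primitive
  triples of differences with sum zero. Burnside's lemma counts all orbits: the identity
  contributes the projective line over the integers modulo \<open>v\<close>, transpositions the roots of
  \<open>x\<^sup>2 - 1\<close> and 3-cycles the roots of \<open>x\<^sup>2 + x + 1\<close>. Two orbits, or three if \<open>v\<close> is even, do not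
  come from configurations, namely those of \<open>(0, 1, -1)\<close>, \<open>(1, 1, -2)\<close> and \<open>(v/2, 1, v/2 - 1)\<close>.
\<close>

section \<open>Subgroups of the integers\<close>

lemma int_subgroup_generator:
  fixes H :: "int set"
  assumes "H \<noteq> {}" and diff: "\<And>x y. x \<in> H \<Longrightarrow> y \<in> H \<Longrightarrow> x - y \<in> H"
  obtains g where "H = {x. g dvd x}"
proof (cases "H \<subseteq> {0}")
  case True
  then show ?thesis using that[of 0] \<open>H \<noteq> {}\<close> by auto
next
  case False
  then obtain x where x: "x \<in> H" "x \<noteq> 0" by blast
  have zero: "0 \<in> H" using diff[OF x(1) x(1)] by simp
  have mult: "k * y \<in> H" if "y \<in> H" for k y
  proof (induction k rule: int_induct[of _ 0])
    case (step1 k)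
    then show ?case using diff[of "k * y" "0 - y"] diff[OF zero that] by (simp add: algebra_simps)
  next
    case (step2 k)
    then show ?case using diff[of "k * y" y] that by (simp add: algebra_simps)
  qed (use zero in simp)
  define g where "g = int (LEAST n. n > 0 \<and> int n \<in> H)"
  have "nat \<bar>x\<bar> > 0 \<and> int (nat \<bar>x\<bar>) \<in> H"
    using x mult[of x "-1"] by (auto simp: abs_if)
  then have "(LEAST n. n > 0 \<and> int n \<in> H) > 0 \<and> g \<in> H"
    unfolding g_def by (rule LeastI)
  then have g: "g > 0" "g \<in> H" by (simp_all add: g_def)
  have least: "g \<le> y" if "y > 0" "y \<in> H" for y
    using that Least_le[of "\<lambda>n. n > 0 \<and> int n \<in> H" "nat y"] by (simp add: g_def nat_le_iff)
  have "g dvd y" if "y \<in> H" for y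
  proof -
    have "y mod g = y - (y div g) * g" by (simp add: minus_div_mult_eq_mod)
    then have "y mod g \<in> H" using diff[OF that mult[OF g(2)]] by metis
    then have "y mod g = 0"
      using least[of "y mod g"] g(1) pos_mod_bound[of g y] pos_mod_sign[of g y] by linarith
    then show ?thesis by (simp add: dvd_eq_mod_eq_0)
  qed
  then have "H = {y. g dvd y}" using mult[OF g(2)] by (auto simp: mult.commute elim!: dvdE)
  then show ?thesis by (rule that)
qed

lemma int_subgroup_eq_UNIV:
  fixes H :: "int set"
  assumes "coprime (Gcd X) m" "m \<in> H" "X \<subseteq> H"
    and "\<And>x y. x \<in> H \<Longrightarrow> y \<in> H \<Longrightarrow> x - y \<in> H"
  shows "H = UNIV"
proof -
  obtain g where g: "H = {x. g dvd x}"
    using int_subgroup_generator assms(2,4) by (metis empty_iff)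
  then have "g dvd Gcd X" "g dvd m"
    using assms(2,3) by (auto intro: Gcd_greatest)
  then have "g dvd 1"
    using assms(1) coprime_common_divisor by blast
  then show ?thesis
    unfolding g using unit_imp_dvd by blast
qed

lemma coprime_Gcd_periodic_constant:
  fixes f :: "int \<Rightarrow> 'a"
  assumes "coprime (Gcd X) m" "\<And>x. f (x + m) = f x" "\<And>d x. d \<in> X \<Longrightarrow> f (x + d) = f x"
  shows "f x = f y"
proof -
  have "{d. \<forall>x. f (x + d) = f x} = UNIV"
  proof (rule int_subgroup_eq_UNIV[OF assms(1)])
    fix d e assume "d \<in> {d. \<forall>x. f (x + d) = f x}" "e \<in> {d. \<forall>x. f (x + d) = f x}"
    then have "f (x + d - e + e) = f (x + d - e)" "f (x + d) = f x" for x
      by blast+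
    then show "d - e \<in> {d. \<forall>x. f (x + d) = f x}" by (simp add: algebra_simps)
  qed (use assms(2,3) in auto)
  then have "f (y + (x - y)) = f y" by blast
  then show ?thesis by simp
qed

lemma coprime_Gcd_range_iff:
  fixes d :: "'b \<Rightarrow> int"
  shows "coprime (Gcd (range d)) m \<longleftrightarrow> (\<forall>g. g dvd m \<longrightarrow> (\<forall>i. g dvd d i) \<longrightarrow> is_unit g)"
  unfolding coprime_def by (auto simp: dvd_Gcd_iff)

lemma coprime_Gcd_range_cong:
  fixes d e :: "'b \<Rightarrow> int"
  assumes "\<And>i. [d i = e i] (mod m)"
  shows "coprime (Gcd (range d)) m \<longleftrightarrow> coprime (Gcd (range e)) m"
proof -
  have "g dvd d i \<longleftrightarrow> g dvd e i" if "g dvd m" for g i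
    using cong_dvd_modulus[OF assms that] by (rule cong_dvd_iff)
  then show ?thesis unfolding coprime_Gcd_range_iff by blast
qed

lemma coprime_Gcd_range_dvd_cancel:
  fixes d :: "'b \<Rightarrow> int"
  assumes "coprime (Gcd (range d)) m" "\<And>i. m dvd c * d i"
  shows "m dvd c"
proof -
  have "m dvd Gcd (range (\<lambda>i. c * d i))"
    using assms(2) by (auto intro: Gcd_greatest)
  also have "range (\<lambda>i. c * d i) = (*) c ` range d" by (simp add: image_image)
  finally have "m dvd c * Gcd (range d)" by (simp add: Gcd_mult)
  then show ?thesis using assms(1) by (simp add: coprime_dvd_mult_left_iff coprime_commute)
qed

section \<open>Base lines and coordinates\<close>

definition sidon :: "int \<Rightarrow> ('c \<Rightarrow> int) \<Rightarrow> bool" where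
  "sidon m s \<longleftrightarrow> (\<forall>i j k l. i \<noteq> k \<longrightarrow> j \<noteq> l \<longrightarrow> [s i - s k = s j - s l] (mod m) \<longrightarrow> i = j \<and> k = l)"

definition primitive :: "int \<Rightarrow> ('c \<Rightarrow> int) \<Rightarrow> bool" where
  "primitive m s \<longleftrightarrow> coprime (Gcd (range (\<lambda>(i, j). s i - s j))) m"

definition affinely_equivalent :: "int \<Rightarrow> ('c \<Rightarrow> int) \<Rightarrow> ('c \<Rightarrow> int) \<Rightarrow> bool" where
  "affinely_equivalent m s t \<longleftrightarrow>
     (\<exists>u \<pi>. bij \<pi> \<and> (\<forall>i j. [t (\<pi> i) - t (\<pi> j) = u * (s i - s j)] (mod m)))"

definition line :: "('c \<Rightarrow> int) \<Rightarrow> (int \<Rightarrow> 'a) \<Rightarrow> int \<Rightarrow> 'a set" where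
  "line s \<phi> y = range (\<lambda>i. \<phi> (y + s i))"

lemma in_lineI: "p = \<phi> (y + s i) \<Longrightarrow> p \<in> line s \<phi> y"
  unfolding line_def by blast

lemma sidonD:
  "sidon m s \<Longrightarrow> i \<noteq> k \<Longrightarrow> j \<noteq> l \<Longrightarrow> [s i - s k = s j - s l] (mod m) \<Longrightarrow> i = j \<and> k = l"
  unfolding sidon_def by blast

lemma sidon_inj:
  assumes "sidon m s" "[s i = s j] (mod m)"
  shows "i = j"
proof (rule ccontr)
  assume "i \<noteq> j"
  moreover have "[s i - s j = s j - s i] (mod m)"
    using assms(2) unfolding cong_iff_dvd_diff by Groebner_Basis.algebra
  ultimately show False using sidonD[OF assms(1), of i j j i] by auto
qed

lemma primitive_iff: "primitive m s \<longleftrightarrow> (\<forall>g. g dvd m \<longrightarrow> (\<forall>i j. g dvd s i - s j) \<longrightarrow> is_unit g)"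
  unfolding primitive_def coprime_def by (auto simp: dvd_Gcd_iff)

lemma primitive_periodic_constant:
  assumes "primitive m s" "\<And>x. f (x + m) = f x" "\<And>i j x. f (x + (s i - s j)) = f x"
  shows "f x = f y"
  by (rule coprime_Gcd_periodic_constant[OF assms(1)[unfolded primitive_def]])
    (use assms(2,3) in fast)+

lemma primitive_dvd_cancel:
  assumes "primitive m s" "\<And>i j. m dvd c * (s i - s j)"
  shows "m dvd c"
  by (rule coprime_Gcd_range_dvd_cancel[OF assms(1)[unfolded primitive_def]])
    (auto simp: assms(2))

lemma primitive_multiplier_coprime:
  assumes "primitive m t" and "surj \<pi>"
    and "\<And>i j. [t (\<pi> i) - t (\<pi> j) = u * (s i - s j)] (mod m)"
  shows "coprime u m"
proof (rule coprimeI)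
  fix g assume g: "g dvd u" "g dvd m"
  have "g dvd t i - t j" for i j
  proof -
    obtain i' j' where "i = \<pi> i'" "j = \<pi> j'" using \<open>surj \<pi>\<close> by (metis surjD)
    then have "[t i - t j = u * (s i' - s j')] (mod g)"
      using assms(3) g(2) cong_dvd_modulus by blast
    then show ?thesis using g(1) by (simp add: cong_dvd_iff)
  qed
  then show "is_unit g" using assms(1) g(2) by (simp add: primitive_iff)
qed

locale coordinatization =
  fixes m :: int and s :: "'c::finite \<Rightarrow> int" and \<phi> :: "int \<Rightarrow> 'a" and C :: "'a incidence"
  assumes modulus_pos: "m > 0"
    and point_eq_iff: "\<phi> x = \<phi> y \<longleftrightarrow> [x = y] (mod m)"
    and points: "fst C = range \<phi>"
    and lines: "snd C = range (line s \<phi>)"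
begin

lemma point_in_line_iff: "\<phi> x \<in> line s \<phi> y \<longleftrightarrow> (\<exists>i. [x = y + s i] (mod m))"
  unfolding line_def by (auto simp: point_eq_iff)

lemma point_in_line: "\<phi> (y + s i) \<in> line s \<phi> y"
  by (rule in_lineI) (rule refl)

lemma point_in_line_diff: "\<phi> x \<in> line s \<phi> (x - s k)"
  using point_in_line[of "x - s k" k] by simp

lemma line_in_lines: "line s \<phi> y \<in> snd C"
  by (simp add: lines)

lemma line_cong: "[y = z] (mod m) \<Longrightarrow> line s \<phi> y = line s \<phi> z"
  unfolding line_def by (intro image_cong refl) (simp add: point_eq_iff cong_add)

lemma factor_through_points:
  assumes "\<And>x y. [x = y] (mod m) \<Longrightarrow> \<psi> x = \<psi> y"
  obtains f where "\<And>x. f (\<phi> x) = \<psi> x"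
proof
  fix x
  have "\<phi> (SOME z. \<phi> z = \<phi> x) = \<phi> x" by (rule someI) simp
  then show "\<psi> (SOME z. \<phi> z = \<phi> x) = \<psi> x"
    using assms point_eq_iff by blast
qed

end

lemma coordinatization_isomorphism:
  assumes "coordinatization m s \<phi> C" "coordinatization m s \<psi> D"
  obtains f where "isomorphism f C D" "\<And>x. f (\<phi> x) = \<psi> x"
proof -
  interpret C: coordinatization m s \<phi> C by fact
  interpret D: coordinatization m s \<psi> D by fact
  obtain f where f: "\<And>x. f (\<phi> x) = \<psi> x"
    using C.factor_through_points[of \<psi>] D.point_eq_iff by blast
  have "f ` line s \<phi> y = line s \<psi> y" for y
    unfolding line_def by (simp add: image_image f)
  then have "(`) f ` snd C = snd D"
    by (simp add: C.lines D.lines image_image)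
  moreover have "bij_betw f (fst C) (fst D)"
    by (rule bij_betw_imageI)
      (auto simp: inj_on_def f C.points D.points C.point_eq_iff D.point_eq_iff image_image)
  ultimately show ?thesis
    using that f unfolding isomorphism_def by blast
qed

lemma coordinatization_image:
  assumes "coordinatization m s \<phi> C" and iso: "isomorphism f C D"
  shows "coordinatization m s (f \<circ> \<phi>) D"
proof -
  interpret coordinatization m s \<phi> C by fact
  have "inj_on f (range \<phi>)" and "f ` range \<phi> = fst D" "(`) f ` range (line s \<phi>) = snd D"
    using iso by (auto simp: isomorphism_def points lines bij_betw_def)
  moreover have "f ` line s \<phi> y = line s (f \<circ> \<phi>) y" for y
    unfolding line_def by (simp add: image_image)
  moreover have "(f \<circ> \<phi>) x = (f \<circ> \<phi>) y \<longleftrightarrow> [x = y] (mod m)" for x y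
    using inj_on_eq_iff[OF \<open>inj_on f (range \<phi>)\<close> rangeI rangeI] by (simp add: point_eq_iff)
  ultimately show ?thesis
    using modulus_pos by unfold_locales (simp_all add: image_image)
qed

lemma line_affine_image:
  assumes "surj \<pi>" and u: "\<And>i j. [t (\<pi> i) - t (\<pi> j) = u * (s i - s j)] (mod m)"
    and \<phi>: "\<And>x. \<phi> x = \<psi> (u * x)" and \<psi>: "\<And>x y. [x = y] (mod m) \<Longrightarrow> \<psi> x = \<psi> y"
  shows "line s \<phi> y = line t \<psi> (u * (y + s c) - t (\<pi> c))"
proof -
  have "\<phi> (y + s i) = \<psi> (u * (y + s c) - t (\<pi> c) + t (\<pi> i))" for i
    unfolding \<phi> using u[of i c] unfolding cong_iff_dvd_diff
    by (intro \<psi>, unfold cong_iff_dvd_diff) Groebner_Basis.algebra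
  then have "line s \<phi> y = (\<lambda>i. \<psi> (u * (y + s c) - t (\<pi> c) + t i)) ` range \<pi>"
    unfolding line_def by (simp add: image_image)
  then show ?thesis unfolding \<open>surj \<pi>\<close> line_def .
qed

lemma coordinatization_affine_change:
  fixes s t :: "'c::finite \<Rightarrow> int"
  assumes "coordinatization m s \<phi> C" "affinely_equivalent m s t" "primitive m t"
  obtains \<psi> where "coordinatization m t \<psi> C"
proof -
  interpret coordinatization m s \<phi> C by fact
  obtain u \<pi> where "bij \<pi>" and u: "\<And>i j. [t (\<pi> i) - t (\<pi> j) = u * (s i - s j)] (mod m)"
    using assms(2) unfolding affinely_equivalent_def by blast
  then have "surj \<pi>" by (simp add: bij_def)
  obtain w where w: "[u * w = 1] (mod m)"
    using cong_solve_coprime_int primitive_multiplier_coprime[OF assms(3) \<open>surj \<pi>\<close> u] by blast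
  define \<psi> where "\<psi> x = \<phi> (w * x)" for x
  have \<psi>_eq_iff: "\<psi> x = \<psi> y \<longleftrightarrow> [x = y] (mod m)" for x y
  proof
    assume "\<psi> x = \<psi> y"
    then show "[x = y] (mod m)"
      using w unfolding \<psi>_def point_eq_iff cong_iff_dvd_diff by Groebner_Basis.algebra
  qed (simp add: \<psi>_def point_eq_iff cong_scalar_left)
  have \<phi>_eq: "\<phi> x = \<psi> (u * x)" for x
    using w unfolding \<psi>_def point_eq_iff cong_iff_dvd_diff by Groebner_Basis.algebra
  define c :: 'c where "c = undefined"
  have line_eq: "line s \<phi> y = line t \<psi> (u * (y + s c) - t (\<pi> c))" for y
    by (rule line_affine_image[where \<psi> = \<psi>]) (simp_all add: \<open>surj \<pi>\<close> u \<phi>_eq \<psi>_eq_iff)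
  have "line t \<psi> y = line s \<phi> (w * (y + t (\<pi> c)) - s c)" for y
  proof -
    have "[u * (w * (y + t (\<pi> c)) - s c + s c) - t (\<pi> c) = y] (mod m)"
      using w unfolding cong_iff_dvd_diff by Groebner_Basis.algebra
    then show ?thesis
      unfolding line_eq unfolding line_def
      by (intro image_cong refl) (simp add: \<psi>_eq_iff cong_add cong_sym)
  qed
  then have "range (line s \<phi>) = range (line t \<psi>)"
    using line_eq by (metis (no_types, lifting) image_subsetI rangeI subset_antisym)
  moreover have "range \<phi> = range \<psi>"
    using \<phi>_eq \<psi>_def by (metis (no_types, lifting) image_subsetI rangeI subset_antisym)
  ultimately have "coordinatization m t \<psi> C"
    using modulus_pos \<psi>_eq_iff points lines by unfold_locales simp_all
  then show ?thesis by (rule that)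
qed

definition circulant_points :: "int \<Rightarrow> int \<Rightarrow> nat" where
  "circulant_points m x = nat (x mod m)"

definition circulant :: "int \<Rightarrow> ('c \<Rightarrow> int) \<Rightarrow> nat incidence" where
  "circulant m s = (range (circulant_points m), range (line s (circulant_points m)))"

lemma coordinatization_circulant:
  assumes "m > 0"
  shows "coordinatization m s (circulant_points m) (circulant m s)"
  using assms
  by unfold_locales (simp_all add: circulant_def circulant_points_def cong_def eq_nat_nat_iff)

lemma (in coordinatization) isomorphic_circulant:
  obtains f where "isomorphism f C (circulant m s)"
  using coordinatization_isomorphism[OF coordinatization_axioms]
    coordinatization_circulant[OF modulus_pos] by blast

section \<open>Configurations developed from a base line\<close>

lemma card_range_mod:
  fixes \<phi> :: "int \<Rightarrow> 'a"
  assumes "m > 0" and iff: "\<And>x y. \<phi> x = \<phi> y \<longleftrightarrow> [x = y] (mod m)"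
  shows "finite (range \<phi>)" "card (range \<phi>) = nat m"
proof -
  have "\<phi> x = \<phi> (x mod m)" "x mod m \<in> {0..<m}" for x using assms(1) by (simp_all add: iff)
  then have "range \<phi> = \<phi> ` {0..<m}" by blast
  moreover have "inj_on \<phi> {0..<m}" by (auto simp: inj_on_def iff cong_def)
  ultimately show "finite (range \<phi>)" "card (range \<phi>) = nat m" by (simp_all add: card_image)
qed

locale configuration_coordinatization = coordinatization m s \<phi> C
  for m and s :: "'c::finite \<Rightarrow> int" and \<phi> :: "int \<Rightarrow> 'a" and C +
  assumes sidon: "sidon m s" and primitive: "primitive m s"
begin

lemma offset_inj: "\<phi> (y + s i) = \<phi> (y + s j) \<Longrightarrow> i = j"
  using sidon_inj[OF sidon] by (auto simp: point_eq_iff cong_add_lcancel)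

lemma line_eq_if_two_common_points:
  assumes p: "p \<in> line s \<phi> y" "p \<in> line s \<phi> z" and q: "q \<in> line s \<phi> y" "q \<in> line s \<phi> z"
    and "p \<noteq> q"
  shows "[y = z] (mod m)"
proof -
  obtain i j where ij: "p = \<phi> (y + s i)" "p = \<phi> (z + s j)" using p unfolding line_def by blast
  obtain k l where kl: "q = \<phi> (y + s k)" "q = \<phi> (z + s l)" using q unfolding line_def by blast
  have "i \<noteq> k" "j \<noteq> l" using ij kl \<open>p \<noteq> q\<close> by auto
  moreover have eqs: "[y + s i = z + s j] (mod m)" "[y + s k = z + s l] (mod m)"
    using ij kl point_eq_iff by metis+
  then have "[s i - s k = s j - s l] (mod m)"
    unfolding cong_iff_dvd_diff by Groebner_Basis.algebra
  ultimately have "i = j" using sidonD[OF sidon] by blast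
  then show ?thesis using eqs(1) by (simp add: cong_add_rcancel)
qed

lemma card_line: "card (line s \<phi> y) = CARD('c)"
proof -
  have "inj (\<lambda>i. \<phi> (y + s i))" by (rule injI) (rule offset_inj)
  then show ?thesis unfolding line_def by (simp add: card_image)
qed

lemma line_eq_iff:
  assumes "CARD('c) > 1"
  shows "line s \<phi> y = line s \<phi> z \<longleftrightarrow> [y = z] (mod m)"
proof
  assume eq: "line s \<phi> y = line s \<phi> z"
  obtain i j :: 'c where "i \<noteq> j"
    using assms by (metis card_le_Suc0_iff_eq finite_code not_le One_nat_def)
  then show "[y = z] (mod m)"
    using line_eq_if_two_common_points[of "\<phi> (y + s i)" y z "\<phi> (y + s j)"] offset_inj
      point_in_line[of y] unfolding eq by blast
qed (rule line_cong)

lemma line_through_point: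
  assumes "M \<in> snd C" "\<phi> x \<in> M"
  obtains k where "M = line s \<phi> (x - s k)"
proof -
  obtain z where z: "M = line s \<phi> z" using assms(1) lines by auto
  then obtain k where "[x = z + s k] (mod m)" using assms(2) point_in_line_iff by auto
  then have "[z = x - s k] (mod m)" unfolding cong_iff_dvd_diff by Groebner_Basis.algebra
  then show ?thesis using that line_cong z by blast
qed

lemma card_lines_through:
  assumes "CARD('c) > 1"
  shows "card {B \<in> snd C. \<phi> x \<in> B} = CARD('c)"
proof -
  have "{B \<in> snd C. \<phi> x \<in> B} = range (\<lambda>k. line s \<phi> (x - s k))"
    using line_through_point line_in_lines point_in_line_diff by blast
  moreover have "inj (\<lambda>k. line s \<phi> (x - s k))"
  proof (rule injI)
    fix i j assume "line s \<phi> (x - s i) = line s \<phi> (x - s j)"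
    then have "[s i = s j] (mod m)"
      unfolding line_eq_iff[OF assms] cong_iff_dvd_diff by Groebner_Basis.algebra
    then show "i = j" by (rule sidon_inj[OF sidon])
  qed
  ultimately show ?thesis by (simp add: card_image)
qed

lemma balanced_configuration:
  assumes "CARD('c) \<ge> 3"
  shows "balanced_configuration (nat m) (CARD('c)) C"
proof -
  have card_gt_1: "CARD('c) > 1" using assms by simp
  have "finite (fst C)" "card (fst C) = nat m"
    using card_range_mod[OF modulus_pos point_eq_iff] points by simp_all
  moreover have "card (snd C) = nat m"
    using card_range_mod(2)[OF modulus_pos line_eq_iff[OF card_gt_1]] lines by simp
  moreover have "snd C \<subseteq> Pow (fst C)" unfolding points lines line_def by auto
  moreover have "card (B1 \<inter> B2) \<le> 1" if B: "B1 \<in> snd C" "B2 \<in> snd C" "B1 \<noteq> B2" for B1 B2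
  proof -
    obtain y z where yz: "B1 = line s \<phi> y" "B2 = line s \<phi> z" using B lines by auto
    then have "finite (B1 \<inter> B2)" by (simp add: line_def)
    moreover have "p = q" if "p \<in> B1 \<inter> B2" "q \<in> B1 \<inter> B2" for p q
      using that line_eq_if_two_common_points line_cong \<open>B1 \<noteq> B2\<close> unfolding yz by blast
    ultimately show ?thesis by (simp add: card_le_Suc0_iff_eq)
  qed
  moreover have "\<forall>x\<in>fst C. card {B \<in> snd C. x \<in> B} = CARD('c)"
    using card_lines_through[OF card_gt_1] points by auto
  moreover have "\<forall>B\<in>snd C. card B = CARD('c)" using card_line lines by auto
  ultimately show ?thesis
    using assms points by (cases C) (auto simp: balanced_configuration_def configuration_def)
qed

lemma connected: "connected_configuration C"
  unfolding connected_configuration_def decomposable_def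
proof (intro notI, elim exE conjE)
  fix P1 \<B>1 P2 \<B>2 v r b k v' r' b' k'
  assume conf: "configuration v r b k (P1, \<B>1)" "configuration v' r' b' k' (P2, \<B>2)"
    and disjoint: "P1 \<inter> P2 = {}" and C: "C = (P1 \<union> P2, \<B>1 \<union> \<B>2)"
  have P: "range \<phi> = P1 \<union> P2" using points C by simp
  have split: "L \<subseteq> P1 \<or> L \<subseteq> P2" if "L \<in> snd C" for L
    using that C conf[THEN configuration_lines] by auto
  have "(\<phi> (x + (s i - s j)) \<in> P1) = (\<phi> x \<in> P1)" for i j x
  proof -
    have "\<phi> x \<in> line s \<phi> (x - s j)" "\<phi> (x + (s i - s j)) \<in> line s \<phi> (x - s j)"
      using point_in_line_diff[of x j] point_in_line[of "x - s j" i]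
      by (simp_all add: algebra_simps)
    then show ?thesis using split[OF line_in_lines[of "x - s j"]] disjoint by blast
  qed
  moreover have "(\<phi> (x + m) \<in> P1) = (\<phi> x \<in> P1)" for x
    using point_eq_iff[of "x + m" x] by (simp add: cong_def)
  ultimately have "(\<phi> x \<in> P1) = (\<phi> y \<in> P1)" for x y
    using primitive_periodic_constant[OF primitive, of "\<lambda>x. \<phi> x \<in> P1"] by blast
  moreover have "P1 \<noteq> {}" "P2 \<noteq> {}" using conf unfolding configuration_def by auto
  ultimately show False using P disjoint by (metis Int_iff UnI1 UnI2 all_not_in_conv rangeE)
qed

end

context coordinatization
begin

lemma shift_automorphism:
  obtains f where "automorphism f C" "\<And>x. f (\<phi> x) = \<phi> (x + 1)"
proof -
  have "line s (\<lambda>x. \<phi> (x + 1)) y = line s \<phi> (y + 1)" for y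
    by (simp add: line_def algebra_simps)
  then have "line s (\<lambda>x. \<phi> (x + 1)) = line s \<phi> \<circ> (\<lambda>y. y + 1)" by auto
  moreover have "surj (\<lambda>y :: int. y + 1)" by (rule surjI[of _ "\<lambda>y. y - 1"]) simp
  ultimately have "range (line s (\<lambda>x. \<phi> (x + 1))) = range (line s \<phi>)"
    "range (\<lambda>x. \<phi> (x + 1)) = range \<phi>"
    by (metis image_comp, metis image_image)
  then have "coordinatization m s (\<lambda>x. \<phi> (x + 1)) C"
    using modulus_pos points lines by unfold_locales (simp_all add: point_eq_iff cong_add_rcancel)
  then show ?thesis
    using coordinatization_isomorphism[OF coordinatization_axioms] that
    unfolding automorphism_def by metis
qed

lemma cyclic: "cyclic_configuration C"
proof -
  obtain f where aut: "automorphism f C" and f: "\<And>x. f (\<phi> x) = \<phi> (x + 1)"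
    using shift_automorphism by blast
  have pow: "(f ^^ n) (\<phi> 0) = \<phi> (int n)" for n
    by (induction n) (simp_all add: f add.commute)
  have "\<phi> x \<in> {\<phi> (int n) |n. 0 < n}" for x
  proof -
    have "\<phi> x = \<phi> (int (nat (x mod m + m)))" "0 < nat (x mod m + m)"
      using modulus_pos by (simp_all add: point_eq_iff cong_def add_nonneg_pos)
    then show ?thesis by blast
  qed
  then have "fst C = Orbits.orbit f (\<phi> 0)"
    unfolding orbit_altdef pow points by auto
  then have "cyclic_on f (fst C)" unfolding cyclic_on_def using points by blast
  then show ?thesis unfolding cyclic_configuration_def using aut by blast
qed

end

section \<open>Coordinates on connected cyclic configurations\<close>

lemma cyclic_on_labelling:
  assumes cyclic: "cyclic_on f P" and card: "card P = v" and "v > 0"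
  obtains \<phi> where "\<And>x y. \<phi> x = \<phi> y \<longleftrightarrow> [x = y] (mod int v)" "range \<phi> = P"
    "\<And>x. f (\<phi> x) = \<phi> (x + 1)"
proof -
  obtain p where p: "p \<in> P" "P = Orbits.orbit f p" using cyclic unfolding cyclic_on_def by blast
  define n where "n = funpow_dist1 f p p"
  have inj: "inj_on (\<lambda>k. (f ^^ k) p) {0..<n}"
    unfolding n_def using inj_on_funpow_dist1[of p f p] p by blast
  have P: "P = (\<lambda>k. (f ^^ k) p) ` {0..<n}"
    unfolding n_def using orbit_conv_funpow_dist1 p by metis
  then have "n = v" using card card_image[OF inj] by simp
  have return: "(f ^^ v) p = p"
    unfolding \<open>n = v\<close>[symmetric] n_def using funpow_dist1_prop p by metis
  define \<phi> where "\<phi> x = (f ^^ nat (x mod int v)) p" for x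
  have funpow_eq: "(f ^^ k) p = \<phi> (int k)" for k
    unfolding \<phi>_def using funpow_mod_eq[OF return, of k] by (simp add: nat_mod_distrib)
  have \<phi>_eq_iff: "\<phi> x = \<phi> y \<longleftrightarrow> [x = y] (mod int v)" for x y
  proof
    assume "\<phi> x = \<phi> y"
    moreover have "nat (z mod int v) \<in> {0..<n}" for z
      using \<open>v > 0\<close> by (simp add: \<open>n = v\<close> nat_less_iff)
    ultimately have "nat (x mod int v) = nat (y mod int v)"
      unfolding \<phi>_def using inj by (meson inj_onD)
    then show "[x = y] (mod int v)" using \<open>v > 0\<close> by (simp add: cong_def eq_nat_nat_iff)
  qed (simp add: \<phi>_def cong_def)
  moreover have "range \<phi> = P"
    unfolding P using \<open>v > 0\<close> funpow_eq by (auto simp: \<phi>_def \<open>n = v\<close> nat_less_iff)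
  moreover have "f (\<phi> x) = \<phi> (x + 1)" for x
  proof -
    have "f (\<phi> x) = \<phi> (int (Suc (nat (x mod int v))))"
      unfolding funpow_eq[symmetric] by (simp add: \<phi>_def)
    also have "\<dots> = \<phi> (x + 1)"
      unfolding \<phi>_eq_iff using \<open>v > 0\<close> by (simp add: cong_def mod_simps add.commute)
    finally show ?thesis .
  qed
  ultimately show ?thesis by (rule that)
qed

lemma configurationD:
  assumes "configuration v r b k C"
  shows "finite (fst C)" "card (fst C) = v" "fst C \<noteq> {}" "card (snd C) = b" "snd C \<subseteq> Pow (fst C)"
    and "\<And>B1 B2. B1 \<in> snd C \<Longrightarrow> B2 \<in> snd C \<Longrightarrow> B1 \<noteq> B2 \<Longrightarrow> card (B1 \<inter> B2) \<le> 1"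
    and "\<And>x. x \<in> fst C \<Longrightarrow> card {B \<in> snd C. x \<in> B} = r"
    and "k \<ge> 3" "\<And>B. B \<in> snd C \<Longrightarrow> card B = k"
  using assms unfolding configuration_def by (auto split: prod.splits)

lemma configuration_line_unique:
  assumes "configuration v r b k C" "B1 \<in> snd C" "B2 \<in> snd C"
    and "p \<in> B1 \<inter> B2" "q \<in> B1 \<inter> B2" "p \<noteq> q"
  shows "B1 = B2"
proof (rule ccontr)
  assume "B1 \<noteq> B2"
  then have "card (B1 \<inter> B2) \<le> 1" using configurationD(6) assms(1-3) by blast
  moreover have "finite (B1 \<inter> B2)"
    using configurationD(1,5)[OF assms(1)] assms(2)
    by (meson finite_Int finite_subset Pow_iff subsetD)
  ultimately show False using assms(4-6) by (simp add: card_le_Suc0_iff_eq)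
qed

lemma configuration_closed_subset:
  assumes "configuration v r b k C" "Q \<noteq> {}" "Q \<subseteq> fst C"
    and closed: "\<And>B. B \<in> snd C \<Longrightarrow> B \<inter> Q \<noteq> {} \<Longrightarrow> B \<subseteq> Q"
  shows "configuration (card Q) r (card {B \<in> snd C. B \<subseteq> Q}) k (Q, {B \<in> snd C. B \<subseteq> Q})"
proof -
  note C = configurationD[OF assms(1)]
  have "card {B \<in> {B \<in> snd C. B \<subseteq> Q}. x \<in> B} = r" if "x \<in> Q" for x
  proof -
    have "{B \<in> {B \<in> snd C. B \<subseteq> Q}. x \<in> B} = {B \<in> snd C. x \<in> B}" using closed that by blast
    moreover have "x \<in> fst C" using that assms(3) by blast
    ultimately show ?thesis using C(7) by simp
  qed
  moreover have "finite Q" using C(1) assms(3) finite_subset by blast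
  ultimately show ?thesis unfolding configuration_def using C(6,8,9) assms(2) by auto
qed

lemma decomposableI:
  assumes "configuration v r b k C" "Q \<noteq> {}" "Q \<subset> fst C"
    and split: "\<And>B. B \<in> snd C \<Longrightarrow> B \<subseteq> Q \<or> B \<inter> Q = {}"
  shows "decomposable C"
proof -
  let ?R = "fst C - Q"
  have lines_R: "B \<subseteq> ?R \<longleftrightarrow> B \<inter> Q = {}" if "B \<in> snd C" for B
    using that configuration_lines[OF assms(1)] by blast
  have conf_Q: "configuration (card Q) r (card {B \<in> snd C. B \<subseteq> Q}) k (Q, {B \<in> snd C. B \<subseteq> Q})"
    using assms(2,3) split by (intro configuration_closed_subset[OF assms(1)]) auto
  have conf_R: "configuration (card ?R) r (card {B \<in> snd C. B \<subseteq> ?R}) k (?R, {B \<in> snd C. B \<subseteq> ?R})"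
  proof (rule configuration_closed_subset[OF assms(1)])
    fix B assume "B \<in> snd C" "B \<inter> ?R \<noteq> {}"
    then show "B \<subseteq> ?R" using split[of B] lines_R[of B] by auto
  qed (use assms(3) in auto)
  have "fst C = Q \<union> ?R" using assms(3) by blast
  moreover have "snd C = {B \<in> snd C. B \<subseteq> Q} \<union> {B \<in> snd C. B \<subseteq> ?R}"
    using split lines_R by (intro equalityI subsetI) auto
  ultimately have "C = (Q \<union> ?R, {B \<in> snd C. B \<subseteq> Q} \<union> {B \<in> snd C. B \<subseteq> ?R})"
    by (simp add: prod_eq_iff)
  moreover have "Q \<inter> ?R = {}" by blast
  ultimately show ?thesis unfolding decomposable_def using conf_Q conf_R by blast
qed

lemma (in coordinatization) connected_imp_primitive:
  assumes conf: "configuration v r b k C" and "connected_configuration C"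
  shows "primitive m s"
proof (rule ccontr)
  assume "\<not> primitive m s"
  then obtain g where g: "g dvd m" "\<And>i j. g dvd s i - s j" "\<not> is_unit g"
    by (auto simp: primitive_iff)
  define Q where "Q = \<phi> ` {x. g dvd x}"
  have Q_iff: "\<phi> x \<in> Q \<longleftrightarrow> g dvd x" for x
  proof
    assume "\<phi> x \<in> Q"
    then obtain y where "[x = y] (mod m)" "g dvd y" unfolding Q_def by (auto simp: point_eq_iff)
    then show "g dvd x" using cong_dvd_modulus[OF _ g(1)] cong_dvd_iff by blast
  qed (simp add: Q_def)
  have "B \<subseteq> Q \<or> B \<inter> Q = {}" if "B \<in> snd C" for B
  proof -
    obtain y where B: "B = line s \<phi> y" using \<open>B \<in> snd C\<close> lines by auto
    have "[y + s i = y + s j] (mod g)" for i j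
      using g(2) by (simp add: cong_iff_dvd_diff)
    then have "\<phi> (y + s i) \<in> Q \<longleftrightarrow> \<phi> (y + s j) \<in> Q" for i j
      unfolding Q_iff by (rule cong_dvd_iff)
    then show ?thesis unfolding B line_def by blast
  qed
  moreover have "Q \<noteq> {}" by (auto simp: Q_def)
  moreover have "Q \<subset> fst C"
    using Q_iff[of 1] g(3) unfolding points Q_def by blast
  ultimately have "decomposable C" using decomposableI[OF conf] by blast
  then show False using assms(2) unfolding connected_configuration_def by blast
qed

lemma card_multiples_mod_le:
  fixes m :: int
  assumes "m > 0" "k > 0"
  shows "card {x \<in> {0..<m}. m dvd int k * x} \<le> k"
proof -
  let ?A = "{x \<in> {0..<m}. m dvd int k * x}" and ?q = "\<lambda>x. int k * x div m"
  have q_mult: "?q x * m = int k * x" if "x \<in> ?A" for x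
    using that by simp
  have "inj_on ?q ?A"
  proof (rule inj_onI)
    fix x y assume "x \<in> ?A" "y \<in> ?A" "?q x = ?q y"
    then have "int k * x = int k * y" using q_mult by metis
    then show "x = y" using \<open>k > 0\<close> by simp
  qed
  moreover have "?q ` ?A \<subseteq> {0..<int k}"
  proof
    fix q assume "q \<in> ?q ` ?A"
    then obtain x where x: "x \<in> ?A" "q = ?q x" by blast
    then have "0 * m \<le> q * m" "q * m < int k * m" using q_mult[OF x(1)] \<open>k > 0\<close> by simp_all
    then show "q \<in> {0..<int k}"
      using \<open>m > 0\<close> by (simp only: mult_le_cancel_right mult_less_cancel_right) simp
  qed
  ultimately have "card ?A \<le> card {0..<int k}" by (rule card_inj_on_le) simp
  then show ?thesis by simp
qed

locale cyclic_labelling =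
  fixes v k :: nat and \<phi> :: "int \<Rightarrow> 'a" and f :: "'a \<Rightarrow> 'a" and C :: "'a incidence"
    and colors :: "'c::finite itself"
  assumes configuration: "configuration v k v k C" and card_colors: "CARD('c) = k"
    and point_eq_iff: "\<phi> x = \<phi> y \<longleftrightarrow> [x = y] (mod int v)"
    and points: "fst C = range \<phi>"
    and shift: "f (\<phi> x) = \<phi> (x + 1)"
    and shift_line: "B \<in> snd C \<Longrightarrow> f ` B \<in> snd C"
begin

lemma v_pos: "v > 0"
  using configurationD(1-3)[OF configuration] by (auto simp: card_gt_0_iff)

lemma line_cong: "[y = z] (mod int v) \<Longrightarrow> line s \<phi> y = line s \<phi> z"
  unfolding line_def by (intro image_cong refl) (simp add: point_eq_iff cong_add)

lemma shift_image_line: "f ` line s \<phi> y = line s \<phi> (y + 1)"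
  unfolding line_def by (simp add: image_image shift algebra_simps)

lemma translation_induct [case_names zero step cong]:
  fixes d :: int
  assumes "P 0" "\<And>d. P d \<Longrightarrow> P (d + 1)" "\<And>d e. [d = e] (mod int v) \<Longrightarrow> P d \<Longrightarrow> P e"
  shows "P d"
proof -
  have "P (int n)" for n
  proof (induction n)
    case (Suc n)
    then show ?case using assms(2)[of "int n"] by (simp add: add.commute)
  qed (simp add: \<open>P 0\<close>)
  moreover have "[int (nat (d mod int v)) = d] (mod int v)" using v_pos by simp
  ultimately show ?thesis using assms(3) by blast
qed

lemma translate_line:
  assumes "line s \<phi> 0 \<in> snd C"
  shows "line s \<phi> y \<in> snd C"
proof (induction y rule: translation_induct)
  case (step d)
  then show ?case using shift_line[of "line s \<phi> d"] by (simp add: shift_image_line)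
next
  case (cong d e)
  then show ?case using line_cong by metis
qed (fact assms)

lemma translate_line_eq:
  assumes "line s \<phi> y = line s \<phi> z"
  shows "line s \<phi> (y + d) = line s \<phi> (z + d)"
proof (induction d rule: translation_induct)
  case (step d)
  then show ?case using shift_image_line by (metis add.assoc)
next
  case (cong d e)
  then show ?case using line_cong by (metis cong_add_lcancel)
qed (use assms in simp)

lemma offsets_exist:
  assumes "B \<in> snd C"
  obtains s :: "'c \<Rightarrow> int" where "B = line s \<phi> 0"
proof -
  have "card B = CARD('c)" "finite B"
    using configurationD(8,9)[OF configuration] assms card_colors
    by (auto intro: card_ge_0_finite)
  then obtain h where h: "bij_betw h (UNIV :: 'c set) B"
    using finite_same_card_bij by (metis finite_code)
  have "B \<subseteq> range \<phi>" using assms configuration_lines[OF configuration] points by auto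
  then have "\<exists>x. h i = \<phi> x" for i using h by (metis bij_betw_apply UNIV_I rangeE subsetD)
  then obtain s where "\<And>i. h i = \<phi> (s i)" by metis
  then have "B = line s \<phi> 0" using h by (auto simp: line_def bij_betw_def)
  then show ?thesis by (rule that)
qed

lemma offsets_inj:
  fixes s :: "'c \<Rightarrow> int"
  assumes "line s \<phi> 0 \<in> snd C" "[s i = s j] (mod int v)"
  shows "i = j"
proof -
  have "card (range (\<lambda>i. \<phi> (s i))) = CARD('c)"
    using configurationD(9)[OF configuration assms(1)] by (simp add: line_def card_colors)
  then have "inj (\<lambda>i. \<phi> (s i))" by (intro eq_card_imp_inj_on) auto
  then show ?thesis using assms(2) by (auto simp: point_eq_iff dest: injD)
qed

lemma period_permutes_offsets:
  fixes s :: "'c \<Rightarrow> int"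
  assumes "line s \<phi> 0 \<in> snd C" "line s \<phi> d = line s \<phi> 0"
  obtains \<tau> where "bij \<tau>" "\<And>i. [s i + d = s (\<tau> i)] (mod int v)"
proof -
  have "\<exists>j. [s i + d = s j] (mod int v)" for i
  proof -
    have "\<phi> (d + s i) \<in> line s \<phi> 0" unfolding assms(2)[symmetric] by (simp add: line_def)
    then show ?thesis by (auto simp: line_def point_eq_iff add.commute)
  qed
  then obtain \<tau> where \<tau>: "\<And>i. [s i + d = s (\<tau> i)] (mod int v)" by metis
  have "inj \<tau>"
  proof (rule injI)
    fix i j assume "\<tau> i = \<tau> j"
    then have "[s i + d = s j + d] (mod int v)" using \<tau> cong_sym cong_trans by metis
    then show "i = j" using offsets_inj[OF assms(1)] by (simp add: cong_add_rcancel)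
  qed
  then have "bij \<tau>" by (simp add: bij_def finite_UNIV_inj_surj)
  then show ?thesis using \<tau> that by blast
qed

lemma period_torsion:
  fixes s :: "'c \<Rightarrow> int"
  assumes "line s \<phi> 0 \<in> snd C" "line s \<phi> d = line s \<phi> 0"
  shows "int v dvd int k * d"
proof -
  obtain \<tau> where "bij \<tau>" and \<tau>: "\<And>i. [s i + d = s (\<tau> i)] (mod int v)"
    using period_permutes_offsets[OF assms] by blast
  have "[(\<Sum>i\<in>UNIV. s i + d) = (\<Sum>i\<in>UNIV. s (\<tau> i))] (mod int v)"
    by (intro cong_sum \<tau>)
  moreover have "(\<Sum>i\<in>UNIV. s i + d) = (\<Sum>i\<in>UNIV. s i) + int k * d"
    by (simp add: sum.distrib card_colors)
  moreover have "(\<Sum>i\<in>UNIV. s (\<tau> i)) = (\<Sum>i\<in>UNIV. s i)"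
    by (rule sum.reindex_bij_betw) (fact \<open>bij \<tau>\<close>)
  ultimately show ?thesis by (simp add: cong_iff_dvd_diff)
qed

text \<open>If \<open>d\<close> is a nontrivial period, then the translate by \<open>s j - s i\<close> shares with the line the
  two points at \<open>s j\<close> and \<open>s j + d\<close>, so \<open>s j - s i\<close> is a period as well.\<close>

lemma period_offset_differences:
  fixes s :: "'c \<Rightarrow> int"
  assumes L: "line s \<phi> 0 \<in> snd C" "line s \<phi> d = line s \<phi> 0" and "\<not> int v dvd d"
  shows "line s \<phi> (s j - s i) = line s \<phi> 0"
proof -
  obtain \<tau> where \<tau>: "\<And>i. [s i + d = s (\<tau> i)] (mod int v)"
    using period_permutes_offsets[OF L] by blast
  have "\<phi> (s j + d) = \<phi> (s (\<tau> j))" "\<phi> (s j + d) = \<phi> (s j - s i + s (\<tau> i))"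
    using \<tau>[of j] \<tau>[of i] unfolding point_eq_iff cong_iff_dvd_diff
    by (blast, Groebner_Basis.algebra)
  then have "\<phi> (s j + d) \<in> line s \<phi> (s j - s i) \<inter> line s \<phi> 0"
    using in_lineI[of _ \<phi> "s j - s i" s "\<tau> i"] in_lineI[of _ \<phi> 0 s "\<tau> j"] by simp
  moreover have "\<phi> (s j) \<in> line s \<phi> (s j - s i) \<inter> line s \<phi> 0"
    using in_lineI[of _ \<phi> "s j - s i" s i] in_lineI[of _ \<phi> 0 s j] by simp
  moreover have "\<phi> (s j) \<noteq> \<phi> (s j + d)"
    using \<open>\<not> int v dvd d\<close> by (simp add: point_eq_iff cong_iff_dvd_diff)
  ultimately show ?thesis
    using configuration_line_unique[OF configuration translate_line[OF L(1)] L(1)] by blast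
qed

lemma periodic_line_through_origin_unique:
  fixes s :: "'c \<Rightarrow> int"
  assumes L: "line s \<phi> 0 \<in> snd C" "line s \<phi> d = line s \<phi> 0" and "\<not> int v dvd d"
    and origin: "\<phi> 0 \<in> line s \<phi> 0"
  shows "line s \<phi> 0 = \<phi> ` {x \<in> {0..<int v}. int v dvd int k * x}" (is "_ = \<phi> ` ?T")
proof (rule card_seteq)
  obtain i where i: "[0 = s i] (mod int v)" using origin by (auto simp: line_def point_eq_iff)
  show "line s \<phi> 0 \<subseteq> \<phi> ` ?T"
  proof
    fix p assume "p \<in> line s \<phi> 0"
    then obtain j where p: "p = \<phi> (s j)" unfolding line_def by auto
    have "int v dvd int k * (s j - s i)"
      using period_torsion[OF L(1) period_offset_differences[OF assms(1-3)]] .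
    then have "int v dvd int k * s j"
      using i unfolding cong_iff_dvd_diff by Groebner_Basis.algebra
    then have "s j mod int v \<in> ?T" using v_pos by (simp add: dvd_eq_mod_eq_0 mod_simps)
    moreover have "p = \<phi> (s j mod int v)" unfolding p point_eq_iff by simp
    ultimately show "p \<in> \<phi> ` ?T" by blast
  qed
  have "k > 0" using configurationD(8)[OF configuration] by simp
  have "finite ?T" by (rule finite_subset[of _ "{0..<int v}"]) auto
  then show "finite (\<phi> ` ?T)" by (rule finite_imageI)
  have "card (\<phi> ` ?T) \<le> card ?T" using \<open>finite ?T\<close> by (rule card_image_le)
  also have "\<dots> \<le> k" using card_multiples_mod_le v_pos \<open>k > 0\<close> by simp
  finally show "card (\<phi> ` ?T) \<le> card (line s \<phi> 0)"
    using configurationD(9)[OF configuration L(1)] by simp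
qed

lemma free_line_exists:
  obtains s :: "'c \<Rightarrow> int"
  where "line s \<phi> 0 \<in> snd C" "\<And>d. line s \<phi> d = line s \<phi> 0 \<Longrightarrow> int v dvd d"
proof -
  let ?T = "{x \<in> {0..<int v}. int v dvd int k * x}"
  have "card {B \<in> snd C. \<phi> 0 \<in> B} = k"
    using configurationD(7)[OF configuration] points by simp
  then have "\<not> card {B \<in> snd C. \<phi> 0 \<in> B} \<le> card {\<phi> ` ?T}"
    using configurationD(8)[OF configuration] by simp
  then have "\<not> {B \<in> snd C. \<phi> 0 \<in> B} \<subseteq> {\<phi> ` ?T}"
    using card_mono[of "{\<phi> ` ?T}"] by blast
  then obtain B where B: "B \<in> snd C" "\<phi> 0 \<in> B" "B \<noteq> \<phi> ` ?T" by blast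
  obtain s :: "'c \<Rightarrow> int" where s: "B = line s \<phi> 0" using offsets_exist B(1) by blast
  have "int v dvd d" if "line s \<phi> d = line s \<phi> 0" for d
    using periodic_line_through_origin_unique[of s d] B that unfolding s by blast
  then show ?thesis using that[of s] B(1) s by blast
qed

lemma coordinatization_free_line:
  fixes s :: "'c \<Rightarrow> int"
  assumes L: "line s \<phi> 0 \<in> snd C" and free: "\<And>d. line s \<phi> d = line s \<phi> 0 \<Longrightarrow> int v dvd d"
  shows "coordinatization (int v) s \<phi> C"
proof
  have "line s \<phi> y = line s \<phi> z \<longleftrightarrow> [y = z] (mod int v)" for y z
  proof
    assume eq: "line s \<phi> y = line s \<phi> z"
    have "line s \<phi> (y - z) = line s \<phi> 0" using translate_line_eq[OF eq, of "- z"] by simp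
    then show "[y = z] (mod int v)" using free by (simp add: cong_iff_dvd_diff)
  qed (rule line_cong)
  then have "card (range (line s \<phi>)) = v"
    using card_range_mod(2)[of "int v" "line s \<phi>"] v_pos by simp
  moreover have "finite (snd C)"
    using configurationD(1,5)[OF configuration] by (meson finite_Pow_iff finite_subset)
  moreover have "range (line s \<phi>) \<subseteq> snd C" using translate_line[OF L] by blast
  ultimately show "snd C = range (line s \<phi>)"
    using configurationD(4)[OF configuration] by (metis card_subset_eq)
qed (use v_pos point_eq_iff points in simp_all)

lemma sidon_free_line:
  fixes s :: "'c \<Rightarrow> int"
  assumes L: "line s \<phi> 0 \<in> snd C" and free: "\<And>d. line s \<phi> d = line s \<phi> 0 \<Longrightarrow> int v dvd d"
  shows "sidon (int v) s"
  unfolding sidon_def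
proof (intro allI impI)
  fix i j k l assume neq: "i \<noteq> k" "j \<noteq> l" and eq: "[s i - s k = s j - s l] (mod int v)"
  define d where "d = s i - s j"
  have "[s k = d + s l] (mod int v)"
    using eq unfolding d_def cong_iff_dvd_diff by Groebner_Basis.algebra
  then have "\<phi> (s k) \<in> line s \<phi> 0 \<inter> line s \<phi> d"
    unfolding line_def by (auto simp: point_eq_iff)
  moreover have "\<phi> (s i) \<in> line s \<phi> 0 \<inter> line s \<phi> d"
    using in_lineI[of _ \<phi> 0 s i] in_lineI[of _ \<phi> d s j] by (simp add: d_def)
  moreover have "\<phi> (s i) \<noteq> \<phi> (s k)" using offsets_inj[OF L] neq(1) by (auto simp: point_eq_iff)
  ultimately have "line s \<phi> 0 = line s \<phi> d"
    using configuration_line_unique[OF configuration L translate_line[OF L]] by blast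
  then have "int v dvd s i - s j" using free d_def by metis
  moreover have "int v dvd s k - s l"
    using eq \<open>int v dvd s i - s j\<close> unfolding cong_iff_dvd_diff by Groebner_Basis.algebra
  ultimately show "i = j \<and> k = l"
    using offsets_inj[OF L] by (simp add: cong_iff_dvd_diff)
qed

end

theorem connected_cyclic_configuration_coordinatization:
  assumes conf: "configuration v k v k C" and "CARD('c) = k"
    and connected: "connected_configuration C" and "cyclic_configuration C"
  obtains s :: "'c::finite \<Rightarrow> int" and \<phi> where "configuration_coordinatization (int v) s \<phi> C"
proof -
  obtain f where f: "automorphism f C" "cyclic_on f (fst C)"
    using assms(4) unfolding cyclic_configuration_def by blast
  have "v > 0" using configurationD(1-3)[OF conf] by (auto simp: card_gt_0_iff)
  then obtain \<phi> where "\<And>x y. \<phi> x = \<phi> y \<longleftrightarrow> [x = y] (mod int v)" "range \<phi> = fst C"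
    "\<And>x. f (\<phi> x) = \<phi> (x + 1)"
    using cyclic_on_labelling[OF f(2) configurationD(2)[OF conf]] by metis
  then interpret cyclic_labelling v k \<phi> f C "TYPE('c)"
    using conf assms(2) f(1) by unfold_locales (auto simp: automorphism_def isomorphism_def)
  obtain s :: "'c \<Rightarrow> int"
    where s: "line s \<phi> 0 \<in> snd C" "\<And>d. line s \<phi> d = line s \<phi> 0 \<Longrightarrow> int v dvd d"
    using free_line_exists by blast
  interpret coordinatization "int v" s \<phi> C
    by (rule coordinatization_free_line[OF s])
  have "configuration_coordinatization (int v) s \<phi> C"
    using sidon_free_line[OF s] connected_imp_primitive[OF conf connected] by unfold_locales
  then show ?thesis by (rule that)
qed

section \<open>Comparing two coordinatizations\<close>

lemma cong_affine_if_increments_cong: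
  fixes h :: "int \<Rightarrow> int"
  assumes increment: "\<And>x. [h (x + 1) = h x + u] (mod m)"
  shows "[h x = h 0 + u * x] (mod m)"
proof (induction x rule: int_induct[of _ 0])
  case (step1 x)
  then show ?case
    using increment[of x] unfolding cong_iff_dvd_diff
    by (simp add: algebra_simps) Groebner_Basis.algebra
next
  case (step2 x)
  then show ?case
    using increment[of "x - 1"] unfolding cong_iff_dvd_diff
    by (simp add: algebra_simps) Groebner_Basis.algebra
qed simp

lemma affinely_equivalentI:
  assumes prim: "primitive m s" and "bij \<pi>"
    and offsets: "\<And>y i. [h (y + s i) = g y + t (\<pi> i)] (mod m)"
    and cong: "\<And>x y. [x = y] (mod m) \<Longrightarrow> [h x = h y] (mod m)"
  shows "affinely_equivalent m s t"
proof -
  have step: "[h (x + (s i - s j)) = h x + (t (\<pi> i) - t (\<pi> j))] (mod m)" for x i j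
    using offsets[of "x - s j" i] offsets[of "x - s j" j] unfolding cong_iff_dvd_diff
    by (simp add: algebra_simps) Groebner_Basis.algebra
  define \<delta> where "\<delta> x = (h (x + 1) - h x) mod m" for x
  have \<delta>_const: "\<delta> x = \<delta> 0" for x
  proof (rule primitive_periodic_constant[where f = \<delta>, OF prim])
    fix x
    have "[h (x + m + 1) = h (x + 1)] (mod m)" "[h (x + m) = h x] (mod m)"
      by (rule cong, simp add: cong_iff_dvd_diff)+
    then show "\<delta> (x + m) = \<delta> x"
      unfolding \<delta>_def cong_def[symmetric] by (rule cong_diff)
  next
    fix i j x
    show "\<delta> (x + (s i - s j)) = \<delta> x"
      using step[of x i j] step[of "x + 1" i j]
      unfolding \<delta>_def cong_def[symmetric] cong_iff_dvd_diff
      by (simp add: algebra_simps) Groebner_Basis.algebra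
  qed
  define u where "u = h 1 - h 0"
  have "[h (x + 1) = h x + u] (mod m)" for x
    using \<delta>_const[of x] unfolding \<delta>_def u_def cong_def[symmetric] cong_iff_dvd_diff
    by (simp add: algebra_simps)
  then have "[h x = h 0 + u * x] (mod m)" for x by (rule cong_affine_if_increments_cong)
  then have "[t (\<pi> i) - t (\<pi> j) = u * (s i - s j)] (mod m)" for i j
    using step[of 0 i j] unfolding cong_iff_dvd_diff
    by (metis (no_types, opaque_lifting) add_0 cong_add_lcancel cong_iff_dvd_diff cong_sym
        cong_trans)
  then show ?thesis using \<open>bij \<pi>\<close> unfolding affinely_equivalent_def by blast
qed

text \<open>Consecutive offsets around a closed walk of length six in the incidence graph, of which
  \<open>k, i, j\<close> are prescribed. Neighbouring ones differ because the walk does not turn back.\<close>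

definition hexagon :: "int \<Rightarrow> ('c \<Rightarrow> int) \<Rightarrow> 'c \<Rightarrow> 'c \<Rightarrow> 'c \<Rightarrow> bool" where
  "hexagon m s k i j \<longleftrightarrow> (\<exists>a b c. j \<noteq> a \<and> a \<noteq> b \<and> b \<noteq> c \<and> c \<noteq> k \<and>
     [s k - s i + s j - s a + s b - s c = 0] (mod m))"

text \<open>The path \<open>q, L, p, M\<close> in the incidence graph closes up to a hexagon.\<close>

definition on_hexagon :: "'a incidence \<Rightarrow> 'a \<Rightarrow> 'a set \<Rightarrow> 'a \<Rightarrow> 'a set \<Rightarrow> bool" where
  "on_hexagon C q L p M \<longleftrightarrow>
     (\<exists>r\<in>M. \<exists>N\<in>snd C. r \<noteq> p \<and> N \<noteq> L \<and> N \<noteq> M \<and> q \<in> N \<and> r \<in> N)"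

context configuration_coordinatization
begin

lemma on_hexagon_imp_hexagon:
  assumes "j \<noteq> i" "k \<noteq> i"
    and "on_hexagon C (\<phi> (y + s j)) (line s \<phi> y) (\<phi> (y + s i)) (line s \<phi> (y + s i - s k))"
  shows "hexagon m s k i j"
proof -
  let ?L = "line s \<phi> y" and ?M = "line s \<phi> (y + s i - s k)"
  obtain r N where r: "r \<in> ?M" "r \<noteq> \<phi> (y + s i)"
    and N: "N \<in> snd C" "N \<noteq> ?L" "N \<noteq> ?M" "\<phi> (y + s j) \<in> N" "r \<in> N"
    using assms(3) unfolding on_hexagon_def by blast
  obtain c where c: "r = \<phi> (y + s i - s k + s c)" using r(1) unfolding line_def by blast
  then have "c \<noteq> k" using r(2) by auto
  obtain a where a: "N = line s \<phi> (y + s j - s a)" using line_through_point N(1,4) by blast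
  then have "j \<noteq> a" using N(2) by auto
  obtain b where "[y + s i - s k + s c = y + s j - s a + s b] (mod m)"
    using N(5) unfolding a c point_in_line_iff by blast
  then have closed: "[s k - s i + s j - s a + s b - s c = 0] (mod m)"
    unfolding cong_iff_dvd_diff by Groebner_Basis.algebra
  have "b \<noteq> c"
  proof
    assume "b = c"
    have "[y + s j - s a = y + s i - s k] (mod m)"
      using closed[unfolded \<open>b = c\<close>] unfolding cong_iff_dvd_diff by Groebner_Basis.algebra
    then show False using N(3) a line_cong by blast
  qed
  have "a \<noteq> b"
  proof
    assume "a = b"
    have "[s k - s i = s c - s j] (mod m)"
      using closed[unfolded \<open>a = b\<close>] unfolding cong_iff_dvd_diff by Groebner_Basis.algebra
    then show False
      using sidonD[OF sidon, of k i c j] sidon_inj[OF sidon, of k i] assms(1,2) \<open>c \<noteq> k\<close>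
      by (cases "c = j") (auto simp: cong_iff_dvd_diff)
  qed
  with \<open>b \<noteq> c\<close> \<open>c \<noteq> k\<close> \<open>j \<noteq> a\<close> closed show ?thesis unfolding hexagon_def by blast
qed

lemma hexagon_imp_on_hexagon:
  assumes "CARD('c) > 1" and "hexagon m s k i j"
  shows "on_hexagon C (\<phi> (y + s j)) (line s \<phi> y) (\<phi> (y + s i)) (line s \<phi> (y + s i - s k))"
proof -
  obtain a b c where abc: "j \<noteq> a" "b \<noteq> c" "c \<noteq> k"
    and closed: "[s k - s i + s j - s a + s b - s c = 0] (mod m)"
    using assms(2) unfolding hexagon_def by blast
  let ?M = "line s \<phi> (y + s i - s k)" and ?N = "line s \<phi> (y + s j - s a)"
  let ?r = "\<phi> (y + s i - s k + s c)"
  have "?r \<noteq> \<phi> (y + s i)"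
    using offset_inj[of "y + s i - s k" c k] abc(3) by auto
  moreover have "?N \<noteq> line s \<phi> y"
  proof
    assume "?N = line s \<phi> y"
    then have "[s j = s a] (mod m)"
      unfolding line_eq_iff[OF assms(1)] cong_iff_dvd_diff by Groebner_Basis.algebra
    then show False using abc(1) sidon_inj[OF sidon] by blast
  qed
  moreover have "?N \<noteq> ?M"
  proof
    assume "?N = ?M"
    then have "[s b = s c] (mod m)"
      using closed unfolding line_eq_iff[OF assms(1)] cong_iff_dvd_diff by Groebner_Basis.algebra
    then show False using abc(2) sidon_inj[OF sidon] by blast
  qed
  moreover have "?r \<in> ?N"
  proof -
    have "[y + s i - s k + s c = y + s j - s a + s b] (mod m)"
      using closed unfolding cong_iff_dvd_diff by Groebner_Basis.algebra
    then show ?thesis unfolding point_in_line_iff by blast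
  qed
  moreover have "\<phi> (y + s j) \<in> ?N" by (rule point_in_line_diff)
  ultimately show ?thesis
    unfolding on_hexagon_def using line_in_lines point_in_line by blast
qed

end

locale recoordinatization =
  S: configuration_coordinatization m s \<phi> C + T: configuration_coordinatization m t \<psi> C
  for m and s :: "'c::finite \<Rightarrow> int" and \<phi> :: "int \<Rightarrow> 'a" and t :: "'c \<Rightarrow> int" and \<psi> and C +
  assumes card_offsets: "CARD('c) > 1"
begin

definition line_position :: "int \<Rightarrow> int" where
  "line_position y = (SOME z. line s \<phi> y = line t \<psi> z)"

definition line_recoloring :: "int \<Rightarrow> 'c \<Rightarrow> 'c" where
  "line_recoloring y i = (SOME j. \<phi> (y + s i) = \<psi> (line_position y + t j))"

definition point_recoloring :: "int \<Rightarrow> 'c \<Rightarrow> 'c" where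
  "point_recoloring x i = line_recoloring (x - s i) i"

lemma line_position: "line s \<phi> y = line t \<psi> (line_position y)"
proof -
  have "\<exists>z. line s \<phi> y = line t \<psi> z" using S.line_in_lines[of y] T.lines by auto
  then show ?thesis unfolding line_position_def by (rule someI_ex)
qed

lemma line_recoloring: "\<phi> (y + s i) = \<psi> (line_position y + t (line_recoloring y i))"
proof -
  have "\<exists>j. \<phi> (y + s i) = \<psi> (line_position y + t j)"
    using S.point_in_line[of y i] unfolding line_position by (auto simp: line_def)
  then show ?thesis unfolding line_recoloring_def by (rule someI_ex)
qed

lemma point_recoloring_offset: "point_recoloring (y + s i) i = line_recoloring y i"
  by (simp add: point_recoloring_def)

lemma point_recoloring:
  assumes "\<phi> x = \<psi> z"
  shows "line s \<phi> (x - s k) = line t \<psi> (z - t (point_recoloring x k))"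
proof -
  have "\<psi> z = \<psi> (line_position (x - s k) + t (point_recoloring x k))"
    using line_recoloring[of "x - s k" k] assms by (simp add: point_recoloring_def)
  then have "[line_position (x - s k) = z - t (point_recoloring x k)] (mod m)"
    unfolding T.point_eq_iff cong_iff_dvd_diff by Groebner_Basis.algebra
  then show ?thesis unfolding line_position by (rule T.line_cong)
qed

lemma inj_line_recoloring: "inj (line_recoloring y)"
  by (rule injI) (metis S.offset_inj line_recoloring)

lemma inj_point_recoloring: "inj (point_recoloring x)"
proof (rule injI)
  fix i j assume eq: "point_recoloring x i = point_recoloring x j"
  obtain z where "\<phi> x = \<psi> z" using S.points T.points by (metis rangeE rangeI)
  then have "line s \<phi> (x - s i) = line s \<phi> (x - s j)" using point_recoloring eq by metis
  then have "[s i = s j] (mod m)"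
    unfolding S.line_eq_iff[OF card_offsets] cong_iff_dvd_diff by Groebner_Basis.algebra
  then show "i = j" by (rule sidon_inj[OF S.sidon])
qed

lemma surj_line_recoloring: "surj (line_recoloring y)"
  using inj_line_recoloring by (simp add: finite_UNIV_inj_surj)

lemma surj_point_recoloring: "surj (point_recoloring x)"
  using inj_point_recoloring by (simp add: finite_UNIV_inj_surj)

lemma hexagon_recoloring:
  assumes "k \<noteq> i" "j \<noteq> i"
  shows "hexagon m s k i j \<longleftrightarrow>
    hexagon m t (point_recoloring (y + s i) k) (line_recoloring y i) (line_recoloring y j)"
proof -
  let ?k = "point_recoloring (y + s i) k"
  let ?i = "line_recoloring y i" and ?j = "line_recoloring y j"
  have "?j \<noteq> ?i" using assms(2) inj_line_recoloring by (metis injD)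
  have "?k \<noteq> ?i" using assms(1) inj_point_recoloring point_recoloring_offset by (metis injD)
  have M: "line s \<phi> (y + s i - s k) = line t \<psi> (line_position y + t ?i - t ?k)"
    using point_recoloring[OF line_recoloring] .
  have "hexagon m s k i j \<longleftrightarrow>
      on_hexagon C (\<phi> (y + s j)) (line s \<phi> y) (\<phi> (y + s i)) (line s \<phi> (y + s i - s k))"
    using S.on_hexagon_imp_hexagon S.hexagon_imp_on_hexagon[OF card_offsets] assms by blast
  also have "\<dots> \<longleftrightarrow> hexagon m t ?k ?i ?j"
    unfolding line_recoloring[of y] line_position[of y] M
    using T.on_hexagon_imp_hexagon T.hexagon_imp_on_hexagon[OF card_offsets]
      \<open>?j \<noteq> ?i\<close> \<open>?k \<noteq> ?i\<close> by blast
  finally show ?thesis .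
qed

lemma line_recoloring_cong:
  assumes "[y = z] (mod m)"
  shows "line_recoloring y = line_recoloring z"
proof
  fix i
  let ?i = "line_recoloring y i" and ?i' = "line_recoloring z i"
  have "[line_position y = line_position z] (mod m)"
    using S.line_cong[OF assms] unfolding line_position T.line_eq_iff[OF card_offsets] .
  moreover have "\<phi> (y + s i) = \<phi> (z + s i)" using assms by (simp add: S.point_eq_iff cong_add)
  then have "[line_position y + t ?i = line_position z + t ?i'] (mod m)"
    by (simp add: line_recoloring T.point_eq_iff)
  ultimately have "[t ?i = t ?i'] (mod m)"
    unfolding cong_iff_dvd_diff by Groebner_Basis.algebra
  then show "?i = ?i'" by (rule sidon_inj[OF T.sidon])
qed

lemma affinely_equivalent_if_recolorings_agree:
  assumes agree: "\<And>y i. point_recoloring (y + s i) = line_recoloring y"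
  shows "affinely_equivalent m s t"
proof -
  have const: "line_recoloring y = line_recoloring 0" for y
  proof (rule primitive_periodic_constant[where f = line_recoloring, OF S.primitive])
    show "line_recoloring (x + m) = line_recoloring x" for x
      by (rule line_recoloring_cong) (simp add: cong_def)
    show "line_recoloring (x + (s i - s j)) = line_recoloring x" for i j x
      using agree[of "x + (s i - s j)" j] agree[of x i] by simp
  qed
  have "\<exists>z. \<phi> x = \<psi> z" for x using S.points T.points by (metis rangeE rangeI)
  then obtain h where h: "\<And>x. \<phi> x = \<psi> (h x)" by metis
  show ?thesis
  proof (rule affinely_equivalentI[OF S.primitive])
    show "bij (line_recoloring 0)"
      using inj_line_recoloring surj_line_recoloring by (simp add: bij_def)
    show "[h (y + s i) = line_position y + t (line_recoloring 0 i)] (mod m)" for y i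
      using line_recoloring[of y i] by (simp add: h const[of y] T.point_eq_iff)
    show "[h x = h y] (mod m)" if "[x = y] (mod m)" for x y
      using that h S.point_eq_iff T.point_eq_iff by metis
  qed
qed

end

section \<open>Three colors\<close>

datatype color = Red | Green | Blue

lemma UNIV_color: "(UNIV :: color set) = {Red, Green, Blue}"
  using color.exhaust by auto

instance color :: finite
  by standard (simp add: UNIV_color)

lemma card_color [simp]: "CARD(color) = 3"
  by (simp add: UNIV_color)

lemma all_color: "(\<forall>i. P i) \<longleftrightarrow> P Red \<and> P Green \<and> P Blue"
  by (metis color.exhaust)

lemma ex_color: "(\<exists>i. P i) \<longleftrightarrow> P Red \<or> P Green \<or> P Blue"
  by (metis color.exhaust)

lemma color_exhaust_distinct:
  fixes x :: color
  assumes "distinct [i, j, k]"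
  shows "x = i \<or> x = j \<or> x = k"
  using assms by (cases i; cases j; cases k; cases x) auto

lemma color_cases_distinct [consumes 1]:
  fixes x :: color
  assumes "distinct [i, j, k]"
  obtains (first) "x = i" | (second) "x = j" | (third) "x = k"
  using color_exhaust_distinct[OF assms] by blast

lemma third_color:
  fixes i j :: color
  assumes "i \<noteq> j"
  obtains k where "distinct [i, j, k]"
  using that[of Red] that[of Green] that[of Blue] assms by (cases i; cases j) auto

lemma other_colors:
  fixes i :: color
  obtains j k where "distinct [i, j, k]"
  using that[of Red Green] that[of Green Blue] that[of Blue Red] by (cases i) auto

lemma inj_color_eqI:
  fixes f g :: "color \<Rightarrow> color"
  assumes "inj f" "inj g" "f i = g i" "f j = g j" "i \<noteq> j"
  shows "f = g"
proof
  obtain k where k: "distinct [i, j, k]" using third_color[OF \<open>i \<noteq> j\<close>] .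
  have f: "distinct [f i, f j, f k]" and g: "distinct [g i, g j, g k]"
    using k assms(1,2) by (simp_all add: inj_eq)
  have "g k = f k"
    using g assms(3,4) by (cases "g k" rule: color_cases_distinct[OF f]) auto
  then show "f x = g x" for x using color_exhaust_distinct[OF k, of x] assms(3,4) by auto
qed

lemma bij_color_obtain:
  fixes i j k i' j' k' :: color
  assumes "distinct [i, j, k]" "distinct [i', j', k']"
  obtains \<pi> where "bij \<pi>" "\<pi> i = i'" "\<pi> j = j'" "\<pi> k = k'"
proof -
  define \<pi> where "\<pi> = (\<lambda>x. if x = i then i' else if x = j then j' else k')"
  have "inj \<pi>"
  proof (rule injI)
    fix x y assume "\<pi> x = \<pi> y"
    then show "x = y"
      using assms by (cases x rule: color_cases_distinct[OF assms(1)];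
        cases y rule: color_cases_distinct[OF assms(1)]) (auto simp: \<pi>_def)
  qed
  then have "bij \<pi>" by (simp add: bij_def finite_UNIV_inj_surj)
  moreover have "\<pi> i = i'" "\<pi> j = j'" "\<pi> k = k'" using assms(1) by (auto simp: \<pi>_def)
  ultimately show ?thesis by (rule that)
qed

section \<open>Hexagons of a three-point base line\<close>

definition doubling :: "int \<Rightarrow> (color \<Rightarrow> int) \<Rightarrow> bool" where
  "doubling m s \<longleftrightarrow> (\<exists>i j k. distinct [i, j, k] \<and> [2 * (s i - s j) = s k - s i] (mod m))"

lemma doublingI:
  assumes "distinct [i, j, k]" "m dvd 3 * s i - 2 * s j - s k"
  shows "doubling m s"
proof -
  have "[2 * (s i - s j) = s k - s i] (mod m)"
    using assms(2) unfolding cong_iff_dvd_diff by Groebner_Basis.algebra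
  then show ?thesis unfolding doubling_def using assms(1) by blast
qed

text \<open>The walks with offsets \<open>k, i, j, k, i, j\<close> bound the faces of the hexagonal tiling, two of
  which meet at each edge.\<close>

lemma hexagon_distinct: "distinct [k, i, j] \<Longrightarrow> hexagon m s k i j"
  unfolding hexagon_def by (intro exI[of _ k] exI[of _ i] exI[of _ j]) auto

lemma hexagon_backtrackD:
  assumes sid: "sidon m s" and ki: "k \<noteq> i" and hex: "hexagon m s k i k"
  shows "[3 * (s k - s i) = 0] (mod m) \<or> doubling m s"
proof -
  obtain a b c where abc: "k \<noteq> a" "a \<noteq> b" "b \<noteq> c" "c \<noteq> k"
    and closed: "m dvd s k - s i + s k - s a + s b - s c"
    using hex unfolding hexagon_def cong_iff_dvd_diff by auto
  obtain h where h: "distinct [k, i, h]" using third_color[OF ki] .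
  have "a = i \<or> a = h" "c = i \<or> c = h"
    using abc color_exhaust_distinct[OF h] by metis+
  then consider
      (i_k_i) "a = i" "b = k" "c = i" | (i_h_i) "a = i" "b = h" "c = i"
    | (i_k_h) "{a, c} = {i, h}" "b = k"
    | (h_k_h) "a = h" "b = k" "c = h" | (h_i_h) "a = h" "b = i" "c = h"
    using abc color_exhaust_distinct[OF h, of b] by auto
  then show ?thesis
  proof cases
    case i_k_i
    then show ?thesis using closed unfolding cong_iff_dvd_diff by (simp add: algebra_simps)
  next
    case i_h_i
    have "m dvd 3 * s i - 2 * s k - s h" using closed[unfolded i_h_i] by Groebner_Basis.algebra
    then show ?thesis using doublingI[of i k h] h by auto
  next
    case i_k_h
    then have "s a + s c = s i + s h" by (auto simp: doubleton_eq_iff)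
    then have "m dvd 3 * s k - 2 * s i - s h"
      using closed unfolding i_k_h(2) by Groebner_Basis.algebra
    then show ?thesis using doublingI[of k i h] h by auto
  next
    case h_k_h
    have "m dvd 3 * s k - 2 * s h - s i" using closed[unfolded h_k_h] by Groebner_Basis.algebra
    then show ?thesis using doublingI[of k h i] h by auto
  next
    case h_i_h
    have "[s k - s h = s h - s k] (mod m)"
      using closed[unfolded h_i_h] unfolding cong_iff_dvd_diff by Groebner_Basis.algebra
    then show ?thesis using sidonD[OF sid, of k h h k] h by auto
  qed
qed

lemma hexagon_backtrack_triple:
  assumes "k \<noteq> i" "[3 * (s k - s i) = 0] (mod m)"
  shows "hexagon m s k i k"
proof -
  have "[s k - s i + s k - s i + s k - s i = 0] (mod m)"
    using assms(2) by (simp add: algebra_simps)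
  then show ?thesis unfolding hexagon_def using assms(1) by metis
qed

lemma hexagon_backtrack_doubling:
  assumes "doubling m s"
  obtains k where "k \<noteq> i" "hexagon m s k i k"
proof -
  obtain a b c where abc: "distinct [a, b, c]" and double: "[2 * (s a - s b) = s c - s a] (mod m)"
    using assms unfolding doubling_def by blast
  from abc show ?thesis
  proof (cases rule: color_cases_distinct[where x = i])
    case first
    have "[s b - s a + s b - s a + s c - s a = 0] (mod m)"
      using double unfolding cong_iff_dvd_diff by Groebner_Basis.algebra
    then have "hexagon m s b a b" unfolding hexagon_def using abc by fastforce
    then show ?thesis using that[of b] abc first by auto
  next
    case second
    have "[s a - s b + s a - s b + s a - s c = 0] (mod m)"
      using double unfolding cong_iff_dvd_diff by Groebner_Basis.algebra
    then have "hexagon m s a b a" unfolding hexagon_def using abc by fastforce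
    then show ?thesis using that[of a] abc second by auto
  next
    case third
    have "[s a - s c + s a - s b + s a - s b = 0] (mod m)"
      using double unfolding cong_iff_dvd_diff by Groebner_Basis.algebra
    then have "hexagon m s a c a" unfolding hexagon_def using abc by fastforce
    then show ?thesis using that[of a] abc third by auto
  qed
qed

text \<open>The edges of a rich color lie on hexagons other than the faces.\<close>

definition rich :: "int \<Rightarrow> (color \<Rightarrow> int) \<Rightarrow> color \<Rightarrow> bool" where
  "rich m s i \<longleftrightarrow> (\<exists>j. j \<noteq> i \<and> hexagon m s j i j)"

lemma rich_iff_all_hexagon: "rich m s i \<longleftrightarrow> (\<exists>j. j \<noteq> i \<and> (\<forall>k. k \<noteq> i \<longrightarrow> hexagon m s k i j))"
proof
  assume "rich m s i"
  then obtain j where j: "j \<noteq> i" "hexagon m s j i j" unfolding rich_def by blast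
  then have "hexagon m s k i j" if "k \<noteq> i" for k
    using that hexagon_distinct[of k i j] by (cases "k = j") auto
  then show "\<exists>j. j \<noteq> i \<and> (\<forall>k. k \<noteq> i \<longrightarrow> hexagon m s k i j)" using j(1) by blast
qed (auto simp: rich_def)

lemma rich_iff_triple:
  assumes "sidon m s" "\<not> doubling m s"
  shows "rich m s i \<longleftrightarrow> (\<exists>j. j \<noteq> i \<and> [3 * (s j - s i) = 0] (mod m))"
proof -
  have "hexagon m s j i j \<longleftrightarrow> [3 * (s j - s i) = 0] (mod m)" if "j \<noteq> i" for j
    using hexagon_backtrackD[OF assms(1) that] hexagon_backtrack_triple[OF that] assms(2) by blast
  then show ?thesis unfolding rich_def by blast
qed

lemma primitive_not_all_triple:
  fixes s :: "color \<Rightarrow> int"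
  assumes prim: "primitive m s" and "\<not> m dvd 3"
    and ij: "[3 * (s i - s j) = 0] (mod m)" and ik: "[3 * (s i - s k) = 0] (mod m)"
  shows "\<not> distinct [i, j, k]"
proof
  assume distinct: "distinct [i, j, k]"
  have base: "m dvd 3 * (s i - s x)" for x
    using color_exhaust_distinct[OF distinct, of x] ij ik by (auto simp: cong_0_iff)
  have "m dvd 3 * (s x - s y)" for x y
    using base[of x] base[of y] by Groebner_Basis.algebra
  then have "m dvd 3"
    by (rule primitive_dvd_cancel[OF prim])
  then show False using \<open>\<not> m dvd 3\<close> by blast
qed

lemma unique_poor_color:
  assumes "sidon m s" "primitive m s" "\<not> m dvd 3" "\<not> doubling m s" "rich m s i"
  obtains h where "h \<noteq> i" "\<And>k. rich m s k \<longleftrightarrow> k \<noteq> h"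
proof -
  note rich_iff = rich_iff_triple[OF assms(1,4)]
  have flip: "[3 * (s b - s a) = 0] (mod m)" if "[3 * (s a - s b) = 0] (mod m)" for a b
    using that unfolding cong_iff_dvd_diff by Groebner_Basis.algebra
  obtain j where j: "j \<noteq> i" "[3 * (s j - s i) = 0] (mod m)" using rich_iff assms(5) by blast
  obtain h where h: "distinct [i, j, h]" using third_color j(1) by metis
  have "rich m s j" using rich_iff flip[OF j(2)] j(1) by metis
  moreover have "\<not> rich m s h"
  proof
    assume "rich m s h"
    then obtain k where k: "k \<noteq> h" "[3 * (s k - s h) = 0] (mod m)" using rich_iff by blast
    then have "k = i \<or> k = j" using color_exhaust_distinct[OF h, of k] by auto
    then show False
      using primitive_not_all_triple[OF assms(2,3), of i j h] h j(2) k(2) flip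
        primitive_not_all_triple[OF assms(2,3), of j i h] by auto
  qed
  ultimately have "rich m s k \<longleftrightarrow> k \<noteq> h" for k
    using color_exhaust_distinct[OF h, of k] h assms(5) by metis
  then show ?thesis using that[of h] h by auto
qed

lemma doubling_iff_all_rich:
  assumes "sidon m s" "primitive m s" "\<not> m dvd 3"
  shows "doubling m s \<longleftrightarrow> (\<forall>i. rich m s i)"
proof
  assume "doubling m s"
  then show "\<forall>i. rich m s i" unfolding rich_def using hexagon_backtrack_doubling by metis
next
  assume all_rich: "\<forall>i. rich m s i"
  show "doubling m s"
  proof (rule ccontr)
    assume "\<not> doubling m s"
    then show False using unique_poor_color[OF assms] all_rich by metis
  qed
qed

lemma doubling_affinely_equivalent:
  assumes prim: "primitive m s" and "doubling m s" "doubling m t"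
  shows "affinely_equivalent m s t"
proof -
  obtain a b c where abc: "distinct [a, b, c]" and s: "[2 * (s a - s b) = s c - s a] (mod m)"
    using assms(2) unfolding doubling_def by blast
  obtain a' b' c' where abc': "distinct [a', b', c']"
    and t: "[2 * (t a' - t b') = t c' - t a'] (mod m)"
    using assms(3) unfolding doubling_def by blast
  have "coprime (s a - s b) m"
  proof (rule coprimeI)
    fix g assume g: "g dvd s a - s b" "g dvd m"
    have "[2 * (s a - s b) = s c - s a] (mod g)" using s g(2) cong_dvd_modulus by blast
    then have "g dvd s c - s a" using g(1) by (metis cong_dvd_iff dvd_mult)
    then have base: "g dvd s a - s x" for x
      using color_exhaust_distinct[OF abc, of x] g(1) by (auto simp: dvd_diff_commute)
    have "g dvd s x - s y" for x y using base[of x] base[of y] by Groebner_Basis.algebra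
    then show "is_unit g" using prim g(2) unfolding primitive_iff by blast
  qed
  then obtain w where w: "[(s a - s b) * w = 1] (mod m)" using cong_solve_coprime_int by blast
  define u where "u = (t a' - t b') * w"
  obtain \<pi> where "bij \<pi>" and \<pi>: "\<pi> a = a'" "\<pi> b = b'" "\<pi> c = c'"
    using bij_color_obtain[OF abc abc'] .
  have "m dvd t a' - t b' - u * (s a - s b)"
    using w unfolding u_def cong_iff_dvd_diff by Groebner_Basis.algebra
  moreover from this have "m dvd t a' - t c' - u * (s a - s c)"
    using s t unfolding cong_iff_dvd_diff by Groebner_Basis.algebra
  ultimately have base: "m dvd t a' - t (\<pi> x) - u * (s a - s x)" for x
    using color_exhaust_distinct[OF abc, of x] by (auto simp: \<pi>)
  have "[t (\<pi> x) - t (\<pi> y) = u * (s x - s y)] (mod m)" for x y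
    using base[of x] base[of y] unfolding cong_iff_dvd_diff by Groebner_Basis.algebra
  then show ?thesis using \<open>bij \<pi>\<close> unfolding affinely_equivalent_def by blast
qed

section \<open>Isomorphic configurations have affinely equivalent base lines\<close>

locale color_recoordinatization = recoordinatization m s \<phi> t \<psi> C
  for m and s :: "color \<Rightarrow> int" and \<phi> :: "int \<Rightarrow> 'a" and t \<psi> C +
  assumes not_dvd_3: "\<not> m dvd 3"
begin

lemma rich_recoloring: "rich m t (line_recoloring y i) \<longleftrightarrow> rich m s i"
proof -
  let ?P = "point_recoloring (y + s i)" and ?\<rho> = "line_recoloring y"
  have all_iff: "(\<forall>k. k \<noteq> ?\<rho> i \<longrightarrow> Q k) \<longleftrightarrow> (\<forall>k. k \<noteq> i \<longrightarrow> Q (?P k))" for Q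
    using surj_point_recoloring[of "y + s i"] inj_point_recoloring[of "y + s i"]
      point_recoloring_offset[of y i] by (metis injD surjD)
  have ex_iff: "(\<exists>j. j \<noteq> ?\<rho> i \<and> Q j) \<longleftrightarrow> (\<exists>j. j \<noteq> i \<and> Q (?\<rho> j))" for Q
    using surj_line_recoloring[of y] inj_line_recoloring[of y] by (metis injD surjD)
  show ?thesis
    unfolding rich_iff_all_hexagon all_iff ex_iff using hexagon_recoloring by blast
qed

lemma doubling_recoloring: "doubling m t \<longleftrightarrow> doubling m s"
  unfolding doubling_iff_all_rich[OF S.sidon S.primitive not_dvd_3]
    doubling_iff_all_rich[OF T.sidon T.primitive not_dvd_3]
  using rich_recoloring[of 0] surj_line_recoloring[of 0] by (metis surjD)

text \<open>At an edge of a poor color the two faces are the only hexagons, so both ends of the edge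
  recolor the remaining two colors alike. At an edge of a rich color both ends have to send the
  only poor color to the only poor color.\<close>

lemma recolorings_agree:
  assumes "\<not> doubling m s"
  shows "point_recoloring (y + s i) = line_recoloring y"
    (is "?P = ?L")
proof (cases "rich m s i")
  case False
  show ?thesis
  proof
    fix k
    show "?P k = ?L k"
    proof (cases "k = i")
      case k: False
      have "\<not> hexagon m t (?P k) (?L i) (?L k)"
        using False k hexagon_recoloring unfolding rich_def by blast
      moreover have "?L k \<noteq> ?L i" "?P k \<noteq> ?L i"
        using k inj_line_recoloring inj_point_recoloring point_recoloring_offset by (metis injD)+
      ultimately show ?thesis
        using hexagon_distinct by fastforce
    qed (simp add: point_recoloring_offset)
  qed
next
  case True
  obtain h where h: "h \<noteq> i" "\<And>k. rich m s k \<longleftrightarrow> k \<noteq> h"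
    using unique_poor_color[OF S.sidon S.primitive not_dvd_3 assms True] by blast
  obtain h' where h': "\<And>k. rich m t k \<longleftrightarrow> k \<noteq> h'"
    using unique_poor_color[OF T.sidon T.primitive not_dvd_3] assms True
      rich_recoloring[of y i] doubling_recoloring by metis
  have "line_recoloring z h = h'" for z using rich_recoloring[of z h] h(2) h' by blast
  then have "?P h = ?L h" by (simp add: point_recoloring_def)
  then show ?thesis
    using inj_color_eqI[OF inj_point_recoloring inj_line_recoloring point_recoloring_offset] h(1)
    by metis
qed

theorem affinely_equivalent: "affinely_equivalent m s t"
proof (cases "doubling m s")
  case True
  then show ?thesis using doubling_affinely_equivalent S.primitive doubling_recoloring by blast
next
  case False
  then show ?thesis using affinely_equivalent_if_recolorings_agree recolorings_agree by blast
qed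

end

theorem configuration_coordinatizations_affinely_equivalent:
  fixes s t :: "color \<Rightarrow> int"
  assumes "configuration_coordinatization m s \<phi> C" "configuration_coordinatization m t \<psi> C"
    and "\<not> m dvd 3"
  shows "affinely_equivalent m s t"
proof -
  interpret color_recoordinatization m s \<phi> t \<psi> C
    using assms
    by (intro color_recoordinatization.intro color_recoordinatization_axioms.intro
      recoordinatization.intro recoordinatization_axioms.intro) simp_all
  show ?thesis by (rule affinely_equivalent)
qed

section \<open>Roots of quadratic congruences\<close>

definition roots_mod :: "int poly \<Rightarrow> int \<Rightarrow> int set" where
  "roots_mod f m = {x \<in> {0..<m}. m dvd poly f x}"

lemma finite_roots_mod: "finite (roots_mod f m)"
  unfolding roots_mod_def by (rule finite_subset[of _ "{0..<m}"]) auto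

lemma cong_poly:
  fixes f :: "int poly"
  shows "[x = y] (mod m) \<Longrightarrow> [poly f x = poly f y] (mod m)"
  by (induction f) (auto intro: cong_add cong_mult)

lemma dvd_poly_cong_iff:
  fixes f :: "int poly"
  shows "[x = y] (mod m) \<Longrightarrow> m dvd poly f x \<longleftrightarrow> m dvd poly f y"
  by (intro cong_dvd_iff cong_poly)

lemma mod_in_roots_mod_iff: "m > 0 \<Longrightarrow> x mod m \<in> roots_mod f m \<longleftrightarrow> m dvd poly f x"
  using dvd_poly_cong_iff[of "x mod m" x m f] by (simp add: roots_mod_def)

lemma card_roots_mod_mult:
  assumes "a > 0" "b > 0" "coprime a b"
  shows "card (roots_mod f (a * b)) = card (roots_mod f a) * card (roots_mod f b)"
proof -
  let ?r = "\<lambda>x. (x mod a, x mod b)"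
  have dvd_iff: "a * b dvd poly f x \<longleftrightarrow> a dvd poly f x \<and> b dvd poly f x" for x
    using \<open>coprime a b\<close> by (metis divides_mult dvd_mult_left dvd_mult_right)
  have "bij_betw ?r (roots_mod f (a * b)) (roots_mod f a \<times> roots_mod f b)"
  proof (rule bij_betw_imageI)
    show "inj_on ?r (roots_mod f (a * b))"
    proof (rule inj_onI)
      fix x y assume xy: "x \<in> roots_mod f (a * b)" "y \<in> roots_mod f (a * b)" and "?r x = ?r y"
      then have "[x = y] (mod a)" "[x = y] (mod b)" by (simp_all add: cong_def)
      then have "[x = y] (mod a * b)" using \<open>coprime a b\<close> by (rule coprime_cong_mult)
      then show "x = y" using xy by (simp add: roots_mod_def cong_def)
    qed
    show "?r ` roots_mod f (a * b) = roots_mod f a \<times> roots_mod f b"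
    proof (intro equalityI subsetI)
      fix z assume "z \<in> ?r ` roots_mod f (a * b)"
      then show "z \<in> roots_mod f a \<times> roots_mod f b"
        using assms(1,2) dvd_iff by (auto simp: mod_in_roots_mod_iff) (auto simp: roots_mod_def)
    next
      fix z assume "z \<in> roots_mod f a \<times> roots_mod f b"
      then obtain y w where z: "z = (y, w)" and y: "y \<in> roots_mod f a" and w: "w \<in> roots_mod f b"
        by blast
      obtain x where x: "[x = y] (mod a)" "[x = w] (mod b)"
        using binary_chinese_remainder_int[OF \<open>coprime a b\<close>] by blast
      then have "a dvd poly f x" "b dvd poly f x"
        using y w dvd_poly_cong_iff by (auto simp: roots_mod_def)
      then have "x mod (a * b) \<in> roots_mod f (a * b)"
        using assms(1,2) by (simp add: mod_in_roots_mod_iff dvd_iff)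
      moreover have "z = ?r (x mod (a * b))"
        using x y w by (simp add: z roots_mod_def cong_def mod_mod_cancel)
      ultimately show "z \<in> ?r ` roots_mod f (a * b)" by blast
    qed
  qed
  then show ?thesis by (simp add: bij_betw_same_card card_cartesian_product)
qed

lemma card_roots_mod_prod:
  fixes g :: "'b \<Rightarrow> int"
  assumes "finite A" "\<And>a. a \<in> A \<Longrightarrow> g a > 0"
    and "\<And>a b. a \<in> A \<Longrightarrow> b \<in> A \<Longrightarrow> a \<noteq> b \<Longrightarrow> coprime (g a) (g b)"
  shows "card (roots_mod f (\<Prod>a\<in>A. g a)) = (\<Prod>a\<in>A. card (roots_mod f (g a)))"
  using assms
proof (induction A rule: finite_induct)
  case empty
  have "roots_mod f 1 = {0}" by (auto simp: roots_mod_def)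
  then show ?case by simp
next
  case (insert a A)
  have "coprime (g a) (\<Prod>a\<in>A. g a)"
    using insert by (intro prod_coprime_right) auto
  moreover have "(\<Prod>a\<in>A. g a) > 0" using insert.prems by (intro prod_pos) simp
  ultimately show ?case using insert by (simp add: card_roots_mod_mult)
qed

lemma card_roots_mod_prime_factors:
  fixes v :: nat
  assumes "v > 0"
  shows "card (roots_mod f (int v)) =
    (\<Prod>p\<in>prime_factors v. card (roots_mod f (int p ^ multiplicity p v)))"
proof -
  have "int v = (\<Prod>p\<in>prime_factors v. int p ^ multiplicity p v)"
    using arg_cong[OF prime_factorization_nat[OF assms], of int] by simp
  also have "card (roots_mod f \<dots>) =
      (\<Prod>p\<in>prime_factors v. card (roots_mod f (int p ^ multiplicity p v)))"
  proof (rule card_roots_mod_prod)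
    fix p q assume "p \<in> prime_factors v" "q \<in> prime_factors v" "p \<noteq> q"
    then have "coprime p q" by (intro primes_coprime) auto
    then show "coprime (int p ^ multiplicity p v) (int q ^ multiplicity q v)" by simp
  qed (auto simp: prime_factors_gt_0_nat)
  finally show ?thesis .
qed

lemma prime_power_dvd_mult_iff:
  fixes p a b :: "'a::factorial_semiring"
  assumes p: "prime p" and not_both: "\<not> (p dvd a \<and> p dvd b)"
  shows "p ^ e dvd a * b \<longleftrightarrow> p ^ e dvd a \<or> p ^ e dvd b"
proof (cases "e = 0")
  case False
  then show ?thesis
    using prime_power_dvd_multD[OF prime_imp_prime_elem[OF p], of e] not_both
    by (metis dvd_mult dvd_mult2 mult.commute neq0_conv)
qed simp

text \<open>The other root is \<open>- b - z\<close>; as \<open>2 z + b\<close> is prime to \<open>p\<close>, the prime cannot divide both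
  linear factors.\<close>

lemma prime_power_dvd_quadratic_iff:
  fixes p b c z :: int
  assumes p: "prime p" and root: "p ^ e dvd poly [:c, b, 1:] z" and simple: "\<not> p dvd 2 * z + b"
  shows "p ^ e dvd poly [:c, b, 1:] x \<longleftrightarrow> [x = z] (mod p ^ e) \<or> [x = - b - z] (mod p ^ e)"
proof -
  have factor: "poly [:c, b, 1:] x - poly [:c, b, 1:] z = (x - z) * (x - (- b - z))"
    by (simp add: algebra_simps)
  have "p ^ e dvd poly [:c, b, 1:] x \<longleftrightarrow> p ^ e dvd (x - z) * (x - (- b - z))"
    using root unfolding factor[symmetric] by (metis diff_add_cancel dvd_add dvd_diff)
  also have "\<dots> \<longleftrightarrow> p ^ e dvd x - z \<or> p ^ e dvd x - (- b - z)"
  proof (rule prime_power_dvd_mult_iff[OF p], rule notI)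
    assume "p dvd x - z \<and> p dvd x - (- b - z)"
    then have "p dvd (x - (- b - z)) - (x - z)" by (metis dvd_diff)
    then show False using simple by (simp add: algebra_simps)
  qed
  finally show ?thesis by (simp add: cong_iff_dvd_diff)
qed

lemma card_roots_mod_quadratic:
  fixes p b c z :: int
  assumes p: "prime p" and "e > 0"
    and root: "p ^ e dvd poly [:c, b, 1:] z" and simple: "\<not> p dvd 2 * z + b"
  shows "card (roots_mod [:c, b, 1:] (p ^ e)) = 2"
proof -
  let ?q = "p ^ e"
  have "?q > 0" using p by (simp add: prime_gt_0_int)
  note root_iff = prime_power_dvd_quadratic_iff[OF p root simple]
  have "x \<in> roots_mod [:c, b, 1:] ?q \<longleftrightarrow> x = z mod ?q \<or> x = (- b - z) mod ?q" for x
  proof (cases "0 \<le> x \<and> x < ?q")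
    case True
    then have "x mod ?q = x" by simp
    then show ?thesis
      using True root_iff[of x] by (simp add: roots_mod_def cong_def del: poly_pCons)
  next
    case False
    then show ?thesis
      using pos_mod_sign[OF \<open>?q > 0\<close>] pos_mod_bound[OF \<open>?q > 0\<close>] by (auto simp: roots_mod_def)
  qed
  then have "roots_mod [:c, b, 1:] ?q = {z mod ?q, (- b - z) mod ?q}" by blast
  moreover have "z mod ?q \<noteq> (- b - z) mod ?q"
  proof
    assume "z mod ?q = (- b - z) mod ?q"
    then have "?q dvd 2 * z + b" by (simp add: mod_eq_dvd_iff algebra_simps)
    then show False using simple \<open>e > 0\<close> by (meson dvd_power dvd_trans)
  qed
  ultimately show ?thesis by simp
qed

abbreviation square_minus_one :: "int poly" where "square_minus_one \<equiv> [:- 1, 0, 1:]"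

abbreviation cyclotomic3 :: "int poly" where "cyclotomic3 \<equiv> [:1, 1, 1:]"

lemma poly_square_minus_one: "poly square_minus_one x = (x - 1) * (x + 1)"
  by (simp add: algebra_simps)

lemma poly_cyclotomic3: "poly cyclotomic3 x = x\<^sup>2 + x + 1"
  by (simp add: algebra_simps power2_eq_square)

lemma card_square_minus_one_odd_prime_power:
  fixes p :: nat
  assumes "prime p" "odd p" "e > 0"
  shows "card (roots_mod square_minus_one (int p ^ e)) = 2"
proof (rule card_roots_mod_quadratic[of _ _ _ _ 1])
  have "\<not> p dvd 2" using assms(1,2) primes_dvd_imp_eq two_is_prime_nat by blast
  then show "\<not> int p dvd 2 * 1 + 0"
    by (metis add_0_right int_dvd_int_iff mult_1_right of_nat_numeral)
qed (use assms in simp_all)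

lemma two_power_Suc_dvd_square_minus_one_iff:
  fixes x :: int
  assumes "e > 0"
  shows "2 ^ Suc e dvd (x - 1) * (x + 1) \<longleftrightarrow> 2 ^ e dvd x - 1 \<or> 2 ^ e dvd x + 1"
proof
  assume dvd: "2 ^ Suc e dvd (x - 1) * (x + 1)"
  then have "even ((x - 1) * (x + 1))" by (meson dvd_trans dvd_power zero_less_Suc)
  then have "odd x" by auto
  then obtain y where y: "x = 2 * y + 1" by (rule oddE)
  obtain n where n: "e = Suc n" using assms not0_implies_Suc by blast
  have "(x - 1) * (x + 1) = 2 * (2 * (y * (y + 1)))" by (simp add: y algebra_simps)
  then have "2 ^ n dvd y * (y + 1)" using dvd by (simp add: n)
  then have "2 ^ n dvd y \<or> 2 ^ n dvd y + 1"
    by (cases "even y") (simp_all add: coprime_dvd_mult_left_iff coprime_dvd_mult_right_iff)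
  moreover have "x - 1 = 2 * y" "x + 1 = 2 * (y + 1)" by (simp_all add: y)
  ultimately show "2 ^ e dvd x - 1 \<or> 2 ^ e dvd x + 1"
    unfolding n power_Suc by (metis mult_dvd_mono dvd_refl)
next
  assume "2 ^ e dvd x - 1 \<or> 2 ^ e dvd x + 1"
  moreover have "(2::int) dvd 2 ^ e" using assms by simp
  ultimately have "2 dvd x - 1 \<or> 2 dvd x + 1" using dvd_trans by blast
  then have "odd x" by auto
  then have "even (x - 1)" "even (x + 1)" by simp_all
  then show "2 ^ Suc e dvd (x - 1) * (x + 1)"
    using \<open>2 ^ e dvd x - 1 \<or> 2 ^ e dvd x + 1\<close>
    unfolding power_Suc by (metis mult.commute mult_dvd_mono)
qed

lemma roots_mod_square_minus_one_two_power:
  assumes "e > 0"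
  shows "roots_mod square_minus_one (2 ^ Suc e) = {1, 2 ^ e + 1, 2 ^ e - 1, 2 ^ Suc e - 1}"
proof -
  define h :: int where "h = 2 ^ e"
  have "h \<ge> 2" using assms self_le_power[of "2 :: int" e] by (simp add: h_def)
  have "x \<in> roots_mod square_minus_one (2 * h) \<longleftrightarrow> x \<in> {1, h + 1, h - 1, 2 * h - 1}" for x
  proof
    assume "x \<in> roots_mod square_minus_one (2 * h)"
    then have x: "0 \<le> x" "x < 2 * h" and "h dvd x - 1 \<or> h dvd x + 1"
      using two_power_Suc_dvd_square_minus_one_iff[OF assms, of x]
      by (simp_all add: roots_mod_def h_def poly_square_minus_one del: poly_pCons)
    then consider (plus) k where "x = h * k + 1" | (minus) k where "x = h * k - 1"
      by (metis diff_add_cancel add_diff_cancel_right' dvdE)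
    then show "x \<in> {1, h + 1, h - 1, 2 * h - 1}"
    proof cases
      case (plus k)
      have "h * k < h * 2" "h * (-1) < h * k" using x plus \<open>h \<ge> 2\<close> by linarith+
      then have "k < 2" "-1 < k" using \<open>h \<ge> 2\<close> by (simp_all only: mult_less_cancel_left_pos)
      then have "k = 0 \<or> k = 1" by auto
      then show ?thesis using plus by auto
    next
      case (minus k)
      have "h * k < h * 3" "h * 0 < h * k" using x minus \<open>h \<ge> 2\<close> by linarith+
      then have "k < 3" "0 < k" using \<open>h \<ge> 2\<close> by (simp_all only: mult_less_cancel_left_pos)
      then have "k = 1 \<or> k = 2" by auto
      then show ?thesis using minus by auto
    qed
  next
    assume "x \<in> {1, h + 1, h - 1, 2 * h - 1}"
    then have "0 \<le> x" "x < 2 * h" "h dvd x - 1 \<or> h dvd x + 1" using \<open>h \<ge> 2\<close> by auto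
    then show "x \<in> roots_mod square_minus_one (2 * h)"
      using two_power_Suc_dvd_square_minus_one_iff[OF assms, of x]
      by (simp add: roots_mod_def h_def poly_square_minus_one del: poly_pCons)
  qed
  then show ?thesis unfolding h_def by auto
qed

lemma card_square_minus_one_two_power:
  assumes "e > 0"
  shows "card (roots_mod square_minus_one (2 ^ e)) =
    (if e = 1 then 1 else if e = 2 then 2 else 4)"
proof -
  consider (one) "e = 1" | (two) "e = 2" | (large) "e > 2" using assms by linarith
  then show ?thesis
  proof cases
    case one
    have "{0..<2} = {0, 1 :: int}" by auto
    then have "roots_mod square_minus_one 2 = {1}" unfolding roots_mod_def by auto
    then show ?thesis using one by simp
  next
    case two
    have "roots_mod square_minus_one (2 ^ Suc 1) = {1, 3}"
      unfolding roots_mod_square_minus_one_two_power[OF zero_less_one] by auto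
    then show ?thesis using two by simp
  next
    case large
    define h :: int where "h = 2 ^ (e - 1)"
    have "(2::int) ^ 2 \<le> h" unfolding h_def using large by (intro power_increasing) auto
    then have "card {1, h + 1, h - 1, 2 * h - 1} = 4" by auto
    then show ?thesis
      using roots_mod_square_minus_one_two_power[of "e - 1"] large
      by (simp add: h_def flip: power_Suc)
  qed
qed

lemma prime_dvd_cyclotomic3:
  fixes p :: nat
  assumes p: "prime p" and dvd: "int p dvd poly cyclotomic3 x"
  shows "p = 3 \<or> [p = 1] (mod 3)"
proof -
  define n where "n = nat (x mod int p)"
  have "int n = x mod int p" using prime_gt_0_nat[OF p] by (simp add: n_def)
  then have x: "[x = int n] (mod int p)" by simp
  then have "int p dvd int n ^ 2 + int n + 1"
    using dvd dvd_poly_cong_iff[of x "int n"] poly_cyclotomic3 by metis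
  moreover have "int n ^ 3 - 1 = (int n ^ 2 + int n + 1) * (int n - 1)"
    by (simp add: power2_eq_square power3_eq_cube algebra_simps)
  ultimately have "[int n ^ 3 = 1] (mod int p)" by (simp add: cong_iff_dvd_diff)
  then have "[n ^ 3 = 1] (mod p)" by (metis cong_int_iff of_nat_1 of_nat_power)
  then have "ord p n dvd 3" by (simp only: ord_divides)
  then consider (order_1) "ord p n = 1" | (order_3) "ord p n = 3"
    using prime_nat_iff[of 3] by auto
  then show ?thesis
  proof cases
    case order_1
    then have "[n = 1] (mod p)" using ord[of n p] by simp
    then have "[x = 1] (mod int p)" using x by (metis cong_int_iff cong_trans of_nat_1)
    then have "int p dvd poly cyclotomic3 1" using dvd dvd_poly_cong_iff by blast
    then have "int p dvd int 3" by simp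
    then have "p dvd 3" by (simp only: int_dvd_int_iff)
    then show ?thesis using p primes_dvd_imp_eq[of p 3] by simp
  next
    case order_3
    have "coprime p n" using order_3 ord_eq_0[of p n] by simp
    then have "3 dvd p - 1"
      using order_3 order_divides_totient[of p n] totient_prime[OF p] by simp
    then show ?thesis using prime_gt_0_nat[OF p] by (simp add: cong_altdef_nat cong_sym_eq)
  qed
qed

lemma not_9_dvd_cyclotomic3: "\<not> 9 dvd poly cyclotomic3 x"
proof
  assume "9 dvd poly cyclotomic3 x"
  then have dvd: "9 dvd 4 * (x\<^sup>2 + x + 1)" unfolding poly_cyclotomic3 by (rule dvd_mult)
  have eq: "4 * (x\<^sup>2 + x + 1) = (2 * x + 1)\<^sup>2 + 3" by (simp add: power2_eq_square algebra_simps)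
  have "3 dvd (2 * x + 1)\<^sup>2" using dvd unfolding eq by presburger
  then have "3 dvd 2 * x + 1" using prime_dvd_power[of "3 :: int"] by simp
  then have "3\<^sup>2 dvd (2 * x + 1)\<^sup>2" by (rule dvd_power_same)
  then have "(9::int) dvd 3" using dvd unfolding eq by (simp add: dvd_add_right_iff)
  then show False by simp
qed

lemma ex_cube_root_of_unity_prime_power:
  fixes p :: nat
  assumes p: "prime p" "[p = 1] (mod 3)" and "e > 0"
  obtains z where "[z ^ 3 = 1] (mod int p ^ e)" "\<not> [z = 1] (mod int p ^ e)"
proof -
  have "p \<noteq> 2" using p(2) by (auto simp: cong_def)
  then have "odd p" using p(1) primes_dvd_imp_eq two_is_prime_nat by blast
  obtain g where "\<forall>k>0. residue_primroot (p ^ k) g"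
    using residue_primroot_odd_prime_power_exists[OF p(1) \<open>odd p\<close>] by blast
  then have g: "ord (p ^ e) g = totient (p ^ e)" using \<open>e > 0\<close> by (simp add: residue_primroot_def)
  have "3 dvd p - 1"
    using p prime_gt_0_nat[OF p(1)] by (simp add: cong_altdef_nat cong_sym_eq)
  then have "3 dvd totient (p ^ e)"
    using p(1) \<open>e > 0\<close> by (simp add: totient_prime_power)
  then obtain t where t: "totient (p ^ e) = 3 * t" by (rule dvdE)
  have "totient (p ^ e) > 0" using p(1) by (simp add: prime_gt_0_nat)
  then have "[(g ^ t) ^ 3 = 1] (mod p ^ e)" "\<not> [g ^ t = 1] (mod p ^ e)"
    unfolding power_mult[symmetric] ord_divides g
    using t by (auto simp: mult.commute dest: dvd_imp_le)
  then have "[int (g ^ t) ^ 3 = 1] (mod int p ^ e)" "\<not> [int (g ^ t) = 1] (mod int p ^ e)"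
    by (metis cong_int_iff of_nat_1 of_nat_power)+
  then show ?thesis by (rule that)
qed

lemma ex_cyclotomic3_root_prime_power:
  fixes p :: nat
  assumes p: "prime p" "[p = 1] (mod 3)" and "e > 0"
  obtains z where "int p ^ e dvd z\<^sup>2 + z + 1"
proof -
  have "\<not> p dvd 3" using p primes_dvd_imp_eq[of p 3] by (auto simp: cong_def)
  then have not_dvd_3: "\<not> int p dvd 3" by (metis int_dvd_int_iff of_nat_numeral)
  obtain z where z: "[z ^ 3 = 1] (mod int p ^ e)" "\<not> [z = 1] (mod int p ^ e)"
    using ex_cube_root_of_unity_prime_power[OF assms] .
  have "z ^ 3 - 1 = (z - 1) * (z\<^sup>2 + z + 1)"
    by (simp add: power2_eq_square power3_eq_cube algebra_simps)
  then have prod: "int p ^ e dvd (z - 1) * (z\<^sup>2 + z + 1)"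
    using z(1) by (simp add: cong_iff_dvd_diff)
  have "z\<^sup>2 + z + 1 = (z + 2) * (z - 1) + 3" by (simp add: power2_eq_square algebra_simps)
  then have "\<not> (int p dvd z - 1 \<and> int p dvd z\<^sup>2 + z + 1)"
    using not_dvd_3 by (metis dvd_add_right_iff dvd_mult)
  then have "int p ^ e dvd z - 1 \<or> int p ^ e dvd z\<^sup>2 + z + 1"
    using prod p(1) by (simp add: prime_power_dvd_mult_iff)
  then have "int p ^ e dvd z\<^sup>2 + z + 1" using z(2) by (simp add: cong_iff_dvd_diff)
  then show ?thesis by (rule that)
qed

lemma card_cyclotomic3_prime_1_mod_3:
  fixes p :: nat
  assumes p: "prime p" "[p = 1] (mod 3)" and "e > 0"
  shows "card (roots_mod cyclotomic3 (int p ^ e)) = 2"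
proof -
  obtain z where root: "int p ^ e dvd z\<^sup>2 + z + 1"
    using ex_cyclotomic3_root_prime_power[OF assms] .
  have "int p dvd int p ^ e" using \<open>e > 0\<close> by simp
  then have "int p dvd 4 * (z\<^sup>2 + z + 1)" using root dvd_trans dvd_mult by blast
  moreover have "4 * (z\<^sup>2 + z + 1) = (2 * z + 1) * (2 * z + 1) + 3"
    by (simp add: power2_eq_square algebra_simps)
  moreover have "\<not> p dvd 3" using p primes_dvd_imp_eq[of p 3] by (auto simp: cong_def)
  then have "\<not> int p dvd 3" by (metis int_dvd_int_iff of_nat_numeral)
  ultimately have "\<not> int p dvd 2 * z + 1" by (metis dvd_add_right_iff dvd_mult)
  then show ?thesis
    using root p(1) \<open>e > 0\<close>
    by (intro card_roots_mod_quadratic) (simp_all add: poly_cyclotomic3 del: poly_pCons)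
qed

lemma card_cyclotomic3_prime_power:
  fixes p :: nat
  assumes p: "prime p" and "e > 0"
  shows "card (roots_mod cyclotomic3 (int p ^ e)) =
    (if p = 3 \<and> e = 1 then 1 else if [p = 1] (mod 3) then 2 else 0)"
proof -
  consider (three) "p = 3" "e = 1" | (nine) "p = 3" "e \<ge> 2" | (good) "[p = 1] (mod 3)"
    | (bad) "p \<noteq> 3" "\<not> [p = 1] (mod 3)"
    using \<open>e > 0\<close> by linarith
  then show ?thesis
  proof cases
    case three
    have "{0..<3} = {0, 1, 2 :: int}" by auto
    then have "roots_mod cyclotomic3 3 = {1}" unfolding roots_mod_def by auto
    then show ?thesis using three by simp
  next
    case nine
    have "(9::int) dvd 3 ^ e" using le_imp_power_dvd[of 2 e "3 :: int"] nine by simp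
    then have "roots_mod cyclotomic3 (3 ^ e) = {}"
      using not_9_dvd_cyclotomic3 dvd_trans unfolding roots_mod_def by blast
    then show ?thesis using nine by (simp add: cong_def)
  next
    case good
    then have "p \<noteq> 3" by (auto simp: cong_def)
    then show ?thesis using card_cyclotomic3_prime_1_mod_3[OF p good \<open>e > 0\<close>] good by simp
  next
    case bad
    have "int p dvd int p ^ e" using \<open>e > 0\<close> by simp
    then have "roots_mod cyclotomic3 (int p ^ e) = {}"
      using prime_dvd_cyclotomic3[OF p] bad dvd_trans
      unfolding roots_mod_def by blast
    then show ?thesis using bad by simp
  qed
qed

lemma prod_eq_power_except_one:
  fixes f :: "'b \<Rightarrow> 'a::comm_semiring_1"
  assumes "finite A" "a \<in> A" "\<And>x. x \<in> A \<Longrightarrow> x \<noteq> a \<Longrightarrow> f x = c"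
  shows "c * (\<Prod>x\<in>A. f x) = f a * c ^ card A"
proof -
  have "(\<Prod>x\<in>A. f x) = f a * (\<Prod>x\<in>A - {a}. f x)" by (rule prod.remove) fact+
  also have "(\<Prod>x\<in>A - {a}. f x) = c ^ card (A - {a})"
    using assms(3) by simp
  finally have "c * (\<Prod>x\<in>A. f x) = f a * c ^ Suc (card (A - {a}))" by (simp add: ac_simps)
  then show ?thesis using assms(1,2) by (simp only: card_Suc_Diff1)
qed

lemma beta_eq_multiplicity:
  assumes "v > 0" "even v"
  shows "beta v = (if multiplicity 2 v = 1 then 1/4 else if multiplicity 2 v = 2 then 1/2 else 1)"
proof -
  have dvd: "2 ^ n dvd v \<longleftrightarrow> n \<le> multiplicity 2 v" for n
    using assms(1) by (intro power_dvd_iff_le_multiplicity) auto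
  have "4 dvd v \<longleftrightarrow> 2 \<le> multiplicity 2 v" "8 dvd v \<longleftrightarrow> 3 \<le> multiplicity 2 v"
    "1 \<le> multiplicity 2 v"
    using dvd[of 2] dvd[of 3] dvd[of 1] assms(2) by simp_all
  then consider (one) "multiplicity 2 v = 1" "\<not> 4 dvd v"
    | (two) "multiplicity 2 v = 2" "4 dvd v" "\<not> 8 dvd v"
    | (large) "multiplicity 2 v \<ge> 3" "8 dvd v"
    by linarith
  then show ?thesis
  proof cases
    case one
    then have "v mod 8 = 2 \<or> v mod 8 = 6" using assms(2) by presburger
    then show ?thesis using one by (auto simp: beta_def cong_def)
  next
    case two
    then have "v mod 8 = 4" by presburger
    then show ?thesis using two by (simp add: beta_def cong_def)
  next
    case large
    then show ?thesis by (simp add: beta_def cong_def)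
  qed
qed

lemma card_square_minus_one_roots:
  assumes "v > 0"
  shows "real (card (roots_mod square_minus_one (int v))) =
    (if odd v then 1 else 2 * beta v) * 2 ^ card (prime_factors v)"
proof -
  define c where "c p = card (roots_mod square_minus_one (int p ^ multiplicity p v))" for p
  have card_eq: "card (roots_mod square_minus_one (int v)) = (\<Prod>p\<in>prime_factors v. c p)"
    unfolding c_def by (rule card_roots_mod_prime_factors) fact
  have c_odd: "c p = 2" if "p \<in> prime_factors v" "p \<noteq> 2" for p
    unfolding c_def
  proof (rule card_square_minus_one_odd_prime_power)
    show "prime p" using that(1) by blast
    then show "odd p" using that(2) primes_dvd_imp_eq two_is_prime_nat by blast
    show "multiplicity p v > 0" using that(1) by (simp add: prime_factors_multiplicity)
  qed
  show ?thesis
  proof (cases "odd v")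
    case True
    then have "2 \<notin> prime_factors v" by auto
    then have "(\<Prod>p\<in>prime_factors v. c p) = 2 ^ card (prime_factors v)"
      using c_odd by (metis (no_types, lifting) prod.cong prod_constant)
    then show ?thesis using True by (simp add: card_eq)
  next
    case False
    then have two: "2 \<in> prime_factors v" using assms by (simp add: prime_factors_dvd)
    then have "multiplicity 2 v > 0" by (simp add: prime_factors_multiplicity)
    then have "real (c 2) = 4 * beta v"
      using False card_square_minus_one_two_power[of "multiplicity 2 v"]
        beta_eq_multiplicity[OF assms]
      by (simp add: c_def)
    moreover have "2 * (\<Prod>p\<in>prime_factors v. c p) = c 2 * 2 ^ card (prime_factors v)"
      using two c_odd by (intro prod_eq_power_except_one) auto
    then have "2 * real (\<Prod>p\<in>prime_factors v. c p) = real (c 2) * 2 ^ card (prime_factors v)"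
      by (metis of_nat_mult of_nat_numeral of_nat_power)
    ultimately show ?thesis using False by (simp add: card_eq)
  qed
qed

lemma odd_if_prime_factors_1_mod_3:
  fixes v :: nat
  assumes "v > 0" "\<And>p. p \<in> prime_factors v \<Longrightarrow> p \<noteq> 3 \<Longrightarrow> [p = 1] (mod 3)"
  shows "odd v"
proof
  assume "even v"
  then have "2 \<in> prime_factors v" using \<open>v > 0\<close> by (simp add: prime_factors_dvd)
  then show False using assms(2)[of 2] by (simp add: cong_def)
qed

lemma alpha_eq_multiplicity:
  assumes "3 \<in> prime_factors v" "\<And>p. p \<in> prime_factors v \<Longrightarrow> p \<noteq> 3 \<Longrightarrow> [p = 1] (mod 3)"
  shows "alpha v = (if multiplicity 3 v = 1 then 2/3 else 1/2)"
proof -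
  have "\<not> [3 = 1 :: nat] (mod 3)" by (simp add: cong_def)
  then have "\<not> (\<forall>p\<in>prime_factors v. [p = 1] (mod 3))" using assms(1) by blast
  moreover have "3 ^ multiplicity 3 v = (3::nat) \<longleftrightarrow> multiplicity 3 v = 1"
    using power_inject_exp[of "3::nat" "multiplicity 3 v" 1] by simp
  ultimately show ?thesis using assms(2) by (auto simp: alpha_def)
qed

lemma card_cyclotomic3_roots:
  assumes "v > 0"
  shows "real (card (roots_mod cyclotomic3 (int v))) =
    (if odd v then 3 * alpha v - 3/2 else 0) * 2 ^ card (prime_factors v)"
proof -
  define c where "c p = card (roots_mod cyclotomic3 (int p ^ multiplicity p v))" for p
  have card_eq: "card (roots_mod cyclotomic3 (int v)) = (\<Prod>p\<in>prime_factors v. c p)"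
    unfolding c_def by (rule card_roots_mod_prime_factors) fact
  have c_eq: "c p =
      (if p = 3 \<and> multiplicity p v = 1 then 1 else if [p = 1] (mod 3) then 2 else 0)"
    if "p \<in> prime_factors v" for p
    unfolding c_def using that
    by (intro card_cyclotomic3_prime_power) (auto simp: prime_factors_multiplicity)
  consider (bad_prime) p where "p \<in> prime_factors v" "p \<noteq> 3" "\<not> [p = 1] (mod 3)"
    | (no_3) "3 \<notin> prime_factors v" "\<And>p. p \<in> prime_factors v \<Longrightarrow> [p = 1] (mod 3)"
    | (with_3) "3 \<in> prime_factors v" "\<And>p. p \<in> prime_factors v \<Longrightarrow> p \<noteq> 3 \<Longrightarrow> [p = 1] (mod 3)"
    by metis
  then show ?thesis
  proof cases
    case bad_prime
    then have "card (roots_mod cyclotomic3 (int v)) = 0"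
      unfolding card_eq by (intro prod_zero) (auto simp: c_eq)
    moreover have "alpha v = 1/2" using bad_prime unfolding alpha_def by auto
    ultimately show ?thesis by simp
  next
    case no_3
    then have "c p = 2" if "p \<in> prime_factors v" for p using c_eq[OF that] that by auto
    then have "card (roots_mod cyclotomic3 (int v)) = 2 ^ card (prime_factors v)"
      unfolding card_eq by simp
    moreover have "alpha v = 5/6" using no_3(2) by (simp add: alpha_def)
    ultimately show ?thesis using odd_if_prime_factors_1_mod_3[OF assms no_3(2)] by simp
  next
    case with_3
    then have "2 * (\<Prod>p\<in>prime_factors v. c p) = c 3 * 2 ^ card (prime_factors v)"
      by (intro prod_eq_power_except_one) (auto simp: c_eq)
    then have "2 * real (\<Prod>p\<in>prime_factors v. c p) = real (c 3) * 2 ^ card (prime_factors v)"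
      by (metis of_nat_mult of_nat_numeral of_nat_power)
    moreover have "real (c 3) = (if multiplicity 3 v = 1 then 1 else 0)"
      using c_eq[OF with_3(1)] by (simp add: cong_def)
    ultimately show ?thesis
      using odd_if_prime_factors_1_mod_3[OF assms with_3(2)] alpha_eq_multiplicity[OF with_3]
      by (simp add: card_eq split: if_splits)
  qed
qed

section \<open>The symmetries of difference triples\<close>

lemma group_actionI:
  fixes G (structure)
  assumes "group G" and ext: "\<And>g. g \<in> carrier G \<Longrightarrow> \<phi> g \<in> extensional E"
    and closed: "\<And>g x. g \<in> carrier G \<Longrightarrow> x \<in> E \<Longrightarrow> \<phi> g x \<in> E"
    and one: "\<And>x. x \<in> E \<Longrightarrow> \<phi> \<one> x = x"
    and mult: "\<And>g h x. g \<in> carrier G \<Longrightarrow> h \<in> carrier G \<Longrightarrow> x \<in> E \<Longrightarrow> \<phi> (g \<otimes> h) x = \<phi> g (\<phi> h x)"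
  shows "group_action G E \<phi>"
proof -
  interpret group G by fact
  have Bij: "\<phi> g \<in> Bij E" if g: "g \<in> carrier G" for g
  proof -
    have "\<phi> (inv g) (\<phi> g x) = x" "\<phi> g (\<phi> (inv g) x) = x" if "x \<in> E" for x
      using g that mult[of "inv g" g x] mult[of g "inv g" x] one by simp_all
    then have "bij_betw (\<phi> g) E E"
      using g closed by (intro bij_betw_byWitness[of E "\<phi> (inv g)"]) auto
    then show ?thesis using ext[OF g] by (simp add: Bij_def)
  qed
  have "\<phi> (g \<otimes> h) = compose E (\<phi> g) (\<phi> h)" if "g \<in> carrier G" "h \<in> carrier G" for g h
    using that ext mult by (intro extensionalityI[of _ E]) (auto simp: compose_def)
  then have "\<phi> \<in> hom G (BijGroup E)"
    using Bij by (intro homI) (simp_all add: BijGroup_def)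
  with group_BijGroup have "group_hom G (BijGroup E) \<phi>"
    by (intro group_hom.intro group_hom_axioms.intro is_group)
  then show ?thesis by (rule group_action.intro)
qed

lemma (in group_action) orbit_eq_iff:
  assumes "x \<in> E" "y \<in> E"
  shows "Group_Action.orbit G \<phi> x = Group_Action.orbit G \<phi> y \<longleftrightarrow> y \<in> Group_Action.orbit G \<phi> x"
proof
  have orbit_mono: "Group_Action.orbit G \<phi> u \<subseteq> Group_Action.orbit G \<phi> w"
    if "u \<in> E" "w \<in> E" "u \<in> Group_Action.orbit G \<phi> w" for u w
  proof
    fix z assume z: "z \<in> Group_Action.orbit G \<phi> u"
    then have "z \<in> E" using \<open>u \<in> E\<close> element_image unfolding Group_Action.orbit_def by blast
    then show "z \<in> Group_Action.orbit G \<phi> w" using orbit_trans[OF that(2,1) _ that(3) z] by blast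
  qed
  assume y: "y \<in> Group_Action.orbit G \<phi> x"
  then have "x \<in> Group_Action.orbit G \<phi> y" using orbit_sym[OF assms] by blast
  then show "Group_Action.orbit G \<phi> x = Group_Action.orbit G \<phi> y"
    using orbit_mono assms y by (intro equalityI)
next
  assume "Group_Action.orbit G \<phi> x = Group_Action.orbit G \<phi> y"
  then show "y \<in> Group_Action.orbit G \<phi> x" using orbit_refl[OF assms(2)] by simp
qed

lemma sum_color_distinct:
  fixes f :: "color \<Rightarrow> 'a::comm_monoid_add"
  assumes "distinct [i, j, k]"
  shows "(\<Sum>x\<in>UNIV. f x) = f i + f j + f k"
proof -
  have "(UNIV :: color set) = {i, j, k}" using color_exhaust_distinct[OF assms] by blast
  then have "(\<Sum>x\<in>UNIV. f x) = (\<Sum>x\<in>{i, j, k}. f x)" by (simp only:)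
  then show ?thesis using assms by (simp add: add.assoc)
qed

definition difference_triples :: "int \<Rightarrow> (color \<Rightarrow> int) set" where
  "difference_triples m =
     {d. (\<forall>i. d i \<in> {0..<m}) \<and> m dvd (\<Sum>i\<in>UNIV. d i) \<and> coprime (Gcd (range d)) m}"

definition symmetry_group :: "int \<Rightarrow> ((color \<Rightarrow> color) \<times> int) monoid" where
  "symmetry_group m = BijGroup UNIV \<times>\<times> units_of (residue_ring m)"

definition symmetry :: "int \<Rightarrow> (color \<Rightarrow> color) \<times> int \<Rightarrow> (color \<Rightarrow> int) \<Rightarrow> color \<Rightarrow> int" where
  "symmetry m g = (\<lambda>d\<in>difference_triples m. \<lambda>i. (snd g * d (inv_into UNIV (fst g) i)) mod m)"

definition symmetry_orbit :: "int \<Rightarrow> (color \<Rightarrow> int) \<Rightarrow> (color \<Rightarrow> int) set" where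
  "symmetry_orbit m = Group_Action.orbit (symmetry_group m) (symmetry m)"

lemma Bij_UNIV: "Bij UNIV = {f. bij f}"
  by (simp add: Bij_def)

lemma difference_triplesI:
  assumes "\<And>i. d i \<in> {0..<m}" "m dvd (\<Sum>i\<in>UNIV. d i)"
    and "\<And>g. g dvd m \<Longrightarrow> (\<And>i. g dvd d i) \<Longrightarrow> is_unit g"
  shows "d \<in> difference_triples m"
  using assms unfolding difference_triples_def coprime_Gcd_range_iff by blast

lemma difference_triplesD:
  assumes "d \<in> difference_triples m"
  shows "0 \<le> d i" "d i < m" "m dvd (\<Sum>i\<in>UNIV. d i)"
    and "g dvd m \<Longrightarrow> (\<And>i. g dvd d i) \<Longrightarrow> is_unit g"
  using assms unfolding difference_triples_def coprime_Gcd_range_iff by auto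

lemma triple_entry_mod [simp]: "d \<in> difference_triples m \<Longrightarrow> d i mod m = d i"
  using difference_triplesD(1,2)[of d m i] by simp

lemma triple_entry_cong_iff: "d \<in> difference_triples m \<Longrightarrow> e \<in> difference_triples m \<Longrightarrow>
    [d i = e j] (mod m) \<longleftrightarrow> d i = e j"
  by (simp add: cong_def)

lemma triple_entry_dvd_iff: "d \<in> difference_triples m \<Longrightarrow> m dvd d i \<longleftrightarrow> d i = 0"
  by (metis dvd_0_right dvd_imp_mod_0 triple_entry_mod)

lemma third_entry:
  assumes "d \<in> difference_triples m" "distinct [i, j, k]"
  shows "[d k = - d i - d j] (mod m)"
proof -
  have "m dvd d i + d j + d k"
    using difference_triplesD(3)[OF assms(1)] sum_color_distinct[OF assms(2), of d] by simp
  then show ?thesis by (simp add: cong_iff_dvd_diff algebra_simps)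
qed

lemma third_entry_dvd:
  assumes "d \<in> difference_triples m" "distinct [i, j, k]" "g dvd m" "g dvd d i" "g dvd d j"
  shows "g dvd d k"
proof -
  have "[d k = - d i - d j] (mod g)"
    using third_entry[OF assms(1,2)] assms(3) cong_dvd_modulus by blast
  then show ?thesis using assms(4,5) cong_dvd_iff by (metis dvd_diff dvd_minus_iff)
qed

lemma triple_eqI:
  assumes d: "d \<in> difference_triples m" and e: "e \<in> difference_triples m"
    and ijk: "distinct [i, j, k]"
    and "d i = e i" "d j = e j"
  shows "d = e"
proof
  have "[d k = - d i - d j] (mod m)" "[e k = - d i - d j] (mod m)"
    using third_entry[OF d ijk] third_entry[OF e ijk] assms(4,5) by simp_all
  then have "[d k = e k] (mod m)" using cong_sym cong_trans by blast
  then have "d k = e k" using triple_entry_cong_iff d e by blast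
  then show "d x = e x" for x using color_exhaust_distinct[OF ijk, of x] assms(4,5) by auto
qed

lemma coprime_entry:
  assumes d: "d \<in> difference_triples m" and ijk: "distinct [i, j, k]"
    and dvd: "\<And>g. g dvd m \<Longrightarrow> g dvd d i \<Longrightarrow> g dvd d j"
  shows "coprime (d i) m"
proof (rule coprimeI)
  fix g assume g: "g dvd d i" "g dvd m"
  then have "g dvd d j" "g dvd d k"
    using dvd third_entry_dvd[OF d ijk] by blast+
  then have "g dvd d x" for x using color_exhaust_distinct[OF ijk, of x] g(1) by auto
  then show "is_unit g" using difference_triplesD(4)[OF d g(2)] by blast
qed

lemma coprime_entry_if_multiple:
  assumes "d \<in> difference_triples m" "distinct [i, j, k]" and j: "[d j = u * d i] (mod m)"
  shows "coprime (d i) m"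
proof (rule coprime_entry[OF assms(1,2)])
  fix g assume g: "g dvd m" "g dvd d i"
  then have "[d j = u * d i] (mod g)" using j cong_dvd_modulus by blast
  then show "g dvd d j" using g(2) by (simp add: cong_dvd_iff)
qed

lemma triple_with_entries:
  assumes "m > 0" and ijk: "distinct [i, j, k]" and "coprime a m"
  obtains d where "d \<in> difference_triples m" "[d i = a] (mod m)" "[d j = b] (mod m)"
proof -
  define d where "d = (\<lambda>x. (if x = i then a else if x = j then b else - a - b) mod m)"
  have d: "d i = a mod m" "d j = b mod m" "d k = (- a - b) mod m"
    using ijk by (auto simp: d_def)
  have "d \<in> difference_triples m"
  proof (rule difference_triplesI)
    have "[d i + d j + d k = a + b + (- a - b)] (mod m)"
      unfolding d by (intro cong_add) simp_all
    then show "m dvd (\<Sum>x\<in>UNIV. d x)"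
      by (simp add: sum_color_distinct[OF ijk] cong_0_iff)
  next
    fix g assume "g dvd m" "\<And>x. g dvd d x"
    then have "g dvd a mod m" using d(1) by metis
    then have "g dvd a" using \<open>g dvd m\<close> by (simp add: dvd_mod_iff)
    then show "is_unit g" using \<open>coprime a m\<close> \<open>g dvd m\<close> coprime_common_divisor by blast
  qed (use \<open>m > 0\<close> in \<open>simp add: d_def\<close>)
  then show ?thesis using that[of d] d by simp
qed

locale modulus =
  fixes m :: int
  assumes m_gt_1: "m > 1"
begin

sublocale R: residues m "residue_ring m"
  using m_gt_1 by unfold_locales

lemma m_pos: "m > 0"
  using m_gt_1 by simp

lemma carrier_symmetry_group: "carrier (symmetry_group m) = {\<pi>. bij \<pi>} \<times> Units (residue_ring m)"
  by (simp add: symmetry_group_def BijGroup_def Bij_UNIV units_of_carrier)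

lemma order_symmetry_group: "Coset.order (symmetry_group m) = 6 * totient (nat m)"
proof -
  have "card {\<pi> :: color \<Rightarrow> color. bij \<pi>} = 6"
    using card_permutations[of "UNIV :: color set" 3]
    by (simp add: permutes_univ bij_iff eval_nat_numeral)
  then show ?thesis
    by (simp add: Coset.order_def carrier_symmetry_group card_cartesian_product R.totient_eq)
qed

lemma symmetry_closed:
  assumes d: "d \<in> difference_triples m" and g: "g \<in> carrier (symmetry_group m)"
  shows "symmetry m g d \<in> difference_triples m"
proof -
  define \<sigma> where "\<sigma> = inv_into UNIV (fst g)"
  have "bij \<sigma>" and unit: "coprime (snd g) m"
    using g by (auto simp: carrier_symmetry_group \<sigma>_def bij_imp_bij_inv R.res_units_eq)
  have sym: "symmetry m g d i = (snd g * d (\<sigma> i)) mod m" for i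
    using d by (simp add: symmetry_def \<sigma>_def)
  show ?thesis
  proof (rule difference_triplesI)
    have "(\<Sum>i\<in>UNIV. snd g * d (\<sigma> i)) = snd g * (\<Sum>i\<in>UNIV. d i)"
      using \<open>bij \<sigma>\<close> by (simp add: sum_distrib_left[symmetric] sum.reindex_bij_betw)
    then have "m dvd (\<Sum>i\<in>UNIV. snd g * d (\<sigma> i))" using difference_triplesD(3)[OF d] by simp
    then show "m dvd (\<Sum>i\<in>UNIV. symmetry m g d i)"
      by (simp add: sym dvd_eq_mod_eq_0 mod_sum_eq)
  next
    fix h assume h: "h dvd m" "\<And>i. h dvd symmetry m g d i"
    then have "h dvd snd g * d (\<sigma> i)" for i by (metis sym dvd_mod_iff)
    moreover have "coprime h (snd g)"
      using coprime_divisors[OF dvd_refl h(1) unit] by (simp add: coprime_commute)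
    ultimately have "h dvd d (\<sigma> i)" for i by (simp add: coprime_dvd_mult_right_iff)
    then have "h dvd d i" for i using \<open>bij \<sigma>\<close> by (metis bij_pointE)
    then show "is_unit h" using difference_triplesD(4)[OF d h(1)] by blast
  qed (simp add: sym m_pos)
qed

sublocale group_action "symmetry_group m" "difference_triples m" "symmetry m"
proof (rule group_actionI)
  show "group (symmetry_group m)"
    unfolding symmetry_group_def by (intro DirProd_group group_BijGroup R.units_group)
next
  fix d assume "d \<in> difference_triples m"
  then show "symmetry m \<one>\<^bsub>symmetry_group m\<^esub> d = d"
    by (simp add: symmetry_def symmetry_group_def BijGroup_def units_of_one R.res_one_eq
        restrict_UNIV)
next
  fix g h d
  assume g: "g \<in> carrier (symmetry_group m)" and h: "h \<in> carrier (symmetry_group m)"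
    and d: "d \<in> difference_triples m"
  obtain \<pi> u \<sigma> w where gh: "g = (\<pi>, u)" "h = (\<sigma>, w)" by fastforce
  have bij: "bij \<pi>" "bij \<sigma>" using g h by (auto simp: gh carrier_symmetry_group)
  have "g \<otimes>\<^bsub>symmetry_group m\<^esub> h = (\<pi> \<circ> \<sigma>, (u * w) mod m)"
    using bij
    by (simp add: gh symmetry_group_def BijGroup_def Bij_UNIV compose_def restrict_UNIV comp_def
      units_of_mult R.res_mult_eq)
  moreover have "inv_into UNIV (\<pi> \<circ> \<sigma>) = inv_into UNIV \<sigma> \<circ> inv_into UNIV \<pi>"
    using bij by (rule o_inv_distrib)
  ultimately show "symmetry m (g \<otimes>\<^bsub>symmetry_group m\<^esub> h) d = symmetry m g (symmetry m h d)"
    using d symmetry_closed[OF d h] by (auto simp: symmetry_def gh mod_simps mult_ac)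
qed (simp_all add: symmetry_closed, simp add: symmetry_def)

lemma finite_difference_triples: "finite (difference_triples m)"
proof -
  have "difference_triples m \<subseteq> (UNIV \<rightarrow>\<^sub>E {0..<m})" by (auto simp: difference_triples_def)
  then show ?thesis by (rule finite_subset) (simp add: finite_PiE)
qed

lemma symmetry_eq_iff:
  assumes d: "d \<in> difference_triples m" and e: "e \<in> difference_triples m" and "bij \<pi>"
  shows "symmetry m (\<pi>, u) d = e \<longleftrightarrow> (\<forall>i. [e (\<pi> i) = u * d i] (mod m))"
proof -
  have "symmetry m (\<pi>, u) d = e \<longleftrightarrow> (\<forall>x. e x = (u * d (inv_into UNIV \<pi> x)) mod m)"
    using d by (auto simp: symmetry_def fun_eq_iff)
  also have "\<dots> \<longleftrightarrow> (\<forall>i. e (\<pi> i) = (u * d i) mod m)"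
    using \<open>bij \<pi>\<close> by (metis bij_inv_eq_iff)
  also have "\<dots> \<longleftrightarrow> (\<forall>i. [e (\<pi> i) = u * d i] (mod m))"
    using e by (simp add: cong_def)
  finally show ?thesis .
qed

lemma mem_symmetry_orbit_iff:
  assumes d: "d \<in> difference_triples m" and e: "e \<in> difference_triples m"
  shows "e \<in> symmetry_orbit m d \<longleftrightarrow> (\<exists>\<pi> u. bij \<pi> \<and> (\<forall>i. [e (\<pi> i) = u * d i] (mod m)))"
proof
  assume "e \<in> symmetry_orbit m d"
  then obtain \<pi> u where "bij \<pi>" "symmetry m (\<pi>, u) d = e"
    by (auto simp: symmetry_orbit_def Group_Action.orbit_def carrier_symmetry_group)
  then show "\<exists>\<pi> u. bij \<pi> \<and> (\<forall>i. [e (\<pi> i) = u * d i] (mod m))"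
    using symmetry_eq_iff[OF d e] by blast
next
  assume "\<exists>\<pi> u. bij \<pi> \<and> (\<forall>i. [e (\<pi> i) = u * d i] (mod m))"
  then obtain \<pi> u where \<pi>: "bij \<pi>" and u: "\<And>i. [e (\<pi> i) = u * d i] (mod m)" by blast
  have "coprime u m"
  proof (rule coprimeI)
    fix g assume g: "g dvd u" "g dvd m"
    have "g dvd e (\<pi> i)" for i
      using cong_dvd_modulus[OF u[of i] g(2)] g(1) by (simp add: cong_dvd_iff)
    then have "g dvd e i" for i using \<pi> by (metis bij_pointE)
    then show "is_unit g" using difference_triplesD(4)[OF e g(2)] by blast
  qed
  then have "(\<pi>, u mod m) \<in> carrier (symmetry_group m)"
    using \<pi> m_gt_1 by (simp add: carrier_symmetry_group)
  moreover have "symmetry m (\<pi>, u mod m) d = e"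
    unfolding symmetry_eq_iff[OF d e \<pi>] using u by (simp add: cong_def mod_simps)
  ultimately show "e \<in> symmetry_orbit m d"
    unfolding symmetry_orbit_def Group_Action.orbit_def by blast
qed

lemma symmetry_orbit_eq_iff:
  assumes "d \<in> difference_triples m" "e \<in> difference_triples m"
  shows "symmetry_orbit m d = symmetry_orbit m e \<longleftrightarrow> e \<in> symmetry_orbit m d"
  unfolding symmetry_orbit_def by (rule orbit_eq_iff) fact+

lemma orbits_eq:
  "orbits (symmetry_group m) (difference_triples m) (symmetry m) =
     symmetry_orbit m ` difference_triples m"
  by (auto simp: orbits_def symmetry_orbit_def)

end

section \<open>Counting orbits of difference triples\<close>

lemma bij_color_eq:
  "{\<pi> :: color \<Rightarrow> color. bij \<pi>} =
     {case_color Red Green Blue, case_color Green Red Blue, case_color Blue Green Red,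
      case_color Red Blue Green, case_color Green Blue Red, case_color Blue Red Green}"
    (is "_ = ?S")
proof (intro equalityI subsetI)
  fix \<pi> :: "color \<Rightarrow> color" assume "\<pi> \<in> {\<pi>. bij \<pi>}"
  then have "distinct [\<pi> Red, \<pi> Green, \<pi> Blue]" by (simp add: bij_def inj_eq)
  moreover have "\<pi> = case_color (\<pi> Red) (\<pi> Green) (\<pi> Blue)"
    by (rule ext) (simp split: color.split)
  ultimately show "\<pi> \<in> ?S"
    by (cases "\<pi> Red"; cases "\<pi> Green"; cases "\<pi> Blue") simp_all
next
  fix \<pi> assume "\<pi> \<in> ?S"
  then have "inj \<pi>" unfolding inj_def all_color by auto
  then show "\<pi> \<in> {\<pi>. bij \<pi>}" by (simp add: bij_def finite_UNIV_inj_surj)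
qed

context modulus
begin

definition fixed_pairs :: "(color \<Rightarrow> color) \<Rightarrow> (int \<times> (color \<Rightarrow> int)) set" where
  "fixed_pairs \<pi> = {(u, d). u \<in> Units (residue_ring m) \<and> d \<in> difference_triples m \<and>
     (\<forall>i. [d (\<pi> i) = u * d i] (mod m))}"

lemma card_symmetry_orbits_fixed_pairs:
  "card (symmetry_orbit m ` difference_triples m) * (6 * totient (nat m)) =
     (\<Sum>\<pi> | bij \<pi>. card (fixed_pairs \<pi>))"
proof -
  let ?fixed = "invariants (difference_triples m) (symmetry m)"
  have invariants: "?fixed (\<pi>, u) =
      {d \<in> difference_triples m. \<forall>i. [d (\<pi> i) = u * d i] (mod m)}" if "bij \<pi>" for \<pi> u
    using symmetry_eq_iff[OF _ _ that] unfolding invariants_def by blast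
  have "finite (carrier (symmetry_group m))"
    unfolding carrier_symmetry_group bij_color_eq by simp
  then have "card (symmetry_orbit m ` difference_triples m) * (6 * totient (nat m)) =
      (\<Sum>g\<in>carrier (symmetry_group m). card (?fixed g))"
    using burnside finite_difference_triples by (simp only: orbits_eq order_symmetry_group)
  also have "\<dots> = (\<Sum>\<pi> | bij \<pi>. \<Sum>u\<in>Units (residue_ring m). card (?fixed (\<pi>, u)))"
    unfolding carrier_symmetry_group by (rule sum.cartesian_product')
  also have "\<dots> = (\<Sum>\<pi> | bij \<pi>. card (fixed_pairs \<pi>))"
  proof (rule sum.cong[OF refl])
    fix \<pi> :: "color \<Rightarrow> color" assume "\<pi> \<in> {\<pi>. bij \<pi>}"
    then have "fixed_pairs \<pi> =
        (SIGMA u:Units (residue_ring m). ?fixed (\<pi>, u))"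
      using invariants by (auto simp: fixed_pairs_def)
    moreover have "finite (?fixed g)" for g
      using finite_difference_triples unfolding invariants_def by simp
    ultimately show "(\<Sum>u\<in>Units (residue_ring m). card (?fixed (\<pi>, u))) = card (fixed_pairs \<pi>)"
      by simp
  qed
  finally show ?thesis .
qed

lemma card_fixed_pairs_identity: "card (fixed_pairs (\<lambda>i. i)) = card (difference_triples m)"
proof -
  have unit_eq_1: "u = 1" if u: "u \<in> Units (residue_ring m)" and d: "d \<in> difference_triples m"
    and fixed: "\<And>i. [d i = u * d i] (mod m)" for u d
  proof -
    have "m dvd (1 - u) * d i" for i
      using fixed[of i] by (simp add: cong_iff_dvd_diff algebra_simps)
    then have "m dvd 1 - u"
      using d coprime_Gcd_range_dvd_cancel unfolding difference_triples_def by blast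
    then have "[1 = u] (mod m)" by (simp add: cong_iff_dvd_diff)
    then show "u = 1" using u m_gt_1 by (simp add: R.res_units_eq cong_def)
  qed
  have "(u, d) \<in> fixed_pairs (\<lambda>i. i) \<longleftrightarrow> u = 1 \<and> d \<in> difference_triples m" for u d
  proof
    assume "(u, d) \<in> fixed_pairs (\<lambda>i. i)"
    then show "u = 1 \<and> d \<in> difference_triples m"
      using unit_eq_1 unfolding fixed_pairs_def by blast
  next
    assume "u = 1 \<and> d \<in> difference_triples m"
    then show "(u, d) \<in> fixed_pairs (\<lambda>i. i)"
      using m_gt_1 by (simp add: fixed_pairs_def R.res_units_eq)
  qed
  then have "fixed_pairs (\<lambda>i. i) = {1} \<times> difference_triples m" by auto
  then show ?thesis by (simp add: card_cartesian_product)
qed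

lemma card_triples_with_ratio:
  assumes ijk: "distinct [i, j, k]"
  shows "card {d \<in> difference_triples m. [d j = u * d i] (mod m)} = totient (nat m)"
    (is "card ?D = _")
proof -
  have "bij_betw (\<lambda>d. d i) ?D (Units (residue_ring m))"
  proof (rule bij_betw_imageI)
    show "inj_on (\<lambda>d. d i) ?D"
    proof (rule inj_onI)
      fix d e assume "d \<in> ?D" "e \<in> ?D" and i: "d i = e i"
      then have d: "d \<in> difference_triples m" "[d j = u * d i] (mod m)"
        and e: "e \<in> difference_triples m" "[e j = u * d i] (mod m)"
        by simp_all
      have "[d j = e j] (mod m)" using d(2) e(2) cong_sym cong_trans by blast
      then have "d j = e j" using triple_entry_cong_iff d(1) e(1) by blast
      then show "d = e" using triple_eqI[OF d(1) e(1) ijk i] by blast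
    qed
    show "(\<lambda>d. d i) ` ?D = Units (residue_ring m)"
    proof (intro equalityI subsetI)
      fix a assume "a \<in> (\<lambda>d. d i) ` ?D"
      then obtain d where d: "d \<in> difference_triples m" "[d j = u * d i] (mod m)" and a: "a = d i"
        by blast
      have "d i mod m \<in> Units (residue_ring m)"
        using coprime_entry_if_multiple[OF d(1) ijk d(2)] m_gt_1 by simp
      then show "a \<in> Units (residue_ring m)" using d(1) by (simp add: a)
    next
      fix a assume "a \<in> Units (residue_ring m)"
      then have a: "0 < a" "a < m" "coprime a m" by (simp_all add: R.res_units_eq)
      obtain d where d: "d \<in> difference_triples m" "[d i = a] (mod m)" "[d j = u * a] (mod m)"
        using triple_with_entries[OF m_pos ijk a(3)] .
      have "d i = a" using d(1,2) a by (simp add: cong_def)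
      then show "a \<in> (\<lambda>d. d i) ` ?D" using d by blast
    qed
  qed
  then show ?thesis by (simp add: bij_betw_same_card R.totient_eq)
qed

lemma card_fixed_pairs_eq_units_times_roots:
  assumes "distinct [i, j, k]"
    and unit: "\<And>u. m dvd poly f u \<Longrightarrow> coprime u m"
    and fixed_iff: "\<And>u d. d \<in> difference_triples m \<Longrightarrow>
      (\<forall>x. [d (\<pi> x) = u * d x] (mod m)) \<longleftrightarrow> [d j = u * d i] (mod m) \<and> m dvd poly f u"
  shows "card (fixed_pairs \<pi>) = totient (nat m) * card (roots_mod f m)"
proof -
  have "u \<in> Units (residue_ring m) \<and> m dvd poly f u \<longleftrightarrow> u \<in> roots_mod f m" for u
    using unit[of u] m_gt_1 by (cases "u = 0") (auto simp: R.res_units_eq roots_mod_def)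
  then have "fixed_pairs \<pi> =
      (SIGMA u:roots_mod f m. {d \<in> difference_triples m. [d j = u * d i] (mod m)})"
    using fixed_iff unfolding fixed_pairs_def by blast
  then show ?thesis
    using finite_difference_triples finite_roots_mod
    by (simp add: card_triples_with_ratio[OF assms(1)])
qed

lemma coprime_if_square_eq_one:
  assumes "m dvd poly square_minus_one u"
  shows "coprime u m"
proof -
  have "[u * u = 1] (mod m)"
    using assms by (simp add: poly_square_minus_one cong_iff_dvd_diff algebra_simps)
  then show ?thesis using coprime_iff_invertible_int by blast
qed

lemma coprime_if_cyclotomic3_root:
  assumes "m dvd poly cyclotomic3 u"
  shows "coprime u m"
proof -
  have "[u * (- u - 1) = 1] (mod m)"
    using assms
    unfolding poly_cyclotomic3 power2_eq_square cong_iff_dvd_diff by Groebner_Basis.algebra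
  then show ?thesis using coprime_iff_invertible_int by blast
qed

lemma card_fixed_pairs_transposition:
  assumes ijk: "distinct [i, j, k]" and \<pi>: "\<pi> i = j" "\<pi> j = i" "\<pi> k = k"
  shows "card (fixed_pairs \<pi>) = totient (nat m) * card (roots_mod square_minus_one m)"
proof (rule card_fixed_pairs_eq_units_times_roots[OF ijk coprime_if_square_eq_one])
  fix u d assume d: "d \<in> difference_triples m"
  have all: "(\<forall>x. P x) \<longleftrightarrow> P i \<and> P j \<and> P k" for P using color_exhaust_distinct[OF ijk] by metis
  have k: "m dvd d k - (- d i - d j)"
    using third_entry[OF d ijk] by (simp only: cong_iff_dvd_diff)
  show "(\<forall>x. [d (\<pi> x) = u * d x] (mod m)) \<longleftrightarrow>
      [d j = u * d i] (mod m) \<and> m dvd poly square_minus_one u"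
    unfolding all \<pi>
  proof (intro iffI conjI; elim conjE)
    assume fixed: "[d j = u * d i] (mod m)" "[d i = u * d j] (mod m)"
    show "[d j = u * d i] (mod m)" by fact
    have "coprime (d i) m" using coprime_entry_if_multiple[OF d ijk fixed(1)] .
    moreover have "m dvd (u - 1) * (u + 1) * d i"
      using fixed unfolding cong_iff_dvd_diff by Groebner_Basis.algebra
    ultimately show "m dvd poly square_minus_one u"
      unfolding poly_square_minus_one by (simp add: coprime_dvd_mult_left_iff coprime_commute)
  next
    assume root: "[d j = u * d i] (mod m)" "m dvd poly square_minus_one u"
    show "[d i = u * d j] (mod m)" "[d k = u * d k] (mod m)"
      using root k unfolding poly_square_minus_one cong_iff_dvd_diff by Groebner_Basis.algebra+
  qed
qed

lemma card_fixed_pairs_three_cycle: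
  assumes ijk: "distinct [i, j, k]" and \<pi>: "\<pi> i = j" "\<pi> j = k" "\<pi> k = i"
  shows "card (fixed_pairs \<pi>) = totient (nat m) * card (roots_mod cyclotomic3 m)"
proof (rule card_fixed_pairs_eq_units_times_roots[OF ijk coprime_if_cyclotomic3_root])
  fix u d assume d: "d \<in> difference_triples m"
  have all: "(\<forall>x. P x) \<longleftrightarrow> P i \<and> P j \<and> P k" for P using color_exhaust_distinct[OF ijk] by metis
  have k: "m dvd d k - (- d i - d j)"
    using third_entry[OF d ijk] by (simp only: cong_iff_dvd_diff)
  show "(\<forall>x. [d (\<pi> x) = u * d x] (mod m)) \<longleftrightarrow>
      [d j = u * d i] (mod m) \<and> m dvd poly cyclotomic3 u"
    unfolding all \<pi>
  proof (intro iffI conjI; elim conjE)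
    assume fixed: "[d j = u * d i] (mod m)" "[d k = u * d j] (mod m)"
    show "[d j = u * d i] (mod m)" by fact
    have "coprime (d i) m" using coprime_entry_if_multiple[OF d ijk fixed(1)] .
    moreover have "m dvd (u * u + u + 1) * d i"
      using fixed k unfolding cong_iff_dvd_diff by Groebner_Basis.algebra
    ultimately show "m dvd poly cyclotomic3 u"
      unfolding poly_cyclotomic3
      by (simp add: coprime_dvd_mult_left_iff coprime_commute power2_eq_square)
  next
    assume root: "[d j = u * d i] (mod m)" "m dvd poly cyclotomic3 u"
    show "[d k = u * d j] (mod m)" "[d i = u * d k] (mod m)"
      using root k
      unfolding poly_cyclotomic3 power2_eq_square cong_iff_dvd_diff by Groebner_Basis.algebra+
  qed
qed

lemma card_symmetry_orbits:
  "card (symmetry_orbit m ` difference_triples m) * (6 * totient (nat m)) =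
     card (difference_triples m) + 3 * (totient (nat m) * card (roots_mod square_minus_one m))
       + 2 * (totient (nat m) * card (roots_mod cyclotomic3 m))"
proof -
  let ?A = "totient (nat m) * card (roots_mod square_minus_one m)"
  let ?B = "totient (nat m) * card (roots_mod cyclotomic3 m)"
  have "case_color Red Green Blue = (\<lambda>i. i)" by (rule ext) (simp split: color.split)
  then have "card (fixed_pairs (case_color Red Green Blue)) = card (difference_triples m)"
    using card_fixed_pairs_identity by simp
  moreover have "card (fixed_pairs (case_color Green Red Blue)) = ?A"
    by (rule card_fixed_pairs_transposition[of Red Green Blue]) simp_all
  moreover have "card (fixed_pairs (case_color Blue Green Red)) = ?A"
    by (rule card_fixed_pairs_transposition[of Red Blue Green]) simp_all
  moreover have "card (fixed_pairs (case_color Red Blue Green)) = ?A"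
    by (rule card_fixed_pairs_transposition[of Green Blue Red]) simp_all
  moreover have "card (fixed_pairs (case_color Green Blue Red)) = ?B"
    by (rule card_fixed_pairs_three_cycle[of Red Green Blue]) simp_all
  moreover have "card (fixed_pairs (case_color Blue Red Green)) = ?B"
    by (rule card_fixed_pairs_three_cycle[of Red Blue Green]) simp_all
  ultimately show ?thesis
    unfolding card_symmetry_orbits_fixed_pairs bij_color_eq by (simp add: fun_eq_iff all_color)
qed

end

definition primitive_tuples :: "nat set \<Rightarrow> 'i set \<Rightarrow> nat \<Rightarrow> ('i \<Rightarrow> int) set" where
  "primitive_tuples Q I n = {f \<in> I \<rightarrow>\<^sub>E {0..<int n}. \<forall>q\<in>Q. \<exists>i\<in>I. \<not> int q dvd f i}"

lemma finite_primitive_tuples: "finite I \<Longrightarrow> finite (primitive_tuples Q I n)"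
  by (rule finite_subset[of _ "I \<rightarrow>\<^sub>E {0..<int n}"]) (auto simp: primitive_tuples_def finite_PiE)

lemma primitive_tuples_scale:
  assumes "q > 0" and coprime: "\<And>r. r \<in> Q \<Longrightarrow> coprime r q"
  shows "{f \<in> primitive_tuples Q I (q * k). \<forall>i\<in>I. int q dvd f i}
    = (\<lambda>f. \<lambda>i\<in>I. int q * f i) ` primitive_tuples Q I k" (is "?D = ?g ` _")
proof -
  have dvd_iff: "int r dvd int q * a \<longleftrightarrow> int r dvd a" if "r \<in> Q" for r a
    using coprime[OF that] by (simp add: coprime_dvd_mult_right_iff)
  show ?thesis
  proof (intro equalityI subsetI)
    fix f assume "f \<in> ?D"
    then have f: "f \<in> I \<rightarrow>\<^sub>E {0..<int (q * k)}" "\<forall>r\<in>Q. \<exists>i\<in>I. \<not> int r dvd f i" "\<forall>i\<in>I. int q dvd f i"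
      by (auto simp: primitive_tuples_def)
    define h where "h = (\<lambda>i\<in>I. f i div int q)"
    have scale: "int q * h i = f i" if "i \<in> I" for i using f(3) that by (simp add: h_def)
    have "h i \<in> {0..<int k}" if "i \<in> I" for i
      using PiE_mem[OF f(1) that] \<open>q > 0\<close>
      by (simp add: scale[OF that, symmetric] zero_le_mult_iff)
    then have "h \<in> I \<rightarrow>\<^sub>E {0..<int k}" by (auto simp: h_def)
    moreover have "\<forall>r\<in>Q. \<exists>i\<in>I. \<not> int r dvd h i" using f(2) scale dvd_iff by metis
    ultimately have "h \<in> primitive_tuples Q I k" by (simp add: primitive_tuples_def)
    moreover have "f = ?g h"
      using f(1) scale by (intro extensionalityI[of f I]) (simp_all add: PiE_def)
    ultimately show "f \<in> ?g ` primitive_tuples Q I k" by blast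
  next
    fix f assume "f \<in> ?g ` primitive_tuples Q I k"
    then obtain h where h: "h \<in> I \<rightarrow>\<^sub>E {0..<int k}" "\<forall>r\<in>Q. \<exists>i\<in>I. \<not> int r dvd h i" and f: "f = ?g h"
      by (auto simp: primitive_tuples_def)
    have scale: "f i = int q * h i" if "i \<in> I" for i using that by (simp add: f)
    have "f i \<in> {0..<int (q * k)}" if "i \<in> I" for i
      using PiE_mem[OF h(1) that] \<open>q > 0\<close> by (simp add: scale[OF that])
    then have "f \<in> I \<rightarrow>\<^sub>E {0..<int (q * k)}" by (auto simp: f)
    moreover have "\<forall>r\<in>Q. \<exists>i\<in>I. \<not> int r dvd f i" using h(2) scale dvd_iff by metis
    ultimately show "f \<in> ?D" using scale by (simp add: primitive_tuples_def)
  qed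
qed

lemma card_primitive_tuples_insert:
  assumes "finite I" "q > 0" and coprime: "\<And>r. r \<in> Q \<Longrightarrow> coprime r q"
  shows "real (card (primitive_tuples (insert q Q) I (q * k))) =
    real (card (primitive_tuples Q I (q * k))) - real (card (primitive_tuples Q I k))"
proof -
  let ?T = "primitive_tuples Q I (q * k)"
  let ?D = "{f \<in> ?T. \<forall>i\<in>I. int q dvd f i}" and ?g = "\<lambda>f. \<lambda>i\<in>I. int q * f i"
  have inj: "inj_on ?g (primitive_tuples Q I k)"
  proof (rule inj_onI)
    fix f h assume fh: "f \<in> primitive_tuples Q I k" "h \<in> primitive_tuples Q I k"
      and eq: "?g f = ?g h"
    have "f i = h i" if "i \<in> I" for i using fun_cong[OF eq, of i] that \<open>q > 0\<close> by simp
    then show "f = h"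
      using fh by (intro extensionalityI[of f I]) (simp_all add: primitive_tuples_def PiE_def)
  qed
  have "?D = ?g ` primitive_tuples Q I k"
    by (rule primitive_tuples_scale[OF \<open>q > 0\<close> coprime])
  then have card_D: "card ?D = card (primitive_tuples Q I k)"
    using card_image[OF inj] by (simp only:)
  have fin: "finite ?T" by (rule finite_primitive_tuples) fact
  have sub: "?D \<subseteq> ?T" by blast
  have "primitive_tuples (insert q Q) I (q * k) = ?T - ?D"
    by (auto simp: primitive_tuples_def)
  then have "card (primitive_tuples (insert q Q) I (q * k)) = card ?T - card ?D"
    using card_Diff_subset[OF finite_subset[OF sub fin] sub] by simp
  moreover have "card ?D \<le> card ?T" by (rule card_mono[OF fin sub])
  ultimately show ?thesis unfolding card_D by (simp add: of_nat_diff)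
qed

lemma card_primitive_tuples:
  assumes "finite Q" "finite I" "\<And>q. q \<in> Q \<Longrightarrow> prime q" "\<And>q. q \<in> Q \<Longrightarrow> q dvd n"
  shows "real (card (primitive_tuples Q I n)) = real n ^ card I * (\<Prod>q\<in>Q. 1 - 1 / real q ^ card I)"
  using assms(1,3,4)
proof (induction Q arbitrary: n rule: finite_induct)
  case empty
  have "card (primitive_tuples {} I n) = n ^ card I"
    using assms(2) by (simp add: primitive_tuples_def card_PiE)
  then show ?case by simp
next
  case (insert q Q)
  let ?P = "\<Prod>q\<in>Q. 1 - 1 / real q ^ card I"
  have q: "prime q" "q > 0" using insert.prems prime_gt_0_nat by auto
  obtain k where n: "n = q * k" using insert.prems(2) by auto
  have coprime: "coprime r q" if "r \<in> Q" for r
    using that insert q by (intro primes_coprime) auto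
  have "r dvd k" if "r \<in> Q" for r
    using insert.prems(2)[of r] that coprime[OF that] n by (simp add: coprime_dvd_mult_right_iff)
  then have IH: "real (card (primitive_tuples Q I n)) = real n ^ card I * ?P"
    "real (card (primitive_tuples Q I k)) = real k ^ card I * ?P"
    using insert by simp_all
  have "real (card (primitive_tuples (insert q Q) I n)) =
      real n ^ card I * ?P - real k ^ card I * ?P"
    using card_primitive_tuples_insert[OF assms(2) q(2) coprime, of Q k] IH unfolding n by simp
  also have "\<dots> = real n ^ card I * (1 - 1 / real q ^ card I) * ?P"
    using q(2) n by (simp add: field_simps)
  finally show ?case using insert.hyps by (simp add: mult.assoc)
qed

lemma coprime_Gcd_iff_prime_factors:
  assumes "v > 0"
  shows "coprime (Gcd X) (int v) \<longleftrightarrow> (\<forall>q\<in>prime_factors v. \<exists>x\<in>X. \<not> int q dvd x)"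
proof
  assume coprime: "coprime (Gcd X) (int v)"
  show "\<forall>q\<in>prime_factors v. \<exists>x\<in>X. \<not> int q dvd x"
  proof (intro ballI, rule ccontr)
    fix q assume q: "q \<in> prime_factors v" and "\<not> (\<exists>x\<in>X. \<not> int q dvd x)"
    then have "int q dvd Gcd X" "int q dvd int v"
      by (auto intro: Gcd_greatest)
    then have "is_unit (int q)" using coprime coprime_common_divisor by blast
    then show False using in_prime_factors_imp_prime[OF q] by auto
  qed
next
  assume primes: "\<forall>q\<in>prime_factors v. \<exists>x\<in>X. \<not> int q dvd x"
  show "coprime (Gcd X) (int v)"
  proof (rule ccontr)
    assume "\<not> coprime (Gcd X) (int v)"
    then have "\<not> is_unit (gcd (Gcd X) (int v))" by (simp add: coprime_iff_gcd_eq_1)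
    moreover have "gcd (Gcd X) (int v) \<noteq> 0" using assms by simp
    ultimately obtain p where p: "prime p" "p dvd gcd (Gcd X) (int v)"
      using prime_divisor_exists by blast
    obtain q where q: "p = int q" using prime_ge_0_int[OF p(1)] zero_le_imp_eq_int by blast
    then have "q \<in> prime_factors v" using p assms by (simp add: prime_factors_dvd)
    moreover have "int q dvd x" if "x \<in> X" for x using p(2) q that by (auto simp: dvd_Gcd_iff)
    ultimately show False using primes by blast
  qed
qed

lemma restrict_triple_primitive:
  assumes "v > 0" and d: "d \<in> difference_triples (int v)"
  shows "restrict d {Red, Green} \<in> primitive_tuples (prime_factors v) {Red, Green} v"
proof -
  have "\<exists>i\<in>{Red, Green}. \<not> int q dvd d i" if q: "q \<in> prime_factors v" for q
  proof (rule ccontr)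
    assume not_ex: "\<not> (\<exists>i\<in>{Red, Green}. \<not> int q dvd d i)"
    have "int q dvd int v" using q by (simp add: in_prime_factors_imp_dvd)
    then have "int q dvd d i" for i
      using not_ex third_entry_dvd[OF d, of Red Green Blue "int q"] by (cases i) auto
    moreover have "coprime (Gcd (range d)) (int v)" using d by (simp add: difference_triples_def)
    ultimately show False
      using coprime_Gcd_iff_prime_factors[OF \<open>v > 0\<close>, of "range d"] q by blast
  qed
  then show ?thesis
    using difference_triplesD(1,2)[OF d] by (auto simp: primitive_tuples_def)
qed

lemma primitive_pair_extends_to_triple:
  assumes "v > 0" and "f \<in> primitive_tuples (prime_factors v) {Red, Green} v"
  obtains d where "d \<in> difference_triples (int v)" "f = restrict d {Red, Green}"
proof -
  have f: "f \<in> {Red, Green} \<rightarrow>\<^sub>E {0..<int v}"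
    and primes: "\<forall>q\<in>prime_factors v. \<exists>i\<in>{Red, Green}. \<not> int q dvd f i"
    using assms(2) by (auto simp: primitive_tuples_def)
  define d where "d = case_color (f Red) (f Green) ((- f Red - f Green) mod int v)"
  have "d \<in> difference_triples (int v)"
    unfolding difference_triples_def
  proof (intro CollectI conjI allI)
    show "d i \<in> {0..<int v}" for i
      using PiE_mem[OF f, of Red] PiE_mem[OF f, of Green] assms(1)
      by (cases i) (simp_all add: d_def)
    show "int v dvd (\<Sum>i\<in>UNIV. d i)"
      by (simp add: sum_color_distinct[of Red Green Blue] d_def dvd_eq_mod_eq_0 mod_simps)
    have "d i = f i" if "i \<in> {Red, Green}" for i using that by (auto simp: d_def)
    then have "\<exists>x\<in>range d. \<not> int q dvd x" if "q \<in> prime_factors v" for q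
      using bspec[OF primes that] by (metis rangeI)
    then show "coprime (Gcd (range d)) (int v)"
      using coprime_Gcd_iff_prime_factors[OF assms(1)] by simp
  qed
  moreover have "f = restrict d {Red, Green}"
    using f by (intro extensionalityI[of f "{Red, Green}"]) (auto simp: d_def PiE_def)
  ultimately show ?thesis by (rule that)
qed

lemma bij_betw_triples_primitive_pairs:
  assumes "v > 0"
  shows "bij_betw (\<lambda>d. restrict d {Red, Green}) (difference_triples (int v))
    (primitive_tuples (prime_factors v) {Red, Green} v)"
proof (rule bij_betw_imageI)
  show "inj_on (\<lambda>d. restrict d {Red, Green}) (difference_triples (int v))"
  proof (rule inj_onI)
    fix d e assume "d \<in> difference_triples (int v)" "e \<in> difference_triples (int v)"
      and eq: "restrict d {Red, Green} = restrict e {Red, Green}"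
    moreover have "d Red = e Red" "d Green = e Green"
      using fun_cong[OF eq, of Red] fun_cong[OF eq, of Green] by simp_all
    ultimately show "d = e" using triple_eqI[of d "int v" e Red Green Blue] by simp
  qed
  show "(\<lambda>d. restrict d {Red, Green}) ` difference_triples (int v) =
      primitive_tuples (prime_factors v) {Red, Green} v"
    using restrict_triple_primitive[OF assms] primitive_pair_extends_to_triple[OF assms] by blast
qed

lemma card_difference_triples:
  assumes "v > 0"
  shows "real (card (difference_triples (int v))) =
    (real v)\<^sup>2 * (\<Prod>q\<in>prime_factors v. 1 - 1 / (real q)\<^sup>2)"
proof -
  have "card {Red, Green} = 2" by simp
  then show ?thesis
    using card_primitive_tuples[of "prime_factors v" "{Red, Green}" v]
      bij_betw_same_card[OF bij_betw_triples_primitive_pairs[OF assms]]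
    by (simp add: in_prime_factors_imp_prime in_prime_factors_imp_dvd power2_eq_square)
qed

theorem real_card_symmetry_orbits:
  assumes "v > 1"
  shows "real (card (symmetry_orbit (int v) ` difference_triples (int v))) =
    real v / 6 * (\<Prod>p\<in>prime_factors v. 1 + 1 / real p)
      + real (card (roots_mod square_minus_one (int v))) / 2
      + real (card (roots_mod cyclotomic3 (int v))) / 3"
    (is "?K = real v / 6 * ?P + ?A / 2 + ?B / 3")
proof -
  interpret modulus "int v" using assms by unfold_locales simp
  have "v > 0" using assms by simp
  let ?t = "real (totient v)"
  have "(\<Prod>q\<in>prime_factors v. 1 - 1 / (real q)\<^sup>2) =
      (\<Prod>q\<in>prime_factors v. (1 - 1 / real q) * (1 + 1 / real q))"
    by (intro prod.cong refl) (simp add: algebra_simps power2_eq_square)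
  then have "real (card (difference_triples (int v))) = ?t * (real v * ?P)"
    unfolding card_difference_triples[OF \<open>v > 0\<close>] totient_formula2
    by (simp add: prod.distrib power2_eq_square)
  moreover have "?K * (6 * ?t) =
      real (card (difference_triples (int v))) + 3 * (?t * ?A) + 2 * (?t * ?B)"
    using arg_cong[OF card_symmetry_orbits, of real] by simp
  ultimately have "?t * (6 * ?K) = ?t * (real v * ?P + 3 * ?A + 2 * ?B)"
    by (simp add: algebra_simps)
  moreover have "?t \<noteq> 0" using assms by simp
  ultimately have "6 * ?K = real v * ?P + 3 * ?A + 2 * ?B" by (simp only: mult_cancel_left) simp
  then show ?thesis by (simp add: field_simps)
qed

section \<open>Degenerate orbits\<close>

definition nondegenerate :: "int \<Rightarrow> (color \<Rightarrow> int) \<Rightarrow> bool" where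
  "nondegenerate m d \<longleftrightarrow> (\<forall>i. \<not> m dvd 2 * d i) \<and> (\<forall>i j. i \<noteq> j \<longrightarrow> \<not> [d i = d j] (mod m))"

definition unit_triple :: "int \<Rightarrow> int \<Rightarrow> color \<Rightarrow> int" where
  "unit_triple m a = (\<lambda>i. case_color a 1 (- a - 1) i mod m)"

context modulus
begin

lemma symmetry_orbitE:
  assumes "d \<in> difference_triples m" "e \<in> symmetry_orbit m d"
  obtains \<pi> where "bij \<pi>" "\<And>c i. m dvd c * e (\<pi> i) \<longleftrightarrow> m dvd c * d i"
    "\<And>i j. [e (\<pi> i) = e (\<pi> j)] (mod m) \<longleftrightarrow> [d i = d j] (mod m)"
proof -
  obtain \<pi> u where "bij \<pi>" and u: "coprime u m" and e: "e = symmetry m (\<pi>, u) d"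
    using assms(2) by (auto simp: symmetry_orbit_def Group_Action.orbit_def carrier_symmetry_group
        R.res_units_eq)
  have entry: "[e (\<pi> i) = u * d i] (mod m)" for i
    using assms(1) \<open>bij \<pi>\<close> by (simp add: e symmetry_def bij_is_inj)
  have "m dvd c * e (\<pi> i) \<longleftrightarrow> m dvd c * d i" for c i
  proof -
    have "m dvd c * e (\<pi> i) \<longleftrightarrow> m dvd c * (u * d i)"
      by (intro cong_dvd_iff cong_scalar_left entry)
    also have "\<dots> \<longleftrightarrow> m dvd u * (c * d i)" by (simp only: mult.left_commute)
    also have "\<dots> \<longleftrightarrow> m dvd c * d i"
      using u by (simp add: coprime_dvd_mult_right_iff coprime_commute)
    finally show ?thesis .
  qed
  moreover have "[e (\<pi> i) = e (\<pi> j)] (mod m) \<longleftrightarrow> [d i = d j] (mod m)" for i j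
  proof -
    have "[e (\<pi> i) = e (\<pi> j)] (mod m) \<longleftrightarrow> [u * d i = u * d j] (mod m)"
      using entry[of i] entry[of j] cong_sym cong_trans by meson
    also have "\<dots> \<longleftrightarrow> [d i = d j] (mod m)" using u by (simp add: cong_mult_lcancel)
    finally show ?thesis .
  qed
  ultimately show ?thesis using \<open>bij \<pi>\<close> by (intro that)
qed

lemma nondegenerate_orbit_iff:
  assumes "d \<in> difference_triples m" "e \<in> symmetry_orbit m d"
  shows "nondegenerate m e \<longleftrightarrow> nondegenerate m d"
proof -
  obtain \<pi> where "bij \<pi>" and dvd_iff: "\<And>c i. m dvd c * e (\<pi> i) \<longleftrightarrow> m dvd c * d i"
    and cong_iff: "\<And>i j. [e (\<pi> i) = e (\<pi> j)] (mod m) \<longleftrightarrow> [d i = d j] (mod m)"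
    using symmetry_orbitE[OF assms] by metis
  have "nondegenerate m e \<longleftrightarrow>
      (\<forall>i. \<not> m dvd 2 * e (\<pi> i)) \<and> (\<forall>i j. i \<noteq> j \<longrightarrow> \<not> [e (\<pi> i) = e (\<pi> j)] (mod m))"
    unfolding nondegenerate_def using \<open>bij \<pi>\<close> by (metis bij_pointE)
  then show ?thesis unfolding dvd_iff cong_iff nondegenerate_def .
qed

lemma zero_entry_orbit_iff:
  assumes d: "d \<in> difference_triples m" and e: "e \<in> difference_triples m" "e \<in> symmetry_orbit m d"
  shows "(\<exists>i. e i = 0) \<longleftrightarrow> (\<exists>i. d i = 0)"
proof -
  obtain \<pi> where "bij \<pi>" and dvd_iff: "\<And>c i. m dvd c * e (\<pi> i) \<longleftrightarrow> m dvd c * d i"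
    using symmetry_orbitE[OF d e(2)] by metis
  have "e (\<pi> i) = 0 \<longleftrightarrow> d i = 0" for i
    using triple_entry_dvd_iff[OF d, of i] triple_entry_dvd_iff[OF e(1), of "\<pi> i"] dvd_iff[of 1 i]
    by simp
  then show ?thesis using \<open>bij \<pi>\<close> by (metis bij_pointE)
qed

lemma equal_entries_orbit_iff:
  assumes d: "d \<in> difference_triples m" and e: "e \<in> difference_triples m" "e \<in> symmetry_orbit m d"
  shows "(\<exists>i j. i \<noteq> j \<and> e i = e j) \<longleftrightarrow> (\<exists>i j. i \<noteq> j \<and> d i = d j)"
proof -
  obtain \<pi> where "bij \<pi>"
    and cong_iff: "\<And>i j. [e (\<pi> i) = e (\<pi> j)] (mod m) \<longleftrightarrow> [d i = d j] (mod m)"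
    using symmetry_orbitE[OF d e(2)] by metis
  have "(\<exists>i j. i \<noteq> j \<and> e i = e j) \<longleftrightarrow> (\<exists>i j. \<pi> i \<noteq> \<pi> j \<and> e (\<pi> i) = e (\<pi> j))"
    using \<open>bij \<pi>\<close> by (metis bij_pointE)
  moreover have "e (\<pi> i) = e (\<pi> j) \<longleftrightarrow> d i = d j" for i j
    using cong_iff triple_entry_cong_iff d e(1) by blast
  moreover have "\<pi> i = \<pi> j \<longleftrightarrow> i = j" for i j using \<open>bij \<pi>\<close> by (simp add: bij_def inj_eq)
  ultimately show ?thesis by simp
qed

lemma unit_triple_in_triples: "unit_triple m a \<in> difference_triples m"
proof (rule difference_triplesI)
  let ?d = "unit_triple m a"
  have "[?d Red + ?d Green + ?d Blue = a + 1 + (- a - 1)] (mod m)"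
    unfolding unit_triple_def by (intro cong_add) simp_all
  then show "m dvd (\<Sum>i\<in>UNIV. ?d i)"
    by (simp add: sum_color_distinct[of Red Green Blue] cong_0_iff)
next
  fix g assume "\<And>i. g dvd unit_triple m a i"
  from this[of Green] show "is_unit g" using m_gt_1 by (simp add: unit_triple_def)
qed (simp add: unit_triple_def m_pos)

lemma unit_triple_eq:
  assumes "0 \<le> a" "a < m"
  shows "unit_triple m a = case_color a 1 (m - a - 1)"
proof
  fix i
  have "(- a - 1) mod m = (m - a - 1) mod m"
    using mod_add_self2[of "- a - 1" m] by (simp add: algebra_simps)
  also have "\<dots> = m - a - 1" using assms by simp
  finally show "unit_triple m a i = case_color a 1 (m - a - 1) i"
    using assms m_gt_1 by (cases i) (simp_all add: unit_triple_def)
qed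

lemma mem_unit_triple_orbit:
  assumes d: "d \<in> difference_triples m" and ijk: "distinct [i, j, k]"
    and i: "[d i = d j * a] (mod m)"
  shows "d \<in> symmetry_orbit m (unit_triple m a)"
proof -
  obtain \<pi> where "bij \<pi>" and \<pi>: "\<pi> Red = i" "\<pi> Green = j" "\<pi> Blue = k"
    using bij_color_obtain[OF _ ijk, of Red Green Blue] by auto
  have "[d j * (unit_triple m a x) = d j * case_color a 1 (- a - 1) x] (mod m)" for x
    by (intro cong_scalar_left) (simp add: unit_triple_def)
  moreover have "[d (\<pi> x) = d j * case_color a 1 (- a - 1) x] (mod m)" for x
  proof (cases x)
    case Blue
    have "[d k = d j * (- a - 1)] (mod m)"
      using third_entry[OF d ijk] i unfolding cong_iff_dvd_diff by Groebner_Basis.algebra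
    then show ?thesis using Blue by (simp add: \<pi>)
  qed (simp_all add: \<pi> i)
  ultimately have "[d (\<pi> x) = d j * unit_triple m a x] (mod m)" for x
    using cong_sym cong_trans by blast
  then show ?thesis using mem_symmetry_orbit_iff[OF unit_triple_in_triples d] \<open>bij \<pi>\<close> by blast
qed

lemma half_entry_orbit:
  assumes d: "d \<in> difference_triples m" and half: "2 * d i = m"
  shows "d \<in> symmetry_orbit m (unit_triple m (d i))"
proof -
  have "even m" using half by (metis dvd_triv_left)
  have "\<exists>j. j \<noteq> i \<and> odd (d j)"
  proof (rule ccontr)
    assume all_even: "\<not> ?thesis"
    obtain j k where "distinct [i, j, k]" using other_colors .
    then have jki: "distinct [j, k, i]" by auto
    then have "even (d j)" "even (d k)" using all_even by auto
    then have "even (d i)" using third_entry_dvd[OF d jki \<open>even m\<close>] by blast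
    then have "even (d x)" for x using all_even by (cases "x = i") auto
    then have "is_unit (2 :: int)" using difference_triplesD(4)[OF d \<open>even m\<close>] by blast
    then show False by simp
  qed
  then obtain j where "j \<noteq> i" "odd (d j)" by blast
  then obtain c where "d j = 2 * c + 1" by (auto elim: oddE)
  then have "d j * d i - d i = m * c" using half by (simp add: algebra_simps)
  then have "[d i = d j * d i] (mod m)" by (metis cong_iff_dvd_diff cong_sym dvd_triv_left)
  moreover obtain k where "distinct [i, j, k]" using third_color \<open>j \<noteq> i\<close> by metis
  ultimately show ?thesis using mem_unit_triple_orbit[OF d] by blast
qed

definition degenerate_parameters :: "int set" where
  "degenerate_parameters = {a. a = 0 \<or> a = 1 \<or> 2 * a = m}"

lemma degenerate_mem_orbit:
  assumes d: "d \<in> difference_triples m" and "\<not> nondegenerate m d"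
  obtains a where "a \<in> degenerate_parameters" "d \<in> symmetry_orbit m (unit_triple m a)"
proof -
  consider (equal) i j where "i \<noteq> j" "[d i = d j] (mod m)" | (zero) i where "d i = 0"
    | (half) i where "m dvd 2 * d i" "d i \<noteq> 0"
    using assms(2) unfolding nondegenerate_def by blast
  then show ?thesis
  proof cases
    case (equal i j)
    then obtain k where "distinct [i, j, k]" using third_color by blast
    then have "d \<in> symmetry_orbit m (unit_triple m 1)"
      using equal(2) mem_unit_triple_orbit[OF d, of i j k 1] by simp
    then show ?thesis using that[of 1] by (simp add: degenerate_parameters_def)
  next
    case (zero i)
    obtain j k where "distinct [i, j, k]" using other_colors .
    then have "d \<in> symmetry_orbit m (unit_triple m 0)"
      using zero by (intro mem_unit_triple_orbit[OF d, of i j k]) simp_all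
    then show ?thesis using that[of 0] by (simp add: degenerate_parameters_def)
  next
    case (half i)
    obtain c where c: "2 * d i = m * c" using half(1) by (rule dvdE)
    have "m * 0 < m * c" "m * c < m * 2"
      using c half(2) difference_triplesD(1,2)[OF d, of i] by linarith+
    then have "c = 1" using m_pos by (simp only: mult_less_cancel_left_pos)
    then have "2 * d i = m" using c by simp
    then show ?thesis
      using that[of "d i"] half_entry_orbit[OF d] by (simp add: degenerate_parameters_def)
  qed
qed

lemma unit_triple_degenerate:
  assumes "a \<in> degenerate_parameters"
  shows "\<not> nondegenerate m (unit_triple m a)"
proof -
  have "m dvd 2 * unit_triple m a Red \<or> [unit_triple m a Red = unit_triple m a Green] (mod m)"
    using assms m_gt_1 by (auto simp: degenerate_parameters_def unit_triple_def)
  then show ?thesis unfolding nondegenerate_def by blast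
qed

lemma degenerate_orbits:
  "symmetry_orbit m ` {d \<in> difference_triples m. \<not> nondegenerate m d} =
     (\<lambda>a. symmetry_orbit m (unit_triple m a)) ` degenerate_parameters" (is "_ ` ?D = ?o ` _")
proof (intro equalityI subsetI)
  fix X assume "X \<in> symmetry_orbit m ` ?D"
  then obtain d where d: "d \<in> difference_triples m" "\<not> nondegenerate m d" "X = symmetry_orbit m d"
    by blast
  obtain a where "a \<in> degenerate_parameters" "d \<in> ?o a" using degenerate_mem_orbit[OF d(1,2)] .
  then show "X \<in> ?o ` degenerate_parameters"
    using d(3) symmetry_orbit_eq_iff[OF unit_triple_in_triples d(1), of a] by blast
qed (use unit_triple_in_triples unit_triple_degenerate in blast)

lemma inj_on_degenerate_orbits:
  assumes "m > 4"
  shows "inj_on (\<lambda>a. symmetry_orbit m (unit_triple m a)) degenerate_parameters" (is "inj_on ?o _")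
proof (rule inj_onI)
  have range: "0 \<le> a" "a < m - 1" if "a \<in> degenerate_parameters" for a
    using that assms by (auto simp: degenerate_parameters_def)
  have zero: "(\<exists>i. unit_triple m a i = 0) \<longleftrightarrow> a = 0" if "a \<in> degenerate_parameters" for a
    using range[OF that] unit_triple_eq[of a] by (auto simp: ex_color)
  have equal: "(\<exists>i j. i \<noteq> j \<and> unit_triple m a i = unit_triple m a j) \<longleftrightarrow> a = 1"
    if "a \<in> degenerate_parameters" for a
    using range[OF that] unit_triple_eq[of a] that assms
    by (auto simp: ex_color degenerate_parameters_def)
  fix a b assume ab: "a \<in> degenerate_parameters" "b \<in> degenerate_parameters" and "?o a = ?o b"
  then have mem: "unit_triple m b \<in> ?o a"
    using symmetry_orbit_eq_iff unit_triple_in_triples by blast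
  have "a = 0 \<longleftrightarrow> b = 0"
    using zero_entry_orbit_iff[OF unit_triple_in_triples unit_triple_in_triples mem] zero ab
    by blast
  moreover have "a = 1 \<longleftrightarrow> b = 1"
    using equal_entries_orbit_iff[OF unit_triple_in_triples unit_triple_in_triples mem] equal ab
    by blast
  ultimately show "a = b" using ab by (auto simp: degenerate_parameters_def)
qed

lemma card_degenerate_orbits:
  assumes "m > 4"
  shows "card (symmetry_orbit m ` {d \<in> difference_triples m. \<not> nondegenerate m d}) =
    (if odd m then 2 else 3)"
proof -
  have "degenerate_parameters = (if odd m then {0, 1} else {0, 1, m div 2})"
    by (auto simp: degenerate_parameters_def)
  then have "card degenerate_parameters = (if odd m then 2 else 3)" using assms by auto
  then show ?thesis
    unfolding degenerate_orbits by (simp add: card_image[OF inj_on_degenerate_orbits[OF assms]])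
qed

lemma card_nondegenerate_orbits:
  assumes "m > 4"
  shows "card (symmetry_orbit m ` {d \<in> difference_triples m. nondegenerate m d}) +
    (if odd m then 2 else 3) = card (symmetry_orbit m ` difference_triples m)"
proof -
  let ?D = "{d \<in> difference_triples m. \<not> nondegenerate m d}"
  let ?N = "{d \<in> difference_triples m. nondegenerate m d}"
  have "symmetry_orbit m ` ?N \<inter> symmetry_orbit m ` ?D = {}"
    using symmetry_orbit_eq_iff nondegenerate_orbit_iff by blast
  moreover have "difference_triples m = ?N \<union> ?D" by blast
  then have "symmetry_orbit m ` difference_triples m =
      symmetry_orbit m ` ?N \<union> symmetry_orbit m ` ?D"
    by (metis image_Un)
  ultimately show ?thesis
    using finite_difference_triples
    by (simp add: card_Un_disjoint flip: card_degenerate_orbits[OF assms])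
qed

end

section \<open>Base lines and difference triples\<close>

fun next_color :: "color \<Rightarrow> color" where
  "next_color Red = Green" | "next_color Green = Blue" | "next_color Blue = Red"

definition differences :: "(color \<Rightarrow> int) \<Rightarrow> color \<Rightarrow> int" where
  "differences s i = s (next_color i) - s (next_color (next_color i))"

definition base_line :: "(color \<Rightarrow> int) \<Rightarrow> color \<Rightarrow> int" where
  "base_line d = case_color 0 (d Red + d Green) (d Green)"

lemma difference_cases:
  assumes "x \<noteq> y"
  obtains i where "s x - s y = differences s i" | i where "s x - s y = - differences s i"
proof -
  have "\<exists>i. s x - s y = differences s i \<or> s x - s y = - differences s i"
    using assms by (cases x; cases y) (auto simp: ex_color differences_def)
  then show ?thesis using that by blast
qed

lemma sum_differences: "(\<Sum>i\<in>UNIV. differences s i) = 0"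
  by (simp add: sum_color_distinct[of Red Green Blue] differences_def)

lemma differences_base_line:
  assumes "d \<in> difference_triples m"
  shows "[differences (base_line d) i = d i] (mod m)"
proof (cases i)
  case Blue
  have "[d Blue = - d Red - d Green] (mod m)"
    using third_entry[OF assms, of Red Green Blue] by simp
  then show ?thesis using Blue by (simp add: differences_def base_line_def cong_sym_eq)
qed (simp_all add: differences_def base_line_def)

lemma nondegenerate_cong:
  assumes "\<And>i. [d i = e i] (mod m)"
  shows "nondegenerate m d \<longleftrightarrow> nondegenerate m e"
proof -
  have "m dvd 2 * d i \<longleftrightarrow> m dvd 2 * e i" for i
    by (rule cong_dvd_iff) (intro cong_scalar_left assms)
  moreover have "[d i = d j] (mod m) \<longleftrightarrow> [e i = e j] (mod m)" for i j
    using assms cong_sym cong_trans by meson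
  ultimately show ?thesis unfolding nondegenerate_def by simp
qed

lemma sidon_imp_nondegenerate:
  assumes "sidon m s"
  shows "nondegenerate m (differences s)"
proof -
  have neq: "next_color i \<noteq> next_color (next_color i)" for i by (cases i) auto
  have inj: "next_color i = next_color j \<Longrightarrow> i = j" for i j by (cases i; cases j) auto
  have "\<not> m dvd 2 * differences s i" for i
  proof
    let ?x = "next_color i" and ?y = "next_color (next_color i)"
    assume "m dvd 2 * differences s i"
    then have "[s ?x - s ?y = s ?y - s ?x] (mod m)"
      by (simp add: differences_def cong_iff_dvd_diff algebra_simps)
    then show False using sidonD[OF assms neq neq[symmetric]] neq by blast
  qed
  moreover have "\<not> [differences s i = differences s j] (mod m)" if "i \<noteq> j" for i j
    using sidonD[OF assms neq neq] inj that unfolding differences_def by blast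
  ultimately show ?thesis unfolding nondegenerate_def by blast
qed

lemma nondegenerate_imp_no_progression:
  assumes nondeg: "nondegenerate m (differences s)" and "x \<noteq> y"
  shows "\<not> [s x - s y = s y - s z] (mod m)"
proof -
  have not_dvd: "\<not> m dvd 2 * (s x - s y)"
    using nondeg unfolding nondegenerate_def
    by (cases rule: difference_cases[OF \<open>x \<noteq> y\<close>, of s]) simp_all
  consider (returns) "z = x" | (stays) "z = y" | (leaves) "distinct [x, y, z]"
    using \<open>x \<noteq> y\<close> by auto
  then show ?thesis
  proof cases
    case returns
    then show ?thesis using not_dvd by (simp add: cong_iff_dvd_diff algebra_simps)
  next
    case stays
    then show ?thesis
      using not_dvd dvd_mult[of m "s x - s y" 2] by (auto simp only: cong_0_iff diff_self)
  next
    case leaves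
    then have "\<exists>i j. i \<noteq> j \<and>
        (s x - s y = differences s i \<and> s y - s z = differences s j \<or>
         s x - s y = - differences s i \<and> s y - s z = - differences s j)"
      by (cases x; cases y; cases z) (auto simp: ex_color differences_def)
    then show ?thesis using nondeg unfolding nondegenerate_def by (metis cong_minus_minus_iff)
  qed
qed

lemma nondegenerate_imp_sidon:
  assumes nondeg: "nondegenerate m (differences s)"
  shows "sidon m s"
  unfolding sidon_def
proof (intro allI impI)
  note no_progression = nondegenerate_imp_no_progression[OF nondeg]
  have inj: "x = y" if "[s x = s y] (mod m)" for x y
  proof (rule ccontr)
    assume "x \<noteq> y"
    moreover have "[s x - s y = s y - s y] (mod m)" using that by (simp add: cong_diff_iff_cong_0)
    ultimately show False using no_progression by blast
  qed
  fix x x' y y' assume "x \<noteq> y" "x' \<noteq> y'" and eq: "[s x - s y = s x' - s y'] (mod m)"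
  then consider (same_start) "x = x'" | (same_end) "y = y'"
    | (precede) "x = y'" | (follow) "y = x'"
    by (cases x; cases y; cases x'; cases y') auto
  then show "x = x' \<and> y = y'"
  proof cases
    case same_start
    then have "[s y = s y'] (mod m)"
      using eq unfolding cong_iff_dvd_diff by simp (metis dvd_diff_commute)
    then show ?thesis using inj same_start by blast
  next
    case same_end
    then have "[s x = s x'] (mod m)" using eq unfolding cong_iff_dvd_diff by simp
    then show ?thesis using inj same_end by blast
  next
    case precede
    then show ?thesis using eq no_progression[of x' x y] \<open>x' \<noteq> y'\<close> cong_sym by blast
  next
    case follow
    then show ?thesis using eq no_progression[of x y y'] \<open>x \<noteq> y\<close> by blast
  qed
qed

lemma sidon_iff_nondegenerate: "sidon m s \<longleftrightarrow> nondegenerate m (differences s)"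
  using sidon_imp_nondegenerate nondegenerate_imp_sidon by (rule iffI)

lemma coprime_Gcd_differences_iff: "coprime (Gcd (range (differences s))) m \<longleftrightarrow> primitive m s"
proof -
  have "(\<forall>i. g dvd differences s i) \<longleftrightarrow> (\<forall>x y. g dvd s x - s y)" for g
  proof
    assume dvd: "\<forall>i. g dvd differences s i"
    show "\<forall>x y. g dvd s x - s y"
    proof (intro allI)
      fix x y
      show "g dvd s x - s y"
      proof (cases "x = y")
        case False
        then show ?thesis by (cases rule: difference_cases[of x y s]) (simp_all add: dvd)
      qed simp
    qed
  qed (simp add: differences_def)
  then show ?thesis unfolding primitive_iff coprime_Gcd_range_iff by simp
qed

lemma base_line_sidon_iff:
  assumes "d \<in> difference_triples m"
  shows "sidon m (base_line d) \<longleftrightarrow> nondegenerate m d"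
  unfolding sidon_iff_nondegenerate
  by (rule nondegenerate_cong) (rule differences_base_line[OF assms])

lemma base_line_primitive:
  assumes "d \<in> difference_triples m"
  shows "primitive m (base_line d)"
  using assms
    coprime_Gcd_range_cong[of "differences (base_line d)" d m, OF differences_base_line[OF assms]]
  unfolding coprime_Gcd_differences_iff[symmetric] by (simp add: difference_triples_def)

text \<open>Relabelling the colors by an odd permutation reverses the cyclic order, which negates the
  differences; the sign is absorbed into the multiplier.\<close>

lemma differences_permute:
  assumes "bij \<pi>"
  obtains \<epsilon> :: int where "\<epsilon> * \<epsilon> = 1" "\<And>t i. differences t (\<pi> i) = \<epsilon> * differences (t \<circ> \<pi>) i"
proof -
  have "\<pi> \<in> {\<pi>. bij \<pi>}" using assms by simp
  then have "(\<forall>t i. differences t (\<pi> i) = 1 * differences (t \<circ> \<pi>) i) \<or>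
      (\<forall>t i. differences t (\<pi> i) = - 1 * differences (t \<circ> \<pi>) i)"
    unfolding bij_color_eq by (auto simp: differences_def all_color)
  then show ?thesis using that[of 1] that[of "- 1"] by auto
qed

lemma affinely_equivalent_iff_differences:
  "affinely_equivalent m s t \<longleftrightarrow>
    (\<exists>\<pi> u. bij \<pi> \<and> (\<forall>i. [differences t (\<pi> i) = u * differences s i] (mod m)))"
proof
  assume "affinely_equivalent m s t"
  then obtain u \<pi> where \<pi>: "bij \<pi>" and u: "\<And>i j. [t (\<pi> i) - t (\<pi> j) = u * (s i - s j)] (mod m)"
    unfolding affinely_equivalent_def by blast
  obtain \<epsilon> where \<epsilon>: "\<And>t i. differences t (\<pi> i) = \<epsilon> * differences (t \<circ> \<pi>) i"
    using differences_permute[OF \<pi>] by blast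
  have "[differences t (\<pi> i) = (\<epsilon> * u) * differences s i] (mod m)" for i
    unfolding \<epsilon> mult.assoc by (rule cong_scalar_left) (simp add: differences_def u)
  then show "\<exists>\<pi> u. bij \<pi> \<and> (\<forall>i. [differences t (\<pi> i) = u * differences s i] (mod m))"
    using \<pi> by blast
next
  assume "\<exists>\<pi> u. bij \<pi> \<and> (\<forall>i. [differences t (\<pi> i) = u * differences s i] (mod m))"
  then obtain u \<pi> where \<pi>: "bij \<pi>"
    and u: "\<And>i. [differences t (\<pi> i) = u * differences s i] (mod m)" by blast
  obtain \<epsilon> :: int where sq: "\<epsilon> * \<epsilon> = 1"
    and \<epsilon>: "\<And>t i. differences t (\<pi> i) = \<epsilon> * differences (t \<circ> \<pi>) i"
    using differences_permute[OF \<pi>] by blast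
  have diff: "[differences (t \<circ> \<pi>) i = (\<epsilon> * u) * differences s i] (mod m)" for i
  proof -
    have "[\<epsilon> * differences t (\<pi> i) = \<epsilon> * (u * differences s i)] (mod m)"
      by (intro cong_scalar_left u)
    then show ?thesis unfolding \<epsilon> by (simp add: mult.assoc[symmetric] sq)
  qed
  have "[t (\<pi> x) - t (\<pi> y) = (\<epsilon> * u) * (s x - s y)] (mod m)" for x y
  proof (cases "x = y")
    case False
    have "\<exists>i. (\<forall>s. s x - s y = differences s i) \<or> (\<forall>s. s x - s y = - differences s i)"
      using False by (cases x; cases y) (auto simp: ex_color differences_def)
    then obtain i where "(\<forall>s. s x - s y = differences s i) \<or> (\<forall>s. s x - s y = - differences s i)"
      by blast
    moreover have "t (\<pi> x) - t (\<pi> y) = (t \<circ> \<pi>) x - (t \<circ> \<pi>) y" by simp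
    ultimately show ?thesis
      using diff[of i] by (metis cong_minus_minus_iff mult_minus_right)
  qed simp
  then show "affinely_equivalent m s t" unfolding affinely_equivalent_def using \<pi> by blast
qed

context modulus
begin

lemma affinely_equivalent_base_line_iff:
  assumes d: "d \<in> difference_triples m" and e: "e \<in> difference_triples m"
  shows "affinely_equivalent m (base_line d) (base_line e) \<longleftrightarrow> e \<in> symmetry_orbit m d"
proof -
  have "[differences (base_line e) (\<pi> i) = u * differences (base_line d) i] (mod m) \<longleftrightarrow>
      [e (\<pi> i) = u * d i] (mod m)" for \<pi> u i
    using differences_base_line[OF e, of "\<pi> i"]
      cong_scalar_left[OF differences_base_line[OF d, of i], of u]
    by (meson cong_sym cong_trans)
  then show ?thesis
    unfolding affinely_equivalent_iff_differences mem_symmetry_orbit_iff[OF d e] by simp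
qed

lemma normalized_differences:
  assumes "primitive m s"
  defines "d \<equiv> \<lambda>i. differences s i mod m"
  shows "d \<in> difference_triples m" "nondegenerate m d \<longleftrightarrow> nondegenerate m (differences s)"
    "affinely_equivalent m s (base_line d)"
proof -
  have cong: "[d i = differences s i] (mod m)" for i by (simp add: d_def)
  have "[(\<Sum>i\<in>UNIV. d i) = (\<Sum>i\<in>UNIV. differences s i)] (mod m)" by (intro cong_sum cong)
  moreover have "coprime (Gcd (range d)) m"
    using assms(1) coprime_Gcd_range_cong[of d "differences s" m, OF cong]
      coprime_Gcd_differences_iff by blast
  ultimately show d: "d \<in> difference_triples m"
    using m_pos by (simp add: difference_triples_def sum_differences cong_0_iff d_def)
  show "nondegenerate m d \<longleftrightarrow> nondegenerate m (differences s)" by (rule nondegenerate_cong[OF cong])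
  show "affinely_equivalent m s (base_line d)"
    unfolding affinely_equivalent_iff_differences
  proof (intro exI conjI allI)
    show "bij id" by (rule bij_id)
    show "[differences (base_line d) (id i) = 1 * differences s i] (mod m)" for i
      using differences_base_line[OF d, of i] cong[of i] by (metis cong_trans id_apply mult_1)
  qed
qed

abbreviation triple_circulant :: "(color \<Rightarrow> int) \<Rightarrow> nat incidence" where
  "triple_circulant d \<equiv> circulant m (base_line d)"

lemma configuration_coordinatization_circulant:
  assumes "d \<in> difference_triples m" "nondegenerate m d"
  shows "configuration_coordinatization m (base_line d) (circulant_points m) (triple_circulant d)"
  using assms base_line_sidon_iff base_line_primitive coordinatization_circulant[OF m_pos]
  by (simp add: configuration_coordinatization_def configuration_coordinatization_axioms_def)

lemma circulant_connected_cyclic: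
  assumes "d \<in> difference_triples m" "nondegenerate m d"
  shows "triple_circulant d \<in> connected_cyclic_configurations (nat m) 3"
proof -
  interpret configuration_coordinatization m "base_line d" "circulant_points m"
      "triple_circulant d"
    using configuration_coordinatization_circulant[OF assms] .
  show ?thesis
    using balanced_configuration connected cyclic
    by (simp add: connected_cyclic_configurations_def)
qed

lemma isomorphic_circulants_iff:
  assumes "\<not> m dvd 3" and d: "d \<in> difference_triples m" "nondegenerate m d"
    and e: "e \<in> difference_triples m" "nondegenerate m e"
  shows "(\<exists>f. isomorphism f (triple_circulant d) (triple_circulant e)) \<longleftrightarrow> e \<in> symmetry_orbit m d"
proof -
  interpret D: configuration_coordinatization m "base_line d" "circulant_points m"
      "triple_circulant d"
    using configuration_coordinatization_circulant[OF d] .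
  interpret E: configuration_coordinatization m "base_line e" "circulant_points m"
      "triple_circulant e"
    using configuration_coordinatization_circulant[OF e] .
  have "(\<exists>f. isomorphism f (triple_circulant d) (triple_circulant e)) \<longleftrightarrow>
      affinely_equivalent m (base_line d) (base_line e)"
  proof
    assume "\<exists>f. isomorphism f (triple_circulant d) (triple_circulant e)"
    then obtain f where "isomorphism f (triple_circulant d) (triple_circulant e)" by blast
    then have "coordinatization m (base_line d) (f \<circ> circulant_points m) (triple_circulant e)"
      by (rule coordinatization_image[OF D.coordinatization_axioms])
    then have "configuration_coordinatization m (base_line d) (f \<circ> circulant_points m)
        (triple_circulant e)"
      using D.sidon D.primitive
      by (intro configuration_coordinatization.intro configuration_coordinatization_axioms.intro)
    then show "affinely_equivalent m (base_line d) (base_line e)"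
      using E.configuration_coordinatization_axioms assms(1)
      by (rule configuration_coordinatizations_affinely_equivalent)
  next
    assume "affinely_equivalent m (base_line d) (base_line e)"
    then obtain \<psi> where "coordinatization m (base_line e) \<psi> (triple_circulant d)"
      using coordinatization_affine_change[OF D.coordinatization_axioms _ E.primitive] by blast
    then show "\<exists>f. isomorphism f (triple_circulant d) (triple_circulant e)"
      using coordinatization.isomorphic_circulant by blast
  qed
  also have "\<dots> \<longleftrightarrow> e \<in> symmetry_orbit m d"
    by (rule affinely_equivalent_base_line_iff[OF d(1) e(1)])
  finally show ?thesis .
qed

lemma isomorphic_circulant_exists:
  assumes C: "C \<in> connected_cyclic_configurations (nat m) 3"
  obtains d f where "d \<in> difference_triples m" "nondegenerate m d"
    "isomorphism f C (triple_circulant d)"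
proof -
  have "configuration (nat m) 3 (nat m) 3 C" "connected_configuration C" "cyclic_configuration C"
    using C by (simp_all add: connected_cyclic_configurations_def balanced_configuration_def)
  then obtain s :: "color \<Rightarrow> int" and \<phi> where "configuration_coordinatization (int (nat m)) s \<phi> C"
    using connected_cyclic_configuration_coordinatization[where ?'c = color] by (metis card_color)
  then interpret configuration_coordinatization m s \<phi> C using m_pos by simp
  define d where "d = (\<lambda>i. differences s i mod m)"
  note d = normalized_differences[OF primitive, folded d_def]
  have "nondegenerate m d" using d(2) sidon by (simp add: sidon_iff_nondegenerate)
  moreover obtain \<psi> where "coordinatization m (base_line d) \<psi> C"
    using coordinatization_affine_change[OF coordinatization_axioms d(3)]
      base_line_primitive[OF d(1)] by blast
  then obtain f where "isomorphism f C (triple_circulant d)"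
    using coordinatization.isomorphic_circulant by blast
  ultimately show ?thesis using that d(1) by blast
qed

end

section \<open>The number of connected cyclic configurations\<close>

lemma card_image_eq_if_same_kernel:
  assumes "finite A" and kernel: "\<And>a b. a \<in> A \<Longrightarrow> b \<in> A \<Longrightarrow> f a = f b \<longleftrightarrow> g a = g b"
  shows "card (f ` A) = card (g ` A)"
proof (rule bij_betw_same_card)
  let ?a = "inv_into A f"
  have a: "?a (f x) \<in> A" "g (?a (f x)) = g x" if "x \<in> A" for x
    using that inv_into_into[of "f x" f A] f_inv_into_f[of "f x" f A] kernel by auto
  show "bij_betw (\<lambda>y. g (?a y)) (f ` A) (g ` A)"
    using a kernel by (intro bij_betw_imageI inj_onI) (auto simp: image_image)
qed

theorem num_connected_cyclic_eq_card_orbits: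
  assumes "v > 4"
  shows "num_connected_cyclic v 3 =
    card (symmetry_orbit (int v) ` {d \<in> difference_triples (int v). nondegenerate (int v) d})"
proof -
  interpret modulus "int v" using assms by unfold_locales simp
  let ?S = "connected_cyclic_configurations v 3"
  let ?N = "{d \<in> difference_triples (int v). nondegenerate (int v) d}"
  let ?c = triple_circulant
  have "\<not> int v dvd 3" using assms by (auto dest: zdvd_imp_le)
  have c_in: "?c d \<in> ?S" if "d \<in> ?N" for d using circulant_connected_cyclic[of d] that by simp
  have "?S // isomorphic_on ?S = (\<lambda>d. isomorphic_on ?S `` {?c d}) ` ?N"
  proof (intro equalityI subsetI)
    fix X assume "X \<in> ?S // isomorphic_on ?S"
    then obtain C where C: "C \<in> ?S" "X = isomorphic_on ?S `` {C}" by (rule quotientE)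
    then have "C \<in> connected_cyclic_configurations (nat (int v)) 3" by simp
    then obtain d f where "d \<in> difference_triples (int v)" "nondegenerate (int v) d"
        "isomorphism f C (?c d)"
      by (rule isomorphic_circulant_exists)
    then have d: "d \<in> ?N" and "\<exists>f. isomorphism f C (?c d)" by blast+
    then have "(C, ?c d) \<in> isomorphic_on ?S" using C(1) c_in unfolding isomorphic_on_def by blast
    then have "X = isomorphic_on ?S `` {?c d}"
      unfolding C(2) by (rule equiv_class_eq[OF equiv_isomorphic_on])
    then show "X \<in> (\<lambda>d. isomorphic_on ?S `` {?c d}) ` ?N" using d by blast
  qed (use c_in in \<open>auto intro: quotientI\<close>)
  also have "card \<dots> = card (symmetry_orbit (int v) ` ?N)"
  proof (rule card_image_eq_if_same_kernel)
    show "finite ?N" using finite_difference_triples by simp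
    fix d e assume de: "d \<in> ?N" "e \<in> ?N"
    have "isomorphic_on ?S `` {?c d} = isomorphic_on ?S `` {?c e} \<longleftrightarrow>
        (\<exists>f. isomorphism f (?c d) (?c e))"
      using eq_equiv_class_iff[OF equiv_isomorphic_on c_in c_in] de c_in
      by (auto simp: isomorphic_on_def)
    also have "\<dots> \<longleftrightarrow> symmetry_orbit (int v) d = symmetry_orbit (int v) e"
      using isomorphic_circulants_iff[OF \<open>\<not> int v dvd 3\<close>] symmetry_orbit_eq_iff de by simp
    finally show "isomorphic_on ?S `` {?c d} = isomorphic_on ?S `` {?c e} \<longleftrightarrow>
      symmetry_orbit (int v) d = symmetry_orbit (int v) e" .
  qed
  finally show ?thesis unfolding num_connected_cyclic_def .
qed

theorem theoremA:
  fixes v :: nat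
  assumes "v > 4"
  shows "real (num_connected_cyclic v 3) =
    (if odd v
     then real v / 6 * (\<Prod>p\<in>prime_factors v. 1 + 1 / real p)
            + alpha v * 2 ^ card (prime_factors v) - 2
     else real v / 6 * (\<Prod>p\<in>prime_factors v. 1 + 1 / real p)
            + beta v * 2 ^ card (prime_factors v) - 3)"
proof -
  interpret modulus "int v" using assms by unfold_locales simp
  have v: "v > 1" "v > 0" using assms by simp_all
  have "real (num_connected_cyclic v 3) + (if odd v then 2 else 3) =
      real (card (symmetry_orbit (int v) ` difference_triples (int v)))"
    using arg_cong[OF card_nondegenerate_orbits, of real] assms
    by (simp add: num_connected_cyclic_eq_card_orbits split: if_splits)
  also have "\<dots> = real v / 6 * (\<Prod>p\<in>prime_factors v. 1 + 1 / real p)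
      + (if odd v then 1 else 2 * beta v) * 2 ^ card (prime_factors v) / 2
      + (if odd v then 3 * alpha v - 3/2 else 0) * 2 ^ card (prime_factors v) / 3"
    unfolding real_card_symmetry_orbits[OF v(1)] card_square_minus_one_roots[OF v(2)]
      card_cyclotomic3_roots[OF v(2)] ..
  finally show ?thesis by (simp add: field_simps split: if_splits)
qed

end
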